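(* Assume: (A1) the solution set $S_1$ of the variational inequality is nonempty; (A2) $F$ is monotone, i.e. $\langle F(x)-F(y),x-y\rangle\ge 0$ for all $x,y\in K$; (A3) $F$ has a stochastic oracle $F_\xi$ that is variable $\bar L$-Lipschitz in mean; (A4) $F$ is $L$-Lipschitz continuous, i.e. $\|F(x)-F(y)\|_*\le L\|x-y\|$ for all $x,y\in K$. Let $\{x_s\}$ be generated by the algorithm with $p\in(0,1)$, $\gamma\in(p,1)$ chosen as $$p=\frac1M,\qquad\gamma=p+\frac1{\sqrt M},\qquad\alpha=\min\left\{\frac{\gamma-p}{2(1-p)},\ \frac{(1-\gamma)b}{(1-p)(2\bar L^2+bL^2)}\right\}.$$ Let $C$ be a compact subset of $K$, $\mathrm{Gap}(z)=\max_{u\in C}\{\langle F(u),z-u\rangle+g(z)-g(u)\}$ and $z^S=\frac1S\sum_{s=0}^{S-1}x_{s+1}$. Then $$\mathbb E\left[\mathrm{Gap}(z^S)\right]\le\mathcal O\left(\frac{\sqrt M}{S}\right),$$ and the total average complexity of the algorithm to reach an $\epsilon$-gap, i.e. $\mathbb E[\mathrm{Gap}(z^S)]\le\epsilon$, is $\mathcal O\left(\frac{\sqrt M}{\epsilon}\right)$.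
   Context: Setting. $\mathcal X$ is a finite-dimensional space with inner product $\langle\cdot,\cdot\rangle$ and a norm $\|\cdot\|$ with dual norm $\|\cdot\|_*$. $K\subset\mathcal X$ is nonempty, closed and convex; $g:K\to(-\infty,+\infty]$ is proper, convex, lower semicontinuous; $F:\mathrm{dom}\,g\to\mathcal X$ is an operator of the form $F=\frac1M\sum_{i=1}^M F_i$. The variational inequality is: find $x^*\in K$ with $\langle F(x^* ),y-x^*\rangle+g(y)-g(x^* )\ge 0$ for all $y\in K$; $S_1$ is its solution set. Bregman distance. $f:K\to(-\infty,+\infty]$ is proper, convex, lower semicontinuous, $\mathrm{dom}\,g\subset\mathrm{dom}\,f$, $f$ is differentiable on $\mathrm{dom}(\partial f)=\{x\in\mathrm{dom} f:\partial f(x)\ne\emptyset\}$ and 1-strongly convex: $f(x)\ge f(y)+\langle\nabla f(y),x-y\rangle+\frac12\|x-y\|^2$ for $x\in\mathrm{dom} f$, $y\in\mathrm{dom}(\partial f)$. $D(x,y)=f(x)-f(y)-\langle\nabla f(y),x-y\rangle$ for $x\in\mathrm{dom}\,g$, $y\in\mathrm{dom}(\partial f)$. Stochastic oracle. $F$ has a stochastic oracle $F_\xi$ that is variable $\bar L$-Lipschitz in mean if for any $x,y\in\mathrm{dom}\,g$ there is a distribution $Q_{x,y}$ of $\xi$ such that (i) $F(z)=\mathbb E_{\xi\sim Q_{x,y}}[F_\xi(z)]$ for all $z\in\mathrm{dom}\,g$; (ii) $\mathbb E_{\xi\sim Q_{x,y}}[\|F_\xi(x)-F_\xi(y)\|_*^2]\le\bar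 L^2\|x-y\|^2$. Algorithm. Parameters: $0<\gamma\le1$, $0<p\le1$, stepsize $\alpha>0$, batch size $b\in\{1,\dots,M\}$. Start with $x_0=x_{-1}=w_0=w_{-1}\in K$. For $s=0,1,\dots,S-1$: draw $\xi^s_1,\dots,\xi^s_b\in\{1,\dots,M\}$ independently from $Q_{x_s,w_{s-1}}$ and set $B^s=\{\xi_1^s,\dots,\xi_b^s\}$ (with multiplicity); set $\bar x_s=(\nabla f)^{-1}\big(\gamma\nabla f(x_s)+(1-\gamma)\nabla f(x_{s-1})\big)$; $\Delta^s=\frac1b\sum_{\xi\in B^s}\big(F(w_s)+F_\xi(x_s)-F_\xi(w_{s-1})\big)$; $x_{s+1}=\arg\min_{x\in K}\{\alpha g(x)+\langle\alpha\Delta^s,x\rangle+D(x,\bar x_s)\}$; and let $w_{s+1}=x_{s+1}$ with probability $p$ and $w_{s+1}=x_s$ with probability $1-p$ (fresh independent coin). All iterates are assumed well defined, i.e. the points used as second arguments of $D$ lie in $\mathrm{dom}(\partial f)$. Complexity convention. The total average complexity is the expected number of operator (component/oracle) evaluations; the paper counts it as $M+2+(pM+2)S$ for $S$ iterations. The constants hidden in $\mathcal O$ may depend on $L$, $\bar L$ and $\max_{u\in C}D(u,x_0)$, but not on $M$, $S$, $\epsilon$.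
   Formalization: The complexity O(√M/ε) is claimed only for ε ≤ 1/√M, and O(M + √M/ε) for every ε > 0: the start-up cost M+2 in the count makes O(√M/ε) with a constant independent of M and ε false for fixed ε and large M. *)

theory Defs
  imports "HOL-Probability.Probability"
begin

text \<open>
  The finite-dimensional inner product space is a type of class \<open>euclidean_space\<close>; the norm that
  measures distances is a separate function \<open>N\<close>, unrelated to the norm of the inner product.
\<close>

definition is_norm :: "('a::euclidean_space \<Rightarrow> real) \<Rightarrow> bool" where
  "is_norm N \<longleftrightarrow>
     (\<forall>x. N x = 0 \<longleftrightarrow> x = 0) \<and>
     (\<forall>c x. N (c *\<^sub>R x) = \<bar>c\<bar> * N x) \<and>
     (\<forall>x y. N (x + y) \<le> N x + N y)"

definition dual_norm :: "('a::euclidean_space \<Rightarrow> real) \<Rightarrow> 'a \<Rightarrow> real" where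
  "dual_norm N y = (SUP x\<in>{x. N x \<le> 1}. inner y x)"

text \<open>
  A function \<open>K \<rightarrow> (-\<infinity>, +\<infinity>]\<close> is a total \<open>ereal\<close>-valued function of which only the values on \<open>K\<close>
  are ever constrained or used.
\<close>

definition edom :: "'a set \<Rightarrow> ('a \<Rightarrow> ereal) \<Rightarrow> 'a set" where
  "edom K h = {x \<in> K. h x < \<infinity>}"

definition proper_on :: "'a set \<Rightarrow> ('a \<Rightarrow> ereal) \<Rightarrow> bool" where
  "proper_on K h \<longleftrightarrow> (\<forall>x\<in>K. h x \<noteq> -\<infinity>) \<and> edom K h \<noteq> {}"

definition econvex_on :: "'a::real_vector set \<Rightarrow> ('a \<Rightarrow> ereal) \<Rightarrow> bool" where
  "econvex_on K h \<longleftrightarrow>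
     (\<forall>x\<in>K. \<forall>y\<in>K. \<forall>t\<in>{0<..<1}.
        h ((1 - t) *\<^sub>R x + t *\<^sub>R y) \<le> ereal (1 - t) * h x + ereal t * h y)"

definition lsc_on :: "'a::topological_space set \<Rightarrow> ('a \<Rightarrow> ereal) \<Rightarrow> bool" where
  "lsc_on K h \<longleftrightarrow> (\<forall>x\<in>K. \<forall>r < h x. \<forall>\<^sub>F y in at x within K. r < h y)"

definition subdifferential :: "'a::real_inner set \<Rightarrow> ('a \<Rightarrow> ereal) \<Rightarrow> 'a \<Rightarrow> 'a set" where
  "subdifferential K f x = {v. \<forall>y\<in>K. f x + ereal (inner v (y - x)) \<le> f y}"

definition subdiff_dom :: "'a::real_inner set \<Rightarrow> ('a \<Rightarrow> ereal) \<Rightarrow> 'a set" where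
  "subdiff_dom K f = {x \<in> edom K f. subdifferential K f x \<noteq> {}}"

definition bregman :: "('a::real_inner \<Rightarrow> ereal) \<Rightarrow> ('a \<Rightarrow> 'a) \<Rightarrow> 'a \<Rightarrow> 'a \<Rightarrow> ereal" where
  "bregman f f' x y = f x - f y - ereal (inner (f' y) (x - y))"

text \<open>
  \<open>f'\<close> is the gradient of \<open>f\<close>. Differentiability is relative to the domain of \<open>f\<close>; at interior
  points this is ordinary differentiability, and it also admits sets \<open>K\<close> with empty interior (such
  as a simplex) and boundary points of \<open>K\<close>. Where the relative gradient is not unique, \<open>f'\<close> is any
  selection that satisfies the strong convexity inequality.
\<close>

definition distance_generating ::
  "('a::euclidean_space \<Rightarrow> real) \<Rightarrow> 'a set \<Rightarrow> ('a \<Rightarrow> ereal) \<Rightarrow> ('a \<Rightarrow> ereal) \<Rightarrow> ('a \<Rightarrow> 'a) \<Rightarrow> bool"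
where
  "distance_generating N K g f f' \<longleftrightarrow>
     proper_on K f \<and> econvex_on K f \<and> lsc_on K f \<and> edom K g \<subseteq> edom K f \<and>
     (\<forall>x\<in>subdiff_dom K f.
        ((\<lambda>y. real_of_ereal (f y)) has_derivative (\<lambda>h. inner (f' x) h)) (at x within edom K f)) \<and>
     (\<forall>x\<in>edom K f. \<forall>y\<in>subdiff_dom K f.
        f x \<ge> f y + ereal (inner (f' y) (x - y)) + ereal ((N (x - y))\<^sup>2 / 2))"

definition vi_solutions ::
  "'a::real_inner set \<Rightarrow> ('a \<Rightarrow> ereal) \<Rightarrow> ('a \<Rightarrow> 'a) \<Rightarrow> 'a set" where
  "vi_solutions K g F = {x \<in> K. \<forall>y\<in>K. ereal (inner (F x) (y - x)) + g y - g x \<ge> 0}"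

definition monotone_operator_on :: "'a::real_inner set \<Rightarrow> ('a \<Rightarrow> 'a) \<Rightarrow> bool" where
  "monotone_operator_on A F \<longleftrightarrow> (\<forall>x\<in>A. \<forall>y\<in>A. inner (F x - F y) (x - y) \<ge> 0)"

definition lipschitz_operator_on ::
  "('a::euclidean_space \<Rightarrow> real) \<Rightarrow> real \<Rightarrow> 'a set \<Rightarrow> ('a \<Rightarrow> 'a) \<Rightarrow> bool" where
  "lipschitz_operator_on N L A F \<longleftrightarrow>
     0 \<le> L \<and> (\<forall>x\<in>A. \<forall>y\<in>A. dual_norm N (F x - F y) \<le> L * N (x - y))"

text \<open>
  \<open>Fo \<xi>\<close> is the stochastic oracle \<open>F\<^sub>\<xi>\<close> for \<open>\<xi> \<in> {1..M}\<close>, and \<open>Q x y\<close> is the sampling distribution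
  attached to the pair \<open>(x, y)\<close>.
\<close>

definition variable_lipschitz_oracle ::
  "('a::euclidean_space \<Rightarrow> real) \<Rightarrow> real \<Rightarrow> 'a set \<Rightarrow> nat \<Rightarrow> ('a \<Rightarrow> 'a) \<Rightarrow>
   (nat \<Rightarrow> 'a \<Rightarrow> 'a) \<Rightarrow> ('a \<Rightarrow> 'a \<Rightarrow> nat pmf) \<Rightarrow> bool" where
  "variable_lipschitz_oracle N Lbar A M F Fo Q \<longleftrightarrow>
     0 \<le> Lbar \<and>
     (\<forall>x\<in>A. \<forall>y\<in>A.
        set_pmf (Q x y) \<subseteq> {1..M} \<and>
        (\<forall>z\<in>A. F z = measure_pmf.expectation (Q x y) (\<lambda>\<xi>. Fo \<xi> z)) \<and>
        measure_pmf.expectation (Q x y) (\<lambda>\<xi>. (dual_norm N (Fo \<xi> x - Fo \<xi> y))\<^sup>2)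
          \<le> Lbar\<^sup>2 * (N (x - y))\<^sup>2)"

definition prox_step ::
  "'a::real_inner set \<Rightarrow> ('a \<Rightarrow> ereal) \<Rightarrow> ('a \<Rightarrow> ereal) \<Rightarrow> ('a \<Rightarrow> 'a) \<Rightarrow> real \<Rightarrow> 'a \<Rightarrow> 'a \<Rightarrow> 'a"
where
  "prox_step K g f f' \<alpha> \<Delta> xbar =
     arg_min (\<lambda>x. ereal \<alpha> * g x + ereal (inner (\<alpha> *\<^sub>R \<Delta>) x) + bregman f f' x xbar) (\<lambda>x. x \<in> K)"

text \<open>
  A trajectory is a pair \<open>(x, w)\<close> of sequences indexed by \<open>{-1, 0, 1, ...}\<close>, here by all integers.
  \<open>vr_run \<dots> s\<close> is the joint law of the iterates up to index \<open>s\<close>; entries of larger index are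
  not yet meaningful and still hold the initial value.
\<close>

definition vr_step ::
  "'a::euclidean_space set \<Rightarrow> ('a \<Rightarrow> ereal) \<Rightarrow> ('a \<Rightarrow> ereal) \<Rightarrow> ('a \<Rightarrow> 'a) \<Rightarrow> ('a \<Rightarrow> 'a) \<Rightarrow>
   (nat \<Rightarrow> 'a \<Rightarrow> 'a) \<Rightarrow> ('a \<Rightarrow> 'a \<Rightarrow> nat pmf) \<Rightarrow> nat \<Rightarrow> real \<Rightarrow> real \<Rightarrow> real \<Rightarrow> int \<Rightarrow>
   (int \<Rightarrow> 'a) \<times> (int \<Rightarrow> 'a) \<Rightarrow> ((int \<Rightarrow> 'a) \<times> (int \<Rightarrow> 'a)) pmf" where
  "vr_step K g f f' F Fo Q b p \<gamma> \<alpha> s = (\<lambda>(x, w).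
     do {
       \<xi>s \<leftarrow> replicate_pmf b (Q (x s) (w (s - 1)));
       coin \<leftarrow> bernoulli_pmf p;
       let xbar = inv_into (subdiff_dom K f) f' (\<gamma> *\<^sub>R f' (x s) + (1 - \<gamma>) *\<^sub>R f' (x (s - 1)));
           \<Delta> = (1 / real b) *\<^sub>R (\<Sum>\<xi>\<leftarrow>\<xi>s. F (w s) + Fo \<xi> (x s) - Fo \<xi> (w (s - 1)));
           xnew = prox_step K g f f' \<alpha> \<Delta> xbar
       in return_pmf (x(s + 1 := xnew), w(s + 1 := if coin then xnew else x s))
     })"

primrec vr_run ::
  "'a::euclidean_space set \<Rightarrow> ('a \<Rightarrow> ereal) \<Rightarrow> ('a \<Rightarrow> ereal) \<Rightarrow> ('a \<Rightarrow> 'a) \<Rightarrow> ('a \<Rightarrow> 'a) \<Rightarrow>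
   (nat \<Rightarrow> 'a \<Rightarrow> 'a) \<Rightarrow> ('a \<Rightarrow> 'a \<Rightarrow> nat pmf) \<Rightarrow> nat \<Rightarrow> real \<Rightarrow> real \<Rightarrow> real \<Rightarrow> 'a \<Rightarrow> nat \<Rightarrow>
   ((int \<Rightarrow> 'a) \<times> (int \<Rightarrow> 'a)) pmf" where
  "vr_run K g f f' F Fo Q b p \<gamma> \<alpha> x0 0 = return_pmf (\<lambda>_. x0, \<lambda>_. x0)"
| "vr_run K g f f' F Fo Q b p \<gamma> \<alpha> x0 (Suc s) =
     bind_pmf (vr_run K g f f' F Fo Q b p \<gamma> \<alpha> x0 s) (vr_step K g f f' F Fo Q b p \<gamma> \<alpha> (int s))"

text \<open>
  Every \<open>x\<^sub>s\<close> that the algorithm can produce lies in the domain of the subdifferential of \<open>f\<close>, and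
  the inverse gradient defining the extrapolated point exists there.
\<close>

definition vr_well_defined ::
  "'a::euclidean_space set \<Rightarrow> ('a \<Rightarrow> ereal) \<Rightarrow> ('a \<Rightarrow> 'a) \<Rightarrow> real \<Rightarrow>
   (nat \<Rightarrow> ((int \<Rightarrow> 'a) \<times> (int \<Rightarrow> 'a)) pmf) \<Rightarrow> bool" where
  "vr_well_defined K f f' \<gamma> run \<longleftrightarrow>
     (\<forall>s. \<forall>(x, w)\<in>set_pmf (run s).
        x (int s) \<in> subdiff_dom K f \<and>
        \<gamma> *\<^sub>R f' (x (int s)) + (1 - \<gamma>) *\<^sub>R f' (x (int s - 1)) \<in> f' ` subdiff_dom K f)"

definition ergodic_avg :: "nat \<Rightarrow> (int \<Rightarrow> 'a::real_vector) \<times> (int \<Rightarrow> 'a) \<Rightarrow> 'a" where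
  "ergodic_avg S = (\<lambda>(x, w). (1 / real S) *\<^sub>R (\<Sum>s<S. x (int s + 1)))"

text \<open>Points \<open>u \<in> C\<close> with \<open>g u = \<infinity>\<close> contribute \<open>-\<infinity>\<close> whenever \<open>g z\<close> is finite.\<close>

definition gap ::
  "('a::real_inner \<Rightarrow> ereal) \<Rightarrow> ('a \<Rightarrow> 'a) \<Rightarrow> 'a set \<Rightarrow> 'a \<Rightarrow> ereal" where
  "gap g F C z = (SUP u\<in>C. ereal (inner (F u) (z - u)) + g z - g u)"

text \<open>
  The convention for counting expected operator evaluations over \<open>S\<close> iterations: \<open>M + 2\<close> initially,
  then in each iteration two oracle calls plus, with probability \<open>p\<close>, one full pass over the \<open>M\<close>
  components.
\<close>

definition avg_complexity :: "nat \<Rightarrow> real \<Rightarrow> nat \<Rightarrow> real" where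
  "avg_complexity M p S = real M + 2 + (p * real M + 2) * real S"

end

theory Submission
  imports Defs
begin

text \<open>
  One step of the method is a proximal step along \<open>F w\<^sub>s + (F x\<^sub>s - F w\<^sub>s\<^sub>-\<^sub>1) + e\<^sub>s\<close> with a zero-mean error
  \<open>e\<^sub>s\<close>. Its optimality condition, tested against \<open>u\<close>, telescopes along each trajectory
  (\<open>pathwise_inequality\<close>): the drift \<open>F x\<^sub>s - F w\<^sub>s\<^sub>-\<^sub>1\<close> cancels the error of having used \<open>F w\<^sub>s\<^sub>-\<^sub>1\<close> in
  place of \<open>F x\<^sub>s\<close>, and the potential is \<open>D u x\<^sub>s + (1 - \<gamma>) D u x\<^sub>s\<^sub>-\<^sub>1\<close>. What remains is linear in the
  drift and the error, and must be paid for by the negative terms \<open>- \<gamma> D x\<^sub>s\<^sub>+\<^sub>1 x\<^sub>s\<close> and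
  \<open>- (1 - \<gamma>) D x\<^sub>s\<^sub>+\<^sub>1 x\<^sub>s\<^sub>-\<^sub>1\<close>, that is, by squared displacements over one and over two steps.

  The drift and the error at step \<open>s\<close> are of the size of \<open>x\<^sub>s - w\<^sub>s\<^sub>-\<^sub>1\<close>, a one-step displacement if the
  coin for \<open>w\<^sub>s\<^sub>-\<^sub>1\<close> showed heads and a two-step displacement otherwise. The one-step budget
  \<open>\<gamma> = p + 1 / sqrt M\<close> is small, so it matters that heads have probability \<open>p = 1 / M\<close>. The iterate
  \<open>x\<^sub>s\<close> is not independent of this coin, but by the Lipschitz dependence of the proximal point on its
  direction it changes little when the coin is flipped (\<open>lagw_Suc_le\<close>).

  In a norm that is not Euclidean, averaging \<open>b\<close> samples need not reduce the second moment of the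
  error by the factor \<open>b\<close>. What does improve by this factor is the correlation of the error with the
  new iterate: replacing one sample by an independent copy moves the iterate only by \<open>\<alpha> / b\<close> times the
  change of that sample (\<open>iid_sum_correlation\<close>). This is the quantity that the step size has to
  control.

  The gap contains a supremum over \<open>u\<close> inside the expectation, and the accumulated error enters it
  through a term linear in \<open>u\<close>. The conjugate of the Bregman distance bounds this term uniformly in \<open>u\<close>,
  and grows only with the second moments of the errors (\<open>ex_bregman_conjugate\<close>,
  \<open>conjugate_growth\<close>), which fit into the slack of the displacement budget (\<open>ex_young_weight\<close>). Hence
  \<open>\<alpha> S\<close> times the expected gap is bounded by a constant, and \<open>1 / \<alpha>\<close> is of order \<open>sqrt M\<close>. The
  complexity bound follows by taking \<open>S\<close> proportional to \<open>sqrt M / \<epsilon>\<close>, since an iteration costs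
  \<open>p M + 2 = 3\<close> evaluations on average.
\<close>

section \<open>Norms and dual norms\<close>

locale finite_dim_norm =
  fixes N :: "'a::euclidean_space \<Rightarrow> real"
  assumes is_norm: "is_norm N"
begin

lemma N_zero_iff [simp]: "N x = 0 \<longleftrightarrow> x = 0"
  and N_scale: "N (c *\<^sub>R x) = \<bar>c\<bar> * N x"
  and N_triangle: "N (x + y) \<le> N x + N y"
  using is_norm by (auto simp: is_norm_def)

lemma N_0 [simp]: "N 0 = 0"
  using N_zero_iff[of 0] by blast

lemma N_minus [simp]: "N (- x) = N x"
  using N_scale[of "-1" x] by simp

lemma N_nonneg [simp]: "0 \<le> N x"
  using N_triangle[of x "- x"] by simp

lemma N_commute: "N (x - y) = N (y - x)"
  using N_minus[of "x - y"] by simp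

lemma N_sum_square: "(N (x + y))\<^sup>2 \<le> 2 * (N x)\<^sup>2 + 2 * (N y)\<^sup>2"
proof -
  have "(N (x + y))\<^sup>2 \<le> (N x + N y)\<^sup>2"
    by (intro power_mono N_triangle) auto
  also have "\<dots> \<le> 2 * (N x)\<^sup>2 + 2 * (N y)\<^sup>2"
    using zero_le_power2[of "N x - N y"] by (simp add: power2_eq_square algebra_simps)
  finally show ?thesis .
qed

lemma N_lower: "\<exists>c>0. \<forall>x. c * norm x \<le> N x"
proof -
  have "convex_on UNIV N"
  proof (rule convex_onI)
    fix t :: real and x y assume "0 < t" "t < 1"
    thus "N ((1 - t) *\<^sub>R x + t *\<^sub>R y) \<le> (1 - t) * N x + t * N y"
      using N_triangle[of "(1 - t) *\<^sub>R x" "t *\<^sub>R y"] by (simp add: N_scale)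
  qed auto
  hence "continuous_on UNIV N"
    by (intro convex_on_continuous) auto
  hence "continuous_on (sphere 0 1) N"
    by (rule continuous_on_subset) auto
  moreover have "sphere (0::'a) 1 \<noteq> {}"
    by simp
  ultimately obtain z where z: "z \<in> sphere 0 1" "\<And>y. y \<in> sphere 0 1 \<Longrightarrow> N z \<le> N y"
    using continuous_attains_inf[of "sphere 0 1" N] compact_sphere by blast
  have "N z * norm x \<le> N x" for x
  proof (cases "x = 0")
    case False
    have "N z \<le> N ((1 / norm x) *\<^sub>R x)"
      using False by (intro z(2)) simp
    thus ?thesis using False by (simp add: N_scale field_simps)
  qed simp
  moreover have "N z > 0"
    using z(1) N_zero_iff[of z] N_nonneg[of z] by (metis norm_zero mem_sphere_0 less_eq_real_def zero_neq_one)
  ultimately show ?thesis by blast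
qed

lemma bdd_above_dual: "bdd_above ((\<lambda>x. inner y x) ` {x. N x \<le> 1})"
proof -
  obtain c where c: "c > 0" "\<And>x. c * norm x \<le> N x"
    using N_lower by blast
  have "inner y x \<le> norm y * (1 / c)" if "N x \<le> 1" for x
  proof -
    have "norm x \<le> 1 / c" using c(1) c(2)[of x] that by (simp add: field_simps)
    hence "norm y * norm x \<le> norm y * (1 / c)" by (intro mult_left_mono) auto
    thus ?thesis using norm_cauchy_schwarz[of y x] by linarith
  qed
  thus ?thesis by (intro bdd_aboveI) auto
qed

lemma inner_le_dual_norm: "inner y x \<le> dual_norm N y * N x"
proof (cases "x = 0")
  case False
  hence pos: "N x > 0" using N_nonneg[of x] N_zero_iff[of x] by linarith
  have "inner y ((1 / N x) *\<^sub>R x) \<le> dual_norm N y"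
    unfolding dual_norm_def using pos
    by (intro cSUP_upper bdd_above_dual) (simp add: N_scale)
  thus ?thesis using pos by (simp add: field_simps)
qed simp

lemma dual_norm_le:
  assumes "\<And>x. inner y x \<le> k * N x" "0 \<le> k"
  shows "dual_norm N y \<le> k"
  unfolding dual_norm_def
proof (rule cSUP_least)
  show "{x. N x \<le> 1} \<noteq> {}" by (auto intro!: exI[of _ 0])
  fix x assume "x \<in> {x. N x \<le> 1}"
  hence "k * N x \<le> k * 1" using assms(2) by (intro mult_left_mono) auto
  thus "inner y x \<le> k" using assms(1)[of x] by linarith
qed

lemma dual_norm_nonneg [simp]: "0 \<le> dual_norm N y"
proof -
  have "inner y 0 \<le> dual_norm N y"
    unfolding dual_norm_def by (intro cSUP_upper bdd_above_dual) simp
  thus ?thesis by simp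
qed

lemma dual_norm_triangle: "dual_norm N (y + z) \<le> dual_norm N y + dual_norm N z"
  using inner_le_dual_norm[of y] inner_le_dual_norm[of z]
  by (intro dual_norm_le) (auto simp: inner_add_left distrib_right intro: add_mono)

lemma dual_norm_minus_le: "dual_norm N (- y) \<le> dual_norm N y"
  using inner_le_dual_norm[of y "- _"] by (intro dual_norm_le) auto

lemma dual_norm_diff: "dual_norm N (y - z) \<le> dual_norm N y + dual_norm N z"
  using dual_norm_triangle[of y "- z"] dual_norm_minus_le[of z] by simp

lemma dual_norm_scale:
  assumes "0 \<le> c" shows "dual_norm N (c *\<^sub>R y) \<le> c * dual_norm N y"
  using inner_le_dual_norm[of y] assms
  by (intro dual_norm_le) (auto simp: mult.assoc intro!: mult_left_mono)

lemma dual_norm_diff_square: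
  "(dual_norm N (y - z))\<^sup>2 \<le> 2 * (dual_norm N y)\<^sup>2 + 2 * (dual_norm N z)\<^sup>2"
proof -
  have "(dual_norm N (y - z))\<^sup>2 \<le> (dual_norm N y + dual_norm N z)\<^sup>2"
    by (intro power_mono dual_norm_diff) auto
  also have "\<dots> \<le> 2 * (dual_norm N y)\<^sup>2 + 2 * (dual_norm N z)\<^sup>2"
    using zero_le_power2[of "dual_norm N y - dual_norm N z"]
    by (simp add: power2_eq_square algebra_simps)
  finally show ?thesis .
qed

lemma abs_inner_le_dual_norm: "\<bar>inner y x\<bar> \<le> dual_norm N y * N x"
  using inner_le_dual_norm[of y x] inner_le_dual_norm[of y "- x"] by simp

lemma inner_le_half_squares: "inner y x \<le> (dual_norm N y)\<^sup>2 / 2 + (N x)\<^sup>2 / 2"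
  using inner_le_dual_norm[of y x] zero_le_power2[of "dual_norm N y - N x"]
  by (simp add: power2_eq_square algebra_simps)

end

section \<open>Existence of proximal points\<close>

lemma lsc_on_add:
  assumes "lsc_on K h1" "lsc_on K h2"
    and "\<And>x. x \<in> K \<Longrightarrow> h1 x \<noteq> -\<infinity>" "\<And>x. x \<in> K \<Longrightarrow> h2 x \<noteq> -\<infinity>"
  shows "lsc_on K (\<lambda>x. h1 x + h2 x)"
  unfolding lsc_on_def
proof (intro ballI allI impI)
  fix x r assume x: "x \<in> K" and r: "r < h1 x + h2 x"
  have *: "\<exists>r1 r2. ereal r1 < h1 x \<and> ereal r2 < h2 x \<and> r \<le> ereal r1 + ereal r2"
  proof (cases r)
    case (real c)
    show ?thesis
    proof (cases "h1 x")
      case (real A)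
      note h1 = this
      show ?thesis
      proof (cases "h2 x")
        case (real B)
        have "c < A + B" using r h1 real \<open>r = ereal c\<close> by simp
        thus ?thesis using h1 real \<open>r = ereal c\<close>
          by (intro exI[of _ "A - (A + B - c) / 2"] exI[of _ "B - (A + B - c) / 2"])
             (auto simp: field_simps)
      next
        case PInf
        thus ?thesis using h1 \<open>r = ereal c\<close>
          by (intro exI[of _ "A - 1"] exI[of _ "c - A + 1"]) auto
      qed (use assms(4) x in auto)
    next
      case PInf
      obtain B where "ereal B < h2 x"
        using assms(4)[OF x] by (metis ereal_dense2 ereal_infty_less(2))
      thus ?thesis using PInf \<open>r = ereal c\<close>
        by (intro exI[of _ "c - B"] exI[of _ B]) auto
    qed (use assms(3) x in auto)
  next
    case MInf
    have "\<exists>B. ereal B < h1 x" "\<exists>B. ereal B < h2 x"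
      using assms(3,4)[OF x] by (metis ereal_dense2 ereal_infty_less(2))+
    thus ?thesis using MInf by auto
  qed (use r in auto)
  then obtain r1 r2 where r12: "ereal r1 < h1 x" "ereal r2 < h2 x" "r \<le> ereal r1 + ereal r2"
    by blast
  have "\<forall>\<^sub>F y in at x within K. ereal r1 < h1 y" "\<forall>\<^sub>F y in at x within K. ereal r2 < h2 y"
    using assms(1,2) x r12 unfolding lsc_on_def by blast+
  thus "\<forall>\<^sub>F y in at x within K. r < h1 y + h2 y"
  proof eventually_elim
    case (elim y)
    have "ereal r1 + ereal r2 < h1 y + h2 y"
      using elim by (intro ereal_add_strict_mono2) auto
    thus ?case using r12(3) by simp
  qed
qed

lemma lsc_on_scale:
  assumes "lsc_on K h" "0 < \<alpha>"
  shows "lsc_on K (\<lambda>x. ereal \<alpha> * h x)"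
  unfolding lsc_on_def
proof (intro ballI allI impI)
  fix x r assume x: "x \<in> K" and r: "r < ereal \<alpha> * h x"
  have eq: "r < ereal \<alpha> * t \<longleftrightarrow> r / ereal \<alpha> < t" for t
    using ereal_divide_less_iff[of "ereal \<alpha>" r t] assms(2) by (simp add: mult.commute)
  show "\<forall>\<^sub>F y in at x within K. r < ereal \<alpha> * h y"
    using assms(1) x r unfolding lsc_on_def eq by blast
qed

lemma lsc_on_continuous:
  assumes "continuous_on K h"
  shows "lsc_on K (\<lambda>x. ereal (h x))"
  unfolding lsc_on_def
proof (intro ballI allI impI)
  fix x r assume "x \<in> K" and r: "r < ereal (h x)"
  hence "((\<lambda>y. ereal (h y)) \<longlongrightarrow> ereal (h x)) (at x within K)"
    using assms by (auto simp: continuous_on_def)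
  thus "\<forall>\<^sub>F y in at x within K. r < ereal (h y)"
    using r order_tendstoD(1) by blast
qed

text \<open>
  Were the infimum \<open>m\<close> not attained, every point would have a neighbourhood on which \<open>h\<close> exceeds a
  constant larger than \<open>m\<close>, and finitely many of them would bound \<open>h\<close> away from \<open>m\<close>.
\<close>

lemma lsc_on_attains_inf:
  fixes h :: "'a::topological_space \<Rightarrow> ereal"
  assumes "compact S" "S \<noteq> {}" "S \<subseteq> K" "lsc_on K h"
  shows "\<exists>x\<in>S. \<forall>y\<in>S. h x \<le> h y"
proof (rule ccontr)
  assume none: "\<not> ?thesis"
  define m where "m = (INF x\<in>S. h x)"
  have "\<exists>r. m < r \<and> r < h x" if "x \<in> S" for x
  proof -
    have "\<exists>y\<in>S. h y < h x" using none that by (auto simp: not_le)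
    hence "m < h x" unfolding m_def by (meson INF_lower le_less_trans)
    thus ?thesis using dense by blast
  qed
  then obtain r where r: "\<And>x. x \<in> S \<Longrightarrow> m < r x \<and> r x < h x" by metis
  have "\<exists>U. open U \<and> x \<in> U \<and> (\<forall>y\<in>U \<inter> K. r x < h y)" if "x \<in> S" for x
  proof -
    have "\<forall>\<^sub>F y in at x within K. r x < h y"
      using assms(3,4) that r unfolding lsc_on_def by blast
    then obtain U where "open U" "x \<in> U" "\<forall>y\<in>U. y \<noteq> x \<longrightarrow> y \<in> K \<longrightarrow> r x < h y"
      unfolding eventually_at_topological by blast
    thus ?thesis using r[OF that] by (intro exI[of _ U]) auto
  qed
  then obtain U where U: "\<And>x. x \<in> S \<Longrightarrow> open (U x) \<and> x \<in> U x \<and> (\<forall>y\<in>U x \<inter> K. r x < h y)"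
    by metis
  obtain T where T: "T \<subseteq> S" "finite T" "S \<subseteq> (\<Union>x\<in>T. U x)"
    using compactE_image[OF assms(1), of S U] U by blast
  hence "T \<noteq> {}" using assms(2) by auto
  have "Min (r ` T) \<le> m"
    unfolding m_def
  proof (rule INF_greatest)
    fix y assume "y \<in> S"
    then obtain x where x: "x \<in> T" "y \<in> U x" using T by blast
    hence "r x < h y" using U[of x] T(1) \<open>y \<in> S\<close> assms(3) by blast
    thus "Min (r ` T) \<le> h y" using x(1) T(2)
      by (meson Min_le finite_imageI image_eqI le_less_trans less_imp_le)
  qed
  moreover have "m < Min (r ` T)"
    using T \<open>T \<noteq> {}\<close> r by (subst Min_gr_iff) auto
  ultimately show False by simp
qed

lemma lsc_on_coercive_attains_inf:
  fixes h :: "'a::euclidean_space \<Rightarrow> ereal"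
  assumes "closed K" "lsc_on K h" "x1 \<in> K"
    and far: "\<And>x. x \<in> K \<Longrightarrow> R < norm (x - x1) \<Longrightarrow> h x1 \<le> h x"
  shows "\<exists>y. is_arg_min h (\<lambda>x. x \<in> K) y"
proof -
  define S where "S = K \<inter> cball x1 (max R 0)"
  have "compact S" unfolding S_def using assms(1) by (intro closed_Int_compact) auto
  moreover have x1S: "x1 \<in> S" using assms(3) by (simp add: S_def)
  ultimately obtain y where y: "y \<in> S" "\<And>x. x \<in> S \<Longrightarrow> h y \<le> h x"
    using lsc_on_attains_inf[of S K h] assms(2) unfolding S_def by blast
  have "h y \<le> h x" if "x \<in> K" for x
  proof (cases "x \<in> S")
    case False
    hence "R < norm (x - x1)" using that by (auto simp: S_def dist_norm norm_minus_commute)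
    thus ?thesis using far[OF that] y(2)[OF x1S] by simp
  qed (use y in auto)
  thus ?thesis using y(1) by (auto simp: is_arg_min_def S_def not_less)
qed

text \<open>
  On the unit ball around a point of its domain, lower semicontinuity bounds \<open>h\<close> from below; along a
  longer ray, convexity forces any decrease to be at most linear.
\<close>

lemma convex_lsc_linear_minorant:
  fixes h :: "'a::euclidean_space \<Rightarrow> ereal"
  assumes "closed K" "convex K" "proper_on K h" "econvex_on K h" "lsc_on K h" "x1 \<in> edom K h"
  shows "\<exists>c\<ge>0. \<forall>x\<in>K. ereal (- c * (1 + norm (x - x1))) \<le> h x"
proof -
  define S where "S = K \<inter> cball x1 1"
  have x1: "x1 \<in> K" "h x1 < \<infinity>" using assms(6) by (auto simp: edom_def)
  have "compact S" unfolding S_def using assms(1) by (intro closed_Int_compact) auto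
  then obtain z where z: "z \<in> S" "\<And>x. x \<in> S \<Longrightarrow> h z \<le> h x"
    using lsc_on_attains_inf[of S K h] assms(5) x1(1) unfolding S_def by fastforce
  have "h z \<le> h x1" using x1(1) by (intro z(2)) (simp add: S_def)
  moreover have nm: "x \<in> K \<Longrightarrow> h x \<noteq> -\<infinity>" for x using assms(3) by (auto simp: proper_on_def)
  ultimately obtain m a where m: "h z = ereal m" and a: "h x1 = ereal a"
    using x1 z(1) nm[of z] nm[of x1] unfolding S_def
    by (cases "h z"; cases "h x1") auto
  define c where "c = \<bar>m\<bar> + \<bar>a\<bar>"
  have "ereal (- c * (1 + norm (x - x1))) \<le> h x" if x: "x \<in> K" for x
  proof (cases "norm (x - x1) \<le> 1")
    case True
    hence "ereal m \<le> h x" using z(2)[of x] x m by (simp add: S_def dist_norm norm_minus_commute)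
    moreover have "c \<le> c * (1 + norm (x - x1))" by (simp add: c_def mult_le_cancel_left1)
    hence "- c * (1 + norm (x - x1)) \<le> m" unfolding c_def by linarith
    ultimately show ?thesis by (meson ereal_less_eq(3) order_trans)
  next
    case False
    define r where "r = norm (x - x1)"
    define y where "y = (1 - 1 / r) *\<^sub>R x1 + (1 / r) *\<^sub>R x"
    have r: "r > 1" using False by (simp add: r_def)
    have "y = x1 + (1 / r) *\<^sub>R (x - x1)" by (simp add: y_def algebra_simps)
    hence "norm (y - x1) = 1 / r * r" using r by (simp add: r_def)
    hence "norm (y - x1) = 1" using r by simp
    moreover have "y \<in> K" unfolding y_def using assms(2) x x1(1) r
      by (intro convexD_alt) auto
    ultimately have "ereal m \<le> h y" using z(2)[of y] m by (simp add: S_def dist_norm norm_minus_commute)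
    also have "h y \<le> ereal (1 - 1 / r) * h x1 + ereal (1 / r) * h x"
      using assms(4) x x1(1) r unfolding econvex_on_def y_def by simp
    finally have le: "ereal m \<le> ereal (1 - 1 / r) * ereal a + ereal (1 / r) * h x" using a by simp
    show ?thesis
    proof (cases "h x")
      case (real b)
      have "m \<le> (1 - 1 / r) * a + 1 / r * b" using le real by simp
      hence "r * m \<le> (r - 1) * a + b" using r by (simp add: field_simps)
      hence b: "r * m - (r - 1) * a \<le> b" by simp
      have "r * m \<ge> - r * \<bar>m\<bar>" using r by (simp add: abs_if)
      moreover have "(r - 1) * a \<le> (r - 1) * \<bar>a\<bar>" using r by (intro mult_left_mono) auto
      ultimately have "- c * (1 + r) \<le> b" using b r by (simp add: c_def algebra_simps)
      thus ?thesis using real by (simp add: r_def)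
    qed (use nm[OF x] in auto)
  qed
  thus ?thesis by (intro exI[of _ c]) (auto simp: c_def)
qed

section \<open>Bregman geometry\<close>

locale mirror_setting = finite_dim_norm N
  for N :: "'a::euclidean_space \<Rightarrow> real" +
  fixes K :: "'a set" and g f :: "'a \<Rightarrow> ereal" and f' :: "'a \<Rightarrow> 'a"
  assumes closed_K: "closed K" and convex_K: "convex K"
    and proper_g: "proper_on K g" and econvex_g: "econvex_on K g" and lsc_g: "lsc_on K g"
    and dgf: "distance_generating N K g f f'"
begin

abbreviation gr :: "'a \<Rightarrow> real" where "gr x \<equiv> real_of_ereal (g x)"
abbreviation fr :: "'a \<Rightarrow> real" where "fr x \<equiv> real_of_ereal (f x)"

definition D :: "'a \<Rightarrow> 'a \<Rightarrow> real" where
  "D u y = fr u - fr y - inner (f' y) (u - y)"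

lemma proper_f: "proper_on K f" and econvex_f: "econvex_on K f" and lsc_f: "lsc_on K f"
  and edom_g_le: "edom K g \<subseteq> edom K f"
  using dgf by (auto simp: distance_generating_def)

lemma edom_real:
  assumes "proper_on K h" "x \<in> edom K h"
  shows "h x = ereal (real_of_ereal (h x))"
proof -
  have "h x \<noteq> -\<infinity>" "h x \<noteq> \<infinity>" using assms by (auto simp: proper_on_def edom_def)
  thus ?thesis by (cases "h x") auto
qed

lemma convex_edom:
  assumes "proper_on K h" "econvex_on K h"
  shows "convex (edom K h)" "convex_on (edom K h) (\<lambda>x. real_of_ereal (h x))"
proof -
  have *: "(1 - t) *\<^sub>R x + t *\<^sub>R y \<in> edom K h \<and>
      real_of_ereal (h ((1 - t) *\<^sub>R x + t *\<^sub>R y))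
        \<le> (1 - t) * real_of_ereal (h x) + t * real_of_ereal (h y)"
    if "x \<in> edom K h" "y \<in> edom K h" "0 < t" "t < 1" for x y t
  proof -
    let ?z = "(1 - t) *\<^sub>R x + t *\<^sub>R y"
    have K: "x \<in> K" "y \<in> K" using that by (auto simp: edom_def)
    have zK: "?z \<in> K" using convexD_alt[OF convex_K K, of t] that by simp
    have "h ?z \<le> ereal (1 - t) * h x + ereal t * h y"
      using assms(2) K that unfolding econvex_on_def by simp
    also have "\<dots> = ereal ((1 - t) * real_of_ereal (h x) + t * real_of_ereal (h y))"
      by (subst (1) edom_real[OF assms(1) that(1)], subst (1) edom_real[OF assms(1) that(2)]) simp
    finally have le: "h ?z \<le> ereal ((1 - t) * real_of_ereal (h x) + t * real_of_ereal (h y))" .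
    hence "h ?z \<noteq> \<infinity>" by auto
    hence z: "?z \<in> edom K h" using zK by (simp add: edom_def less_top[symmetric])
    have "ereal (real_of_ereal (h ?z)) \<le> ereal ((1 - t) * real_of_ereal (h x) + t * real_of_ereal (h y))"
      using le by (subst edom_real[OF assms(1) z, symmetric])
    with z show ?thesis by simp
  qed
  show "convex (edom K h)"
    unfolding convex_alt
  proof (intro ballI allI impI)
    fix x y and u :: real assume "x \<in> edom K h" "y \<in> edom K h" "0 \<le> u \<and> u \<le> 1"
    thus "(1 - u) *\<^sub>R x + u *\<^sub>R y \<in> edom K h"
      using *[of x y u] by (cases "u = 0 \<or> u = 1") auto
  qed
  thus "convex_on (edom K h) (\<lambda>x. real_of_ereal (h x))"
    using * by (intro convex_onI) auto
qed

lemma strong_convexity: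
  assumes "x \<in> edom K f" "y \<in> subdiff_dom K f"
  shows "D x y \<ge> (N (x - y))\<^sup>2 / 2"
proof -
  have y: "y \<in> edom K f" using assms(2) by (simp add: subdiff_dom_def)
  have "f x \<ge> f y + ereal (inner (f' y) (x - y)) + ereal ((N (x - y))\<^sup>2 / 2)"
    using dgf assms by (simp add: distance_generating_def)
  hence "ereal (fr x) \<ge> ereal (fr y) + ereal (inner (f' y) (x - y)) + ereal ((N (x - y))\<^sup>2 / 2)"
    using edom_real[OF proper_f assms(1)] edom_real[OF proper_f y] by simp
  thus ?thesis by (simp add: D_def)
qed

lemma D_nonneg: "x \<in> edom K f \<Longrightarrow> y \<in> subdiff_dom K f \<Longrightarrow> 0 \<le> D x y"
  using strong_convexity[of x y] by (meson order_trans zero_le_divide_iff zero_le_numeral zero_le_power2)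

lemma bregman_eq_D:
  assumes "x \<in> edom K f" "y \<in> edom K f"
  shows "bregman f f' x y = ereal (D x y)"
  unfolding bregman_def D_def
  by (subst (1) edom_real[OF proper_f assms(1)], subst (1) edom_real[OF proper_f assms(2)]) simp

lemma gradient_monotone:
  assumes "x \<in> subdiff_dom K f" "y \<in> subdiff_dom K f"
  shows "inner (f' x - f' y) (x - y) \<ge> (N (x - y))\<^sup>2"
proof -
  have "x \<in> edom K f" "y \<in> edom K f" using assms by (auto simp: subdiff_dom_def)
  hence "D x y \<ge> (N (x - y))\<^sup>2 / 2" "D y x \<ge> (N (y - x))\<^sup>2 / 2"
    using strong_convexity assms by auto
  moreover have "D x y + D y x = inner (f' x - f' y) (x - y)"
    by (simp add: D_def inner_diff_left inner_diff_right)
  ultimately show ?thesis using N_commute[of x y] by simp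
qed

text \<open>
  The objective of a proximal step, with a general convex part \<open>h\<close> so that \<open>h = 0\<close> gives the
  conjugate of the Bregman distance.
\<close>

definition prox_objective :: "real \<Rightarrow> ('a \<Rightarrow> ereal) \<Rightarrow> 'a \<Rightarrow> 'a \<Rightarrow> 'a \<Rightarrow> ereal" where
  "prox_objective a h l z x = ereal a * h x + ereal (inner l x) + bregman f f' x z"

lemma prox_objective_real:
  assumes "proper_on K h" "x \<in> edom K h" "x \<in> edom K f" "z \<in> edom K f"
  shows "prox_objective a h l z x = ereal (a * real_of_ereal (h x) + inner l x + D x z)"
  unfolding prox_objective_def bregman_eq_D[OF assms(3,4)]
  by (subst edom_real[OF assms(1,2)]) simp

text \<open>
  The quadratic growth of the Bregman distance beats the at most linear decrease of the rest of the
  objective, so the objective is coercive.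
\<close>

lemma ex_prox_point:
  assumes h: "proper_on K h" "econvex_on K h" "lsc_on K h"
    and x1: "x1 \<in> edom K h" "x1 \<in> edom K f" and z: "z \<in> subdiff_dom K f" and a: "0 < a"
  shows "\<exists>y. is_arg_min (prox_objective a h l z) (\<lambda>x. x \<in> K) y"
proof -
  have zf: "z \<in> edom K f" using z by (simp add: subdiff_dom_def)
  have nm: "h x \<noteq> -\<infinity>" "f x \<noteq> -\<infinity>" if "x \<in> K" for x
    using h(1) proper_f that by (auto simp: proper_on_def)
  have obj: "prox_objective a h l z x
      = ereal a * h x + (ereal (inner l x - fr z - inner (f' z) (x - z)) + f x)" if "x \<in> K" for x
  proof -
    have fz: "f z = ereal (fr z)" by (rule edom_real[OF proper_f zf])
    show ?thesis
      unfolding prox_objective_def bregman_def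
      by (subst fz, cases "f x"; cases "h x") (use nm[OF that] a in auto)
  qed
  have "lsc_on K (\<lambda>x. ereal a * h x + (ereal (inner l x - fr z - inner (f' z) (x - z)) + f x))"
    using nm a
    by (intro lsc_on_add lsc_on_scale lsc_on_continuous continuous_intros h(3) lsc_f)
       (auto simp: ereal_mult_eq_MInfty)
  hence lsc: "lsc_on K (prox_objective a h l z)"
    unfolding lsc_on_def using obj
    by (auto elim!: eventually_mono simp: eventually_at_filter)
  obtain c1 where c1: "c1 \<ge> 0" "\<And>x. x \<in> K \<Longrightarrow> ereal (- c1 * (1 + norm (x - x1))) \<le> h x"
    using convex_lsc_linear_minorant[OF closed_K convex_K h x1(1)] by blast
  obtain c where c: "c > 0" "\<And>x. c * norm x \<le> N x" using N_lower by blast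
  define V where "V = a * real_of_ereal (h x1) + inner l x1 + D x1 z"
  define k where "k = norm (z - x1)"
  have "filterlim (\<lambda>r::real. c\<^sup>2 * (r - k)\<^sup>2 / 2 - a * c1 * (1 + r) - norm l * (norm x1 + r)) at_top at_top"
    using c(1) by real_asymp
  hence "\<forall>\<^sub>F r in at_top. c\<^sup>2 * (r - k)\<^sup>2 / 2 - a * c1 * (1 + r) - norm l * (norm x1 + r) \<ge> V"
    by (simp add: filterlim_at_top)
  then obtain R0 where R0: "\<And>r. r \<ge> R0 \<Longrightarrow>
      c\<^sup>2 * (r - k)\<^sup>2 / 2 - a * c1 * (1 + r) - norm l * (norm x1 + r) \<ge> V"
    by (auto simp: eventually_at_top_linorder)
  show ?thesis
  proof (rule lsc_on_coercive_attains_inf[OF closed_K lsc, of x1 "max R0 k"])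
    show "x1 \<in> K" using x1 by (simp add: edom_def)
    fix x assume x: "x \<in> K" and far: "max R0 k < norm (x - x1)"
    define r where "r = norm (x - x1)"
    show "prox_objective a h l z x1 \<le> prox_objective a h l z x"
    proof (cases "x \<in> edom K h \<and> x \<in> edom K f")
      case False
      hence "h x = \<infinity> \<or> f x = \<infinity>" using x by (auto simp: edom_def)
      hence "prox_objective a h l z x = \<infinity>" using nm[OF x] a obj[OF x]
        by (cases "h x"; cases "f x") auto
      thus ?thesis by simp
    next
      case True
      have "ereal (- c1 * (1 + r)) \<le> ereal (real_of_ereal (h x))"
        using c1(2)[OF x] edom_real[OF h(1), of x] True by (simp add: r_def)
      hence "a * (- c1 * (1 + r)) \<le> a * real_of_ereal (h x)"
        using a by (intro mult_left_mono) auto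
      moreover have "norm x \<le> norm x1 + r" unfolding r_def by norm
      hence "norm l * norm x \<le> norm l * (norm x1 + r)" by (intro mult_left_mono) auto
      hence "inner l x \<ge> - (norm l * (norm x1 + r))"
        using Cauchy_Schwarz_ineq2[of l x] by linarith
      moreover have "D x z \<ge> c\<^sup>2 * (r - k)\<^sup>2 / 2"
      proof -
        have "r - k \<le> norm (x - z)" unfolding r_def k_def by norm
        hence "c * (r - k) \<le> N (x - z)" using c(1) c(2)[of "x - z"]
          by (meson mult_left_mono less_imp_le order_trans)
        moreover have "0 \<le> c * (r - k)" using c(1) far by (simp add: r_def)
        ultimately have "(c * (r - k))\<^sup>2 \<le> (N (x - z))\<^sup>2" by (intro power_mono)
        thus ?thesis using strong_convexity[of x z] True z by (simp add: power_mult_distrib)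
      qed
      moreover have "c\<^sup>2 * (r - k)\<^sup>2 / 2 - a * c1 * (1 + r) - norm l * (norm x1 + r) \<ge> V"
        using far by (intro R0) (simp add: r_def)
      ultimately have "V \<le> a * real_of_ereal (h x) + inner l x + D x z" by (simp add: mult.assoc)
      thus ?thesis
        using True x1 zf by (simp add: prox_objective_real h(1) V_def)
    qed
  qed
qed

lemma prox_point_edom:
  assumes h: "proper_on K h" and x1: "x1 \<in> edom K h" "x1 \<in> edom K f" and z: "z \<in> edom K f"
    and a: "0 < a" and y: "is_arg_min (prox_objective a h l z) (\<lambda>x. x \<in> K) y"
  shows "y \<in> edom K h" "y \<in> edom K f"
proof -
  have yK: "y \<in> K" and "prox_objective a h l z y \<le> prox_objective a h l z x1"
    using y x1 by (auto simp: is_arg_min_def not_less edom_def)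
  hence "prox_objective a h l z y \<noteq> \<infinity>"
    using prox_objective_real[OF h x1 z, of a l] by auto
  moreover have "h y \<noteq> -\<infinity>" "f y \<noteq> -\<infinity>" using h proper_f yK by (auto simp: proper_on_def)
  ultimately have "h y \<noteq> \<infinity>" "f y \<noteq> \<infinity>"
    using a edom_real[OF proper_f z] unfolding prox_objective_def bregman_def
    by (cases "h y"; cases "f y"; cases "f z"; auto)+
  thus "y \<in> edom K h" "y \<in> edom K f" using yK by (auto simp: edom_def)
qed

lemma prox_point_le:
  assumes h: "proper_on K h" and x1: "x1 \<in> edom K h" "x1 \<in> edom K f" and z: "z \<in> edom K f"
    and a: "0 < a" and y: "is_arg_min (prox_objective a h l z) (\<lambda>x. x \<in> K) y"
  shows "a * real_of_ereal (h y) + inner l y + D y z \<le> a * real_of_ereal (h x1) + inner l x1 + D x1 z"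
proof -
  have "prox_objective a h l z y \<le> prox_objective a h l z x1"
    using y x1 by (auto simp: is_arg_min_def not_less edom_def)
  thus ?thesis
    using prox_objective_real[OF h x1 z, of a l] prox_objective_real[OF h prox_point_edom[OF assms] z, of a l]
    by simp
qed

text \<open>
  First-order optimality: move from the minimizer towards \<open>u\<close>, use convexity of \<open>h\<close> along the
  segment, and let the step tend to zero in the difference quotient of \<open>f\<close>.
\<close>

lemma prox_point_variational_inequality:
  assumes h: "proper_on K h" "econvex_on K h" and z: "z \<in> edom K f" and a: "0 < a"
    and y: "is_arg_min (prox_objective a h l z) (\<lambda>x. x \<in> K) y" and ys: "y \<in> subdiff_dom K f"
    and u: "u \<in> edom K h" "u \<in> edom K f"
  shows "0 \<le> a * (real_of_ereal (h u) - real_of_ereal (h y)) + inner (l + f' y - f' z) (u - y)"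
proof -
  define hr where "hr = (\<lambda>x. real_of_ereal (h x))"
  have yd: "y \<in> edom K h" "y \<in> edom K f" using prox_point_edom[OF h(1) u z a y] by auto
  define yt where "yt = (\<lambda>t::real. y + t *\<^sub>R (u - y))"
  define q where "q = (\<lambda>t. (fr (yt t) - fr y) / t)"
  have "(fr has_derivative (\<lambda>v. inner (f' y) v)) (at y within edom K f)"
    using dgf ys by (simp add: distance_generating_def)
  moreover have yt_alt: "yt t = (1 - t) *\<^sub>R y + t *\<^sub>R u" for t by (simp add: yt_def algebra_simps)
  hence ytf: "yt ` {0..1} \<subseteq> edom K f"
    using convex_edom(1)[OF proper_f econvex_f] yd u by (auto intro!: convexD_alt)
  ultimately have "(fr has_derivative (\<lambda>v. inner (f' y) v)) (at (yt 0) within yt ` {0..1})"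
    by (auto simp: yt_def intro: has_derivative_subset)
  moreover have "(yt has_derivative (\<lambda>t. t *\<^sub>R (u - y))) (at 0 within {0..1})"
    unfolding yt_def by (auto intro!: derivative_eq_intros)
  ultimately have "((\<lambda>t. fr (yt t)) has_derivative (\<lambda>t. inner (f' y) (t *\<^sub>R (u - y)))) (at 0 within {0..1})"
    by (rule has_derivative_in_compose[rotated])
  hence "((\<lambda>t. fr (yt t)) has_field_derivative inner (f' y) (u - y)) (at 0 within {0..1})"
    unfolding has_field_derivative_def by (rule has_derivative_eq_rhs) (auto simp: mult.commute)
  hence lim: "(q \<longlongrightarrow> inner (f' y) (u - y)) (at 0 within {0..1})"
    by (simp add: has_field_derivative_iff q_def yt_def)
  have "0 \<le> a * (hr u - hr y) + inner (l - f' z) (u - y) + q t" if "t \<in> {0<..<1}" for t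
  proof -
    have t: "0 < t" "t < 1" using that by auto
    have ytd: "yt t \<in> edom K h" "yt t \<in> edom K f"
      unfolding yt_alt using convex_edom(1)[OF h] convex_edom(1)[OF proper_f econvex_f] yd u t
      by (auto intro!: convexD_alt)
    have "hr (yt t) \<le> (1 - t) * hr y + t * hr u"
      unfolding yt_alt hr_def
      using convex_onD[OF convex_edom(2)[OF h], of t y u] yd u t by simp
    hence "a * hr (yt t) \<le> a * ((1 - t) * hr y + t * hr u)" using a by (intro mult_left_mono) auto
    moreover have "a * hr y + inner l y + D y z \<le> a * hr (yt t) + inner l (yt t) + D (yt t) z"
      unfolding hr_def by (rule prox_point_le[OF h(1) ytd z a y])
    ultimately have "0 \<le> t * (a * (hr u - hr y) + inner (l - f' z) (u - y)) + (fr (yt t) - fr y)"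
      by (simp add: D_def yt_def inner_simps algebra_simps)
    hence "0 \<le> (t * (a * (hr u - hr y) + inner (l - f' z) (u - y)) + (fr (yt t) - fr y)) / t"
      using t by simp
    also have "\<dots> = a * (hr u - hr y) + inner (l - f' z) (u - y) + q t"
      using t by (simp add: q_def add_divide_distrib)
    finally show ?thesis .
  qed
  hence low: "- (a * (hr u - hr y) + inner (l - f' z) (u - y)) \<le> q t" if "0 < t" "t < 1" for t
    using that by (smt (verit) greaterThanLessThan_iff)
  have ev: "\<forall>\<^sub>F t in at 0 within {0..1}. - (a * (hr u - hr y) + inner (l - f' z) (u - y)) \<le> q t"
    unfolding eventually_at by (intro exI[of _ 1]) (use low in \<open>auto simp: dist_real_def\<close>)
  have "at (0::real) within {0..1} \<noteq> bot"
    by (simp add: trivial_limit_within islimpt_Icc)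
  from tendsto_lowerbound[OF lim ev this] show ?thesis
    by (simp add: hr_def inner_simps)
qed

text \<open>
  The conjugate of the Bregman distance from \<open>x0\<close>: Young's inequality bounds every linear
  functional by it, uniformly in the point, and strong convexity makes it 1-smooth for the dual
  norm. It therefore grows only by the second moment of a zero-mean increment, which is how a
  supremum over \<open>u\<close> of a noise term is controlled in expectation.
\<close>

lemma ex_bregman_conjugate:
  assumes x0: "x0 \<in> subdiff_dom K f"
  shows "\<exists>(\<psi> :: 'a \<Rightarrow> real) (\<eta> :: 'a \<Rightarrow> 'a). \<psi> 0 \<le> 0 \<and>
    (\<forall>v e. \<psi> (v + e) \<le> \<psi> v + inner e (\<eta> v) + (dual_norm N e)\<^sup>2 / 2) \<and>
    (\<forall>v. \<forall>u\<in>edom K f. inner v (u - x0) \<le> \<psi> v + D u x0)"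
proof -
  have x0f: "x0 \<in> edom K f" using x0 by (simp add: subdiff_dom_def)
  have edom0: "edom K (\<lambda>_. 0 :: ereal) = K" by (auto simp: edom_def)
  have x0K: "x0 \<in> K" using x0f by (simp add: edom_def)
  have h: "proper_on K (\<lambda>_. 0 :: ereal)" "econvex_on K (\<lambda>_. 0 :: ereal)" "lsc_on K (\<lambda>_. 0 :: ereal)"
    using x0K lsc_on_continuous[of K "\<lambda>_. 0"]
    by (auto simp: proper_on_def econvex_on_def edom_def zero_ereal_def)
  have "\<exists>y. is_arg_min (prox_objective 1 (\<lambda>_. 0) (- v) x0) (\<lambda>x. x \<in> K) y" for v
    using ex_prox_point[OF h _ x0f x0, of 1 "- v"] x0K by (simp add: edom0)
  then obtain Y where Y: "\<And>v. is_arg_min (prox_objective 1 (\<lambda>_. 0) (- v) x0) (\<lambda>x. x \<in> K) (Y v)"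
    by metis
  have inK: "x \<in> edom K (\<lambda>_. 0 :: ereal)" if "x \<in> edom K f" for x using that by (simp add: edom_def)
  have Yf: "Y v \<in> edom K f" for v
    using prox_point_edom[OF h(1) inK[OF x0f] x0f x0f _ Y] by simp
  have Y_le: "D (Y v) x0 - inner v (Y v) \<le> D u x0 - inner v u" if "u \<in> edom K f" for u v
    using prox_point_le[OF h(1) inK[OF that] that x0f _ Y, of v] by simp
  have Y_sub: "Y v \<in> subdiff_dom K f" for v
  proof -
    have "f (Y v) + ereal (inner (v + f' x0) (x - Y v)) \<le> f x" if "x \<in> K" for x
    proof (cases "x \<in> edom K f")
      case True
      have "fr (Y v) + inner (v + f' x0) (x - Y v) \<le> fr x"
        using Y_le[OF True, of v] by (simp add: D_def inner_simps)
      thus ?thesis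
        by (subst edom_real[OF proper_f Yf], subst edom_real[OF proper_f True]) simp
    qed (use that in \<open>auto simp: edom_def\<close>)
    thus ?thesis using Yf by (auto simp: subdiff_dom_def subdifferential_def)
  qed
  have Y_strong: "D (Y v) x0 - inner v (Y v) + (N (u - Y v))\<^sup>2 / 2 \<le> D u x0 - inner v u"
    if u: "u \<in> edom K f" for u v
  proof -
    have "0 \<le> inner (- v + f' (Y v) - f' x0) (u - Y v)"
      using prox_point_variational_inequality[OF h(1,2) x0f _ Y Y_sub inK[OF u] u, of v] by simp
    thus ?thesis using strong_convexity[OF u Y_sub, of v] by (simp add: D_def inner_simps)
  qed
  define \<psi> where "\<psi> = (\<lambda>v. inner v (Y v - x0) - D (Y v) x0)"
  show ?thesis
  proof (intro exI[of _ \<psi>] exI[of _ "\<lambda>v. Y v - x0"] conjI allI ballI)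
    show "\<psi> 0 \<le> 0" using D_nonneg[OF Yf x0] by (simp add: \<psi>_def)
    show "inner v (u - x0) \<le> \<psi> v + D u x0" if "u \<in> edom K f" for v u
      using Y_le[OF that, of v] by (simp add: \<psi>_def inner_simps)
    show "\<psi> (v + e) \<le> \<psi> v + inner e (Y v - x0) + (dual_norm N e)\<^sup>2 / 2" for v e
      using Y_strong[OF Yf, of v "v + e"] inner_le_half_squares[of e "Y (v + e) - Y v"]
      by (simp add: \<psi>_def inner_simps)
  qed
qed

end

section \<open>Expectations over finitely many outcomes\<close>

abbreviation (input) expect :: "'b pmf \<Rightarrow> ('b \<Rightarrow> real) \<Rightarrow> real" where
  "expect \<equiv> measure_pmf.expectation"

lemma expect_mono:
  assumes "finite (set_pmf p)" "\<And>x. x \<in> set_pmf p \<Longrightarrow> h x \<le> h' x"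
  shows "expect p h \<le> expect p h'"
  using assms by (intro integral_mono_AE integrable_measure_pmf_finite) (auto simp: AE_measure_pmf_iff)

lemma expect_cong:
  assumes "\<And>x. x \<in> set_pmf p \<Longrightarrow> h x = h' x"
  shows "expect p h = expect p h'"
  using assms by (intro integral_cong_AE) (auto simp: AE_measure_pmf_iff)

lemma expect_add:
  "finite (set_pmf p) \<Longrightarrow> expect p (\<lambda>x. h x + h' x) = expect p h + expect p h'"
  by (intro Bochner_Integration.integral_add integrable_measure_pmf_finite)

lemma expect_diff:
  "finite (set_pmf p) \<Longrightarrow> expect p (\<lambda>x. h x - h' x) = expect p h - expect p h'"
  by (intro Bochner_Integration.integral_diff integrable_measure_pmf_finite)

lemma expect_bind:
  assumes "finite (set_pmf p)" "\<And>x. x \<in> set_pmf p \<Longrightarrow> finite (set_pmf (r x))"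
  shows "expect (bind_pmf p r) h = expect p (\<lambda>x. expect (r x) h)"
  using assms
  by (subst pmf_expectation_bind[of "set_pmf p"]) (auto simp: integral_measure_pmf[of "set_pmf p"])

lemma expect_commute:
  assumes "finite (set_pmf p)" "finite (set_pmf r)"
  shows "expect p (\<lambda>x. expect r (h x)) = expect r (\<lambda>y. expect p (\<lambda>x. h x y))"
proof -
  have "expect p (\<lambda>x. expect r (h x)) = (\<Sum>x\<in>set_pmf p. \<Sum>y\<in>set_pmf r. pmf p x * (pmf r y * h x y))"
    using assms by (simp add: integral_measure_pmf[of "set_pmf p"] integral_measure_pmf[of "set_pmf r"]
        sum_distrib_left)
  also have "\<dots> = (\<Sum>y\<in>set_pmf r. \<Sum>x\<in>set_pmf p. pmf p x * (pmf r y * h x y))"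
    by (rule sum.swap)
  also have "\<dots> = expect r (\<lambda>y. expect p (\<lambda>x. h x y))"
    using assms by (simp add: integral_measure_pmf[of "set_pmf p"] integral_measure_pmf[of "set_pmf r"]
        sum_distrib_left mult.left_commute)
  finally show ?thesis .
qed

lemma finite_set_replicate_pmf: "finite (set_pmf q) \<Longrightarrow> finite (set_pmf (replicate_pmf n q))"
  using finite_lists_length_eq[of "set_pmf q" n]
  by (simp add: set_replicate_pmf lists_eq_set)

lemma expect_replicate_Suc:
  assumes "finite (set_pmf q)"
  shows "expect (replicate_pmf (Suc n) q) h = expect q (\<lambda>x. expect (replicate_pmf n q) (\<lambda>xs. h (x # xs)))"
  using assms
  by (simp add: expect_bind finite_set_replicate_pmf)

lemma expect_replicate_sum_list:
  assumes "finite (set_pmf q)"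
  shows "expect (replicate_pmf n q) (\<lambda>xs. \<Sum>x\<leftarrow>xs. G x) = real n * expect q G"
proof (induction n)
  case (Suc n)
  show ?case
    using assms Suc
    by (simp del: replicate_pmf.simps
        add: expect_replicate_Suc expect_add finite_set_replicate_pmf algebra_simps)
qed simp

lemma sum_list_square_le:
  fixes G :: "'b \<Rightarrow> real"
  shows "(\<Sum>x\<leftarrow>xs. G x)\<^sup>2 \<le> real (length xs) * (\<Sum>x\<leftarrow>xs. (G x)\<^sup>2)"
  using sum_squared_le_sum_of_squares[of "\<lambda>i. G (xs ! i)" "{0..<length xs}"]
  by (simp add: sum_list_sum_nth mult.commute)

context finite_dim_norm
begin

lemma dual_norm_sum_list: "dual_norm N (\<Sum>x\<leftarrow>xs. X x) \<le> (\<Sum>x\<leftarrow>xs. dual_norm N (X x))"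
proof (induction xs)
  case Nil
  show ?case by (auto intro!: dual_norm_le)
next
  case (Cons x xs)
  thus ?case using dual_norm_triangle[of "X x" "\<Sum>x\<leftarrow>xs. X x"] by simp
qed

text \<open>
  The triangle inequality and Cauchy-Schwarz only; in a general norm an average of independent
  terms need not have a smaller second moment than this.
\<close>

lemma dual_norm_average_square:
  assumes "length xs = b"
  shows "(dual_norm N ((1 / real b) *\<^sub>R (\<Sum>x\<leftarrow>xs. X x)))\<^sup>2
    \<le> (1 / real b) * (\<Sum>x\<leftarrow>xs. (dual_norm N (X x))\<^sup>2)"
proof (cases "b = 0")
  case True
  thus ?thesis using assms dual_norm_scale[of 0 0] dual_norm_nonneg[of 0] by simp
next
  case False
  have "dual_norm N ((1 / real b) *\<^sub>R (\<Sum>x\<leftarrow>xs. X x)) \<le> (1 / real b) * (\<Sum>x\<leftarrow>xs. dual_norm N (X x))"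
    using dual_norm_scale[of "1 / real b" "\<Sum>x\<leftarrow>xs. X x"] dual_norm_sum_list[of X xs]
      mult_left_mono[of _ _ "1 / real b"] by (meson order_trans of_nat_0_le_iff zero_le_divide_1_iff)
  hence "(dual_norm N ((1 / real b) *\<^sub>R (\<Sum>x\<leftarrow>xs. X x)))\<^sup>2
      \<le> ((1 / real b) * (\<Sum>x\<leftarrow>xs. dual_norm N (X x)))\<^sup>2"
    by (intro power_mono) auto
  also have "\<dots> = (1 / (real b)\<^sup>2) * (\<Sum>x\<leftarrow>xs. dual_norm N (X x))\<^sup>2"
    by (simp add: power_mult_distrib power_divide)
  also have "\<dots> \<le> (1 / (real b)\<^sup>2) * (real b * (\<Sum>x\<leftarrow>xs. (dual_norm N (X x))\<^sup>2))"
    using sum_list_square_le[of "\<lambda>x. dual_norm N (X x)" xs] assms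
    by (intro mult_left_mono) auto
  also have "\<dots> = (1 / real b) * (\<Sum>x\<leftarrow>xs. (dual_norm N (X x))\<^sup>2)"
    using False by (simp add: power2_eq_square)
  finally show ?thesis .
qed

text \<open>
  Replacing the sample by an independent copy leaves the law unchanged, so only the variation of
  \<open>h\<close> between the two copies correlates with the centred noise.
\<close>

lemma single_sample_correlation:
  fixes X h :: "'b \<Rightarrow> 'a"
  assumes fin: "finite (set_pmf q)" and d: "d = measure_pmf.expectation q X" and "0 \<le> \<kappa>"
    and lip: "\<And>x y. x \<in> set_pmf q \<Longrightarrow> y \<in> set_pmf q \<Longrightarrow>
      N (h x - h y) \<le> \<kappa> * dual_norm N (X x - X y)"
  shows "expect q (\<lambda>x. - inner (X x - d) (h x)) \<le> 2 * \<kappa> * expect q (\<lambda>x. (dual_norm N (X x))\<^sup>2)"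
proof -
  define T where "T = expect q (\<lambda>x. - inner (X x - d) (h x))"
  define V where "V = expect q (\<lambda>x. (dual_norm N (X x))\<^sup>2)"
  have inner_d: "expect q (\<lambda>y. inner (X y) v) = inner d v" for v
    unfolding d using fin by (intro integral_inner_left integrable_measure_pmf_finite)
  have T1: "T = expect q (\<lambda>x. expect q (\<lambda>y. - inner (X x - X y) (h x)))"
    unfolding T_def by (simp add: inner_diff_left expect_diff fin inner_d)
  have T2: "T = expect q (\<lambda>x. expect q (\<lambda>y. - inner (X y - X x) (h y)))"
    unfolding T1 using fin by (intro expect_commute)
  have "T + T = expect q (\<lambda>x. expect q (\<lambda>y. - inner (X x - X y) (h x)))
      + expect q (\<lambda>x. expect q (\<lambda>y. - inner (X y - X x) (h y)))"
    using T1 T2 by presburger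
  also have "\<dots> = expect q (\<lambda>x. expect q (\<lambda>y. - inner (X x - X y) (h x))
      + expect q (\<lambda>y. - inner (X y - X x) (h y)))"
    using fin by (rule expect_add[symmetric])
  also have "\<dots> = expect q (\<lambda>x. expect q (\<lambda>y. - inner (X x - X y) (h x - h y)))"
    using fin by (simp add: expect_add[symmetric] inner_simps algebra_simps)
  also have "\<dots> \<le> expect q (\<lambda>x. expect q (\<lambda>y.
      2 * \<kappa> * (dual_norm N (X x))\<^sup>2 + 2 * \<kappa> * (dual_norm N (X y))\<^sup>2))"
  proof (intro expect_mono fin)
    fix x y assume xy: "x \<in> set_pmf q" "y \<in> set_pmf q"
    have "- inner (X x - X y) (h x - h y) \<le> dual_norm N (X x - X y) * N (h x - h y)"
      using abs_inner_le_dual_norm[of "X x - X y" "h x - h y"] by linarith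
    also have "\<dots> \<le> dual_norm N (X x - X y) * (\<kappa> * dual_norm N (X x - X y))"
      using lip[OF xy] by (intro mult_left_mono) auto
    also have "\<dots> = \<kappa> * (dual_norm N (X x - X y))\<^sup>2" by (simp add: power2_eq_square)
    also have "\<dots> \<le> \<kappa> * (2 * (dual_norm N (X x))\<^sup>2 + 2 * (dual_norm N (X y))\<^sup>2)"
      using \<open>0 \<le> \<kappa>\<close> by (intro mult_left_mono dual_norm_diff_square)
    finally show "- inner (X x - X y) (h x - h y)
        \<le> 2 * \<kappa> * (dual_norm N (X x))\<^sup>2 + 2 * \<kappa> * (dual_norm N (X y))\<^sup>2"
      by (simp add: algebra_simps)
  qed
  also have "\<dots> = 4 * \<kappa> * V"
    using fin by (simp add: expect_add V_def)
  finally show ?thesis by (simp add: T_def V_def)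
qed

text \<open>
  Only one summand at a time has to be resampled, so a batch average gains the full factor \<open>1 / b\<close>
  in every norm, although the second moment of the average itself need not.
\<close>

lemma iid_sum_correlation:
  fixes X :: "'b \<Rightarrow> 'a" and h :: "'b list \<Rightarrow> 'a"
  assumes fin: "finite (set_pmf q)" and d: "d = measure_pmf.expectation q X" and \<kappa>: "0 \<le> \<kappa>"
    and lip: "\<And>xs ys. xs \<in> set_pmf (replicate_pmf n q) \<Longrightarrow> ys \<in> set_pmf (replicate_pmf n q) \<Longrightarrow>
      N (h xs - h ys) \<le> \<kappa> * dual_norm N ((\<Sum>x\<leftarrow>xs. X x) - (\<Sum>x\<leftarrow>ys. X x))"
  shows "expect (replicate_pmf n q) (\<lambda>xs. - inner (\<Sum>x\<leftarrow>xs. X x - d) (h xs))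
    \<le> 2 * real n * \<kappa> * expect q (\<lambda>x. (dual_norm N (X x))\<^sup>2)"
  using lip
proof (induction n arbitrary: h)
  case (Suc n)
  define R where "R = replicate_pmf n q"
  define V where "V = expect q (\<lambda>x. (dual_norm N (X x))\<^sup>2)"
  have finR: "finite (set_pmf R)" unfolding R_def by (rule finite_set_replicate_pmf[OF fin])
  have supp: "x # xs \<in> set_pmf (replicate_pmf (Suc n) q)" if "x \<in> set_pmf q" "xs \<in> set_pmf R" for x xs
    using that by (auto simp: R_def)
  have "expect (replicate_pmf (Suc n) q) (\<lambda>xs. - inner (\<Sum>x\<leftarrow>xs. X x - d) (h xs))
      = expect q (\<lambda>x. expect R (\<lambda>xs. - inner (X x - d) (h (x # xs))))
        + expect q (\<lambda>x. expect R (\<lambda>xs. - inner (\<Sum>x\<leftarrow>xs. X x - d) (h (x # xs))))"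
    using fin finR by (simp del: replicate_pmf.simps
        add: expect_replicate_Suc R_def[symmetric] expect_add[symmetric] inner_add_left algebra_simps)
  also have "expect q (\<lambda>x. expect R (\<lambda>xs. - inner (X x - d) (h (x # xs))))
      = expect R (\<lambda>xs. expect q (\<lambda>x. - inner (X x - d) (h (x # xs))))"
    using fin finR by (rule expect_commute)
  also have "\<dots> \<le> expect R (\<lambda>xs. 2 * \<kappa> * V)"
    unfolding V_def
  proof (intro expect_mono finR single_sample_correlation fin d \<kappa>)
    fix xs x y assume "xs \<in> set_pmf R" "x \<in> set_pmf q" "y \<in> set_pmf q"
    thus "N (h (x # xs) - h (y # xs)) \<le> \<kappa> * dual_norm N (X x - X y)"
      using Suc.prems[OF supp supp, of x xs y xs] by simp
  qed
  also have "expect q (\<lambda>x. expect R (\<lambda>xs. - inner (\<Sum>x\<leftarrow>xs. X x - d) (h (x # xs))))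
      \<le> expect q (\<lambda>x. 2 * real n * \<kappa> * V)"
    unfolding V_def R_def
  proof (intro expect_mono fin Suc.IH)
    fix x xs ys assume "x \<in> set_pmf q" "xs \<in> set_pmf (replicate_pmf n q)" "ys \<in> set_pmf (replicate_pmf n q)"
    thus "N (h (x # xs) - h (x # ys)) \<le> \<kappa> * dual_norm N ((\<Sum>x\<leftarrow>xs. X x) - (\<Sum>x\<leftarrow>ys. X x))"
      using Suc.prems[OF supp supp, of x xs x ys] by (simp add: R_def)
  qed
  finally show ?case by (simp add: V_def algebra_simps)
qed simp

end

section \<open>The algorithm and its reachable states\<close>

lemma sum_list_add_const:
  fixes c :: "'b::real_vector"
  shows "(\<Sum>x\<leftarrow>xs. c + X x) = real (length xs) *\<^sub>R c + (\<Sum>x\<leftarrow>xs. X x)"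
  by (induction xs) (simp_all add: algebra_simps)

locale vr_method = mirror_setting N K g f f'
  for N :: "'a::euclidean_space \<Rightarrow> real" and K :: "'a set" and g f :: "'a \<Rightarrow> ereal" and f' :: "'a \<Rightarrow> 'a" +
  fixes F :: "'a \<Rightarrow> 'a" and Fo :: "nat \<Rightarrow> 'a \<Rightarrow> 'a" and Q :: "'a \<Rightarrow> 'a \<Rightarrow> nat pmf"
    and M b :: nat and L Lbar p \<gamma> \<alpha> :: real and x0 :: 'a
  assumes monotone_F: "monotone_operator_on (edom K g) F"
    and stochastic: "variable_lipschitz_oracle N Lbar (edom K g) M F Fo Q"
    and lipschitz_F: "lipschitz_operator_on N L (edom K g) F"
    and b_pos: "1 \<le> b" and p01: "0 < p" "p < 1" and \<gamma>01: "0 < \<gamma>" "\<gamma> < 1" and \<alpha>_pos: "0 < \<alpha>"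
    and x0_edom: "x0 \<in> edom K g"
    and well_defined: "vr_well_defined K f f' \<gamma> (vr_run K g f f' F Fo Q b p \<gamma> \<alpha> x0)"
begin

abbreviation run :: "nat \<Rightarrow> ((int \<Rightarrow> 'a) \<times> (int \<Rightarrow> 'a)) pmf" where
  "run \<equiv> vr_run K g f f' F Fo Q b p \<gamma> \<alpha> x0"

definition extrapolation :: "(int \<Rightarrow> 'a) \<Rightarrow> int \<Rightarrow> 'a" where
  "extrapolation x t =
     inv_into (subdiff_dom K f) f' (\<gamma> *\<^sub>R f' (x t) + (1 - \<gamma>) *\<^sub>R f' (x (t - 1)))"

definition direction :: "(int \<Rightarrow> 'a) \<Rightarrow> (int \<Rightarrow> 'a) \<Rightarrow> int \<Rightarrow> nat list \<Rightarrow> 'a" where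
  "direction x w t \<xi>s = (1 / real b) *\<^sub>R (\<Sum>\<xi>\<leftarrow>\<xi>s. F (w t) + Fo \<xi> (x t) - Fo \<xi> (w (t - 1)))"

definition successor :: "(int \<Rightarrow> 'a) \<Rightarrow> (int \<Rightarrow> 'a) \<Rightarrow> int \<Rightarrow> nat list \<Rightarrow> 'a" where
  "successor x w t \<xi>s = prox_step K g f f' \<alpha> (direction x w t \<xi>s) (extrapolation x t)"

definition samples :: "(int \<Rightarrow> 'a) \<Rightarrow> (int \<Rightarrow> 'a) \<Rightarrow> int \<Rightarrow> nat list pmf" where
  "samples x w t = replicate_pmf b (Q (x t) (w (t - 1)))"

definition drift :: "(int \<Rightarrow> 'a) \<Rightarrow> (int \<Rightarrow> 'a) \<Rightarrow> int \<Rightarrow> 'a" where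
  "drift x w t = F (x t) - F (w (t - 1))"

definition noise :: "(int \<Rightarrow> 'a) \<Rightarrow> (int \<Rightarrow> 'a) \<Rightarrow> int \<Rightarrow> nat list \<Rightarrow> 'a" where
  "noise x w t \<xi>s = (1 / real b) *\<^sub>R (\<Sum>\<xi>\<leftarrow>\<xi>s. Fo \<xi> (x t) - Fo \<xi> (w (t - 1)) - drift x w t)"

definition admissible :: "int \<Rightarrow> (int \<Rightarrow> 'a) \<Rightarrow> (int \<Rightarrow> 'a) \<Rightarrow> bool" where
  "admissible t x w \<longleftrightarrow>
     (\<forall>i\<le>t. x i \<in> subdiff_dom K f \<and> x i \<in> edom K g \<and> w i \<in> edom K g) \<and>
     \<gamma> *\<^sub>R f' (x t) + (1 - \<gamma>) *\<^sub>R f' (x (t - 1)) \<in> f' ` subdiff_dom K f"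

text \<open>
  The part of the one-step estimate that does not involve the comparison point.
\<close>

definition residual :: "(int \<Rightarrow> 'a) \<Rightarrow> (int \<Rightarrow> 'a) \<Rightarrow> int \<Rightarrow> nat list \<Rightarrow> real" where
  "residual x w t \<xi>s =
     (let y = successor x w t \<xi>s in
        \<alpha> * inner (drift x w t) (x t - y) + \<alpha> * inner (noise x w t \<xi>s) (x0 - y)
        - \<gamma> * D y (x t) - (1 - \<gamma>) * D y (x (t - 1)))"

text \<open>
  A step of the algorithm that also accumulates the noise in \<open>v\<close>, which the trajectory does not
  determine, and the residuals in \<open>q\<close>.
\<close>

definition aug_step ::
  "int \<Rightarrow> ((int \<Rightarrow> 'a) \<times> (int \<Rightarrow> 'a)) \<times> 'a \<times> real \<Rightarrow> (((int \<Rightarrow> 'a) \<times> (int \<Rightarrow> 'a)) \<times> 'a \<times> real) pmf" where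
  "aug_step t = (\<lambda>((x, w), (v, q)).
     bind_pmf (samples x w t) (\<lambda>\<xi>s.
     bind_pmf (bernoulli_pmf p) (\<lambda>coin.
       return_pmf ((x(t + 1 := successor x w t \<xi>s),
                    w(t + 1 := if coin then successor x w t \<xi>s else x t)),
                   (v + \<alpha> *\<^sub>R noise x w t \<xi>s, q + residual x w t \<xi>s)))))"

primrec aug_run :: "nat \<Rightarrow> (((int \<Rightarrow> 'a) \<times> (int \<Rightarrow> 'a)) \<times> 'a \<times> real) pmf" where
  "aug_run 0 = return_pmf ((\<lambda>_. x0, \<lambda>_. x0), (0, 0))"
| "aug_run (Suc s) = bind_pmf (aug_run s) (aug_step (int s))"

lemma vr_step_eq:
  "vr_step K g f f' F Fo Q b p \<gamma> \<alpha> t (x, w) =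
     bind_pmf (samples x w t) (\<lambda>\<xi>s. bind_pmf (bernoulli_pmf p) (\<lambda>coin.
       return_pmf (x(t + 1 := successor x w t \<xi>s),
                   w(t + 1 := if coin then successor x w t \<xi>s else x t))))"
  unfolding vr_step_def Let_def samples_def successor_def direction_def extrapolation_def by simp

lemma map_fst_aug_run: "map_pmf fst (aug_run s) = run s"
proof (induction s)
  case (Suc s)
  have "map_pmf fst (aug_step (int s) \<sigma>) = vr_step K g f f' F Fo Q b p \<gamma> \<alpha> (int s) (fst \<sigma>)" for \<sigma>
    by (cases \<sigma>) (auto simp: aug_step_def vr_step_eq map_bind_pmf split: prod.splits)
  hence "map_pmf fst (aug_run (Suc s)) =
      bind_pmf (map_pmf fst (aug_run s)) (vr_step K g f f' F Fo Q b p \<gamma> \<alpha> (int s))"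
    by (simp add: map_bind_pmf bind_map_pmf)
  thus ?case by (simp only: Suc vr_run.simps)
qed simp

lemma run_wd:
  assumes "(x, w) \<in> set_pmf (run s)"
  shows "x (int s) \<in> subdiff_dom K f"
    and "\<gamma> *\<^sub>R f' (x (int s)) + (1 - \<gamma>) *\<^sub>R f' (x (int s - 1)) \<in> f' ` subdiff_dom K f"
  using well_defined assms unfolding vr_well_defined_def by blast+

lemma x0_subdiff: "x0 \<in> subdiff_dom K f"
  using run_wd(1)[of "\<lambda>_. x0" "\<lambda>_. x0" 0] by simp

lemma edom_gf: "x \<in> edom K g \<Longrightarrow> x \<in> edom K f"
  using edom_g_le by blast

lemma extrapolation:
  assumes "admissible t x w"
  shows "extrapolation x t \<in> subdiff_dom K f"
    and "f' (extrapolation x t) = \<gamma> *\<^sub>R f' (x t) + (1 - \<gamma>) *\<^sub>R f' (x (t - 1))"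
  using assms unfolding admissible_def extrapolation_def
  by (auto intro: inv_into_into f_inv_into_f)

lemma successor_is_prox_point:
  assumes "admissible t x w"
  shows "is_arg_min (prox_objective \<alpha> g (\<alpha> *\<^sub>R direction x w t \<xi>s) (extrapolation x t))
           (\<lambda>x. x \<in> K) (successor x w t \<xi>s)"
proof -
  have eq: "successor x w t \<xi>s =
      (SOME y. is_arg_min (prox_objective \<alpha> g (\<alpha> *\<^sub>R direction x w t \<xi>s) (extrapolation x t)) (\<lambda>x. x \<in> K) y)"
    unfolding successor_def prox_step_def arg_min_def
    by (simp add: prox_objective_def[abs_def])
  show ?thesis
    unfolding eq
    by (rule someI_ex, rule ex_prox_point[OF proper_g econvex_g lsc_g x0_edom edom_gf[OF x0_edom]
          extrapolation(1)[OF assms] \<alpha>_pos])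
qed

lemma extrapolation_edom: "admissible t x w \<Longrightarrow> extrapolation x t \<in> edom K f"
  using extrapolation(1) by (simp add: subdiff_dom_def)

lemma successor_edom:
  assumes "admissible t x w" shows "successor x w t \<xi>s \<in> edom K g"
  using prox_point_edom(1)[OF proper_g x0_edom edom_gf[OF x0_edom] extrapolation_edom[OF assms]
      \<alpha>_pos successor_is_prox_point[OF assms]] .

lemma successor_variational_inequality:
  assumes "admissible t x w" "successor x w t \<xi>s \<in> subdiff_dom K f" "u \<in> edom K g"
  defines "y \<equiv> successor x w t \<xi>s"
  shows "0 \<le> \<alpha> * (gr u - gr y)
    + inner (\<alpha> *\<^sub>R direction x w t \<xi>s + f' y - (\<gamma> *\<^sub>R f' (x t) + (1 - \<gamma>) *\<^sub>R f' (x (t - 1)))) (u - y)"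
  using prox_point_variational_inequality[OF proper_g econvex_g extrapolation_edom[OF assms(1)]
      \<alpha>_pos successor_is_prox_point[OF assms(1)] assms(2,3) edom_gf[OF assms(3)]]
  unfolding extrapolation(2)[OF assms(1)] y_def .

text \<open>
  Adding the two variational inequalities and using strong monotonicity of the gradient. The
  points are required to lie in the domain of the subdifferential because strong convexity of \<open>f\<close>
  is available only there.
\<close>

lemma successor_lipschitz:
  assumes "admissible t x w" "admissible t x w'"
    and "successor x w t \<xi>s \<in> subdiff_dom K f" "successor x w' t \<xi>s' \<in> subdiff_dom K f"
  shows "N (successor x w t \<xi>s - successor x w' t \<xi>s')
    \<le> \<alpha> * dual_norm N (direction x w t \<xi>s - direction x w' t \<xi>s')"
proof -
  define y y' where "y = successor x w t \<xi>s" and "y' = successor x w' t \<xi>s'"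
  define d d' where "d = direction x w t \<xi>s" and "d' = direction x w' t \<xi>s'"
  note vi = successor_variational_inequality[OF assms(1,3) successor_edom[OF assms(2)], of \<xi>s']
            successor_variational_inequality[OF assms(2,4) successor_edom[OF assms(1)], of \<xi>s]
  have "(N (y - y'))\<^sup>2 \<le> inner (f' y - f' y') (y - y')"
    using gradient_monotone assms(3,4) by (simp add: y_def y'_def)
  also have "\<dots> \<le> - (\<alpha> * inner (d - d') (y - y'))"
    using vi unfolding y_def[symmetric] y'_def[symmetric] d_def[symmetric] d'_def[symmetric]
    by (simp add: inner_simps algebra_simps)
  also have "\<dots> \<le> \<alpha> * (dual_norm N (d - d') * N (y - y'))"
  proof -
    have "- inner (d - d') (y - y') \<le> dual_norm N (d - d') * N (y - y')"
      using abs_inner_le_dual_norm[of "d - d'" "y - y'"] by linarith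
    hence "\<alpha> * - inner (d - d') (y - y') \<le> \<alpha> * (dual_norm N (d - d') * N (y - y'))"
      using \<alpha>_pos by (intro mult_left_mono) auto
    thus ?thesis by simp
  qed
  finally have "N (y - y') * N (y - y') \<le> (\<alpha> * dual_norm N (d - d')) * N (y - y')"
    by (simp add: power2_eq_square mult.assoc)
  hence "N (y - y') \<le> \<alpha> * dual_norm N (d - d')"
    using \<alpha>_pos by (cases "y = y'") (auto simp: mult_le_cancel_right less_le)
  thus ?thesis by (simp add: y_def y'_def d_def d'_def)
qed

lemma direction_eq:
  assumes "length \<xi>s = b"
  shows "direction x w t \<xi>s = F (w t) + drift x w t + noise x w t \<xi>s"
proof -
  have eq: "(\<Sum>\<xi>\<leftarrow>\<xi>s. F (w t) + Fo \<xi> (x t) - Fo \<xi> (w (t - 1)))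
      = (\<Sum>\<xi>\<leftarrow>\<xi>s. (F (w t) + drift x w t) + (Fo \<xi> (x t) - Fo \<xi> (w (t - 1)) - drift x w t))"
    by (intro arg_cong[of _ _ sum_list] map_cong) (auto simp: algebra_simps)
  show ?thesis
    unfolding direction_def noise_def eq
      sum_list_add_const[of "F (w t) + drift x w t" "\<lambda>\<xi>. Fo \<xi> (x t) - Fo \<xi> (w (t - 1)) - drift x w t"]
    using b_pos assms by (simp add: scaleR_right_distrib)
qed

lemma direction_diff:
  assumes "length \<xi>s = b" "length \<xi>s' = b"
  shows "direction x w t \<xi>s - direction x w t \<xi>s' = (1 / real b) *\<^sub>R
    ((\<Sum>\<xi>\<leftarrow>\<xi>s. Fo \<xi> (x t) - Fo \<xi> (w (t - 1))) - (\<Sum>\<xi>\<leftarrow>\<xi>s'. Fo \<xi> (x t) - Fo \<xi> (w (t - 1))))"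
proof -
  have "direction x w t \<xi>s = F (w t) + (1 / real b) *\<^sub>R (\<Sum>\<xi>\<leftarrow>\<xi>s. Fo \<xi> (x t) - Fo \<xi> (w (t - 1)))"
    if "length \<xi>s = b" for \<xi>s
    using sum_list_add_const[of "F (w t)" "\<lambda>\<xi>. Fo \<xi> (x t) - Fo \<xi> (w (t - 1))" \<xi>s] that b_pos
    by (simp add: direction_def scaleR_right_distrib add_diff_eq)
  thus ?thesis using assms by (simp add: scaleR_right_diff_distrib)
qed

lemma samples_length: "\<xi>s \<in> set_pmf (samples x w t) \<Longrightarrow> length \<xi>s = b"
  by (simp add: samples_def set_replicate_pmf)

lemma finite_Q:
  assumes "admissible t x w" shows "finite (set_pmf (Q (x t) (w (t - 1))))"
proof -
  have "x t \<in> edom K g" "w (t - 1) \<in> edom K g" using assms by (auto simp: admissible_def)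
  hence "set_pmf (Q (x t) (w (t - 1))) \<subseteq> {1..M}"
    using stochastic unfolding variable_lipschitz_oracle_def by blast
  thus ?thesis by (rule finite_subset) simp
qed

lemma finite_samples: "admissible t x w \<Longrightarrow> finite (set_pmf (samples x w t))"
  unfolding samples_def by (intro finite_set_replicate_pmf finite_Q)

lemma run_SucE:
  assumes "(x', w') \<in> set_pmf (run (Suc s))"
  obtains x w \<xi>s z where "(x, w) \<in> set_pmf (run s)" "\<xi>s \<in> set_pmf (samples x w (int s))"
    "x' = x(int s + 1 := successor x w (int s) \<xi>s)" "w' = w(int s + 1 := z)"
    "z = successor x w (int s) \<xi>s \<or> z = x (int s)"
proof -
  from assms obtain x w where st: "(x, w) \<in> set_pmf (run s)"
    "(x', w') \<in> set_pmf (vr_step K g f f' F Fo Q b p \<gamma> \<alpha> (int s) (x, w))"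
    by auto
  from st(2) obtain \<xi>s coin where "\<xi>s \<in> set_pmf (samples x w (int s))"
    "x' = x(int s + 1 := successor x w (int s) \<xi>s)"
    "w' = w(int s + 1 := if coin then successor x w (int s) \<xi>s else x (int s))"
    unfolding vr_step_eq set_bind_pmf set_return_pmf by blast
  thus thesis
    using st(1) by (intro that[of x w \<xi>s "if coin then successor x w (int s) \<xi>s else x (int s)"]) auto
qed

lemma run_admissible: "(x, w) \<in> set_pmf (run s) \<Longrightarrow> admissible (int s) x w"
proof (induction s arbitrary: x w)
  case 0
  hence "x = (\<lambda>_. x0)" "w = (\<lambda>_. x0)" by auto
  thus ?case using x0_subdiff x0_edom run_wd(2)[OF 0] by (simp add: admissible_def)
next
  case (Suc s)
  obtain x1 w1 \<xi>s z where st: "(x1, w1) \<in> set_pmf (run s)"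
    "x = x1(int s + 1 := successor x1 w1 (int s) \<xi>s)" "w = w1(int s + 1 := z)"
    "z = successor x1 w1 (int s) \<xi>s \<or> z = x1 (int s)"
    by (rule run_SucE[OF Suc.prems])
  note adm = Suc.IH[OF st(1)]
  have suc: "int (Suc s) = int s + 1" by simp
  note wd = run_wd[OF Suc.prems, unfolded suc]
  have y: "successor x1 w1 (int s) \<xi>s \<in> edom K g" by (rule successor_edom[OF adm])
  have "x i \<in> subdiff_dom K f \<and> x i \<in> edom K g \<and> w i \<in> edom K g" if "i \<le> int s + 1" for i
  proof (cases "i = int s + 1")
    case True
    have "x1 (int s) \<in> edom K g" using adm by (simp add: admissible_def)
    hence "z \<in> edom K g" using st(4) y by auto
    thus ?thesis using True wd(1) y st(2,3) by simp
  next
    case False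
    hence "i \<le> int s" using that by simp
    thus ?thesis using adm st(2,3) by (simp add: admissible_def)
  qed
  thus ?case unfolding admissible_def suc using wd(2) by blast
qed

lemma aug_run_support: "((x, w), a) \<in> set_pmf (aug_run s) \<Longrightarrow> (x, w) \<in> set_pmf (run s)"
  unfolding map_fst_aug_run[symmetric] set_map_pmf by (metis fst_conv imageI)

lemma aug_run_admissible: "((x, w), a) \<in> set_pmf (aug_run s) \<Longrightarrow> admissible (int s) x w"
  by (intro run_admissible aug_run_support)

lemma successor_subdiff:
  assumes "((x, w), a) \<in> set_pmf (aug_run s)" "\<xi>s \<in> set_pmf (samples x w (int s))"
  shows "successor x w (int s) \<xi>s \<in> subdiff_dom K f"
proof -
  have coin: "True \<in> set_pmf (bernoulli_pmf p)" using p01 by (simp add: set_pmf_bernoulli)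
  have "(x(int s + 1 := successor x w (int s) \<xi>s), w(int s + 1 := successor x w (int s) \<xi>s))
      \<in> set_pmf (vr_step K g f f' F Fo Q b p \<gamma> \<alpha> (int s) (x, w))"
    unfolding vr_step_eq set_bind_pmf set_return_pmf
    by (rule UN_I[OF assms(2)], rule UN_I[OF coin]) simp
  hence "(x(int s + 1 := successor x w (int s) \<xi>s), w(int s + 1 := successor x w (int s) \<xi>s))
      \<in> set_pmf (run (Suc s))"
    using aug_run_support[OF assms(1)] by auto
  from run_wd(1)[OF this] show ?thesis by (simp add: add.commute)
qed

lemma finite_aug_run: "finite (set_pmf (aug_run s))"
proof (induction s)
  case (Suc s)
  have "finite (set_pmf (aug_step (int s) \<sigma>))" if "\<sigma> \<in> set_pmf (aug_run s)" for \<sigma>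
    using finite_samples[OF aug_run_admissible, of _ _ _ s] that
    by (cases \<sigma>) (auto simp: aug_step_def split: prod.splits)
  thus ?case using Suc by simp
qed simp

lemma aug_run_SucE:
  assumes "((x', w'), (v', q')) \<in> set_pmf (aug_run (Suc s))"
  obtains x w v q \<xi>s z where "((x, w), (v, q)) \<in> set_pmf (aug_run s)"
    "\<xi>s \<in> set_pmf (samples x w (int s))"
    "x' = x(int s + 1 := successor x w (int s) \<xi>s)" "w' = w(int s + 1 := z)"
    "v' = v + \<alpha> *\<^sub>R noise x w (int s) \<xi>s" "q' = q + residual x w (int s) \<xi>s"
proof -
  from assms obtain x w v q where st: "((x, w), (v, q)) \<in> set_pmf (aug_run s)"
    "((x', w'), (v', q')) \<in> set_pmf (aug_step (int s) ((x, w), (v, q)))"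
    by auto
  from st(2) obtain \<xi>s coin where "\<xi>s \<in> set_pmf (samples x w (int s))"
    "x' = x(int s + 1 := successor x w (int s) \<xi>s)"
    "w' = w(int s + 1 := if coin then successor x w (int s) \<xi>s else x (int s))"
    "v' = v + \<alpha> *\<^sub>R noise x w (int s) \<xi>s" "q' = q + residual x w (int s) \<xi>s"
    unfolding aug_step_def prod.case set_bind_pmf set_return_pmf by blast
  thus thesis
    using st(1) by (intro that[of x w v q \<xi>s "if coin then successor x w (int s) \<xi>s else x (int s)"]) auto
qed

lemma expect_aug_Suc:
  fixes H :: "((int \<Rightarrow> 'a) \<times> (int \<Rightarrow> 'a)) \<times> 'a \<times> real \<Rightarrow> real"
  shows "expect (aug_run (Suc s)) H = expect (aug_run s) (\<lambda>((x, w), (v, q)).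
     expect (samples x w (int s)) (\<lambda>\<xi>s. expect (bernoulli_pmf p) (\<lambda>coin.
       H ((x(int s + 1 := successor x w (int s) \<xi>s),
           w(int s + 1 := if coin then successor x w (int s) \<xi>s else x (int s))),
          (v + \<alpha> *\<^sub>R noise x w (int s) \<xi>s, q + residual x w (int s) \<xi>s)))))"
proof -
  have *: "finite (set_pmf (samples x w (int s)))" if "((x, w), a) \<in> set_pmf (aug_run s)" for x w a
    using finite_samples aug_run_admissible that by blast
  have "finite (set_pmf (aug_step (int s) \<sigma>))" if "\<sigma> \<in> set_pmf (aug_run s)" for \<sigma>
    using * that by (cases \<sigma>) (auto simp: aug_step_def split: prod.splits)
  hence "expect (aug_run (Suc s)) H = expect (aug_run s) (\<lambda>\<sigma>. expect (aug_step (int s) \<sigma>) H)"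
    by (simp add: expect_bind finite_aug_run)
  also have "\<dots> = expect (aug_run s) (\<lambda>((x, w), (v, q)).
     expect (samples x w (int s)) (\<lambda>\<xi>s. expect (bernoulli_pmf p) (\<lambda>coin.
       H ((x(int s + 1 := successor x w (int s) \<xi>s),
           w(int s + 1 := if coin then successor x w (int s) \<xi>s else x (int s))),
          (v + \<alpha> *\<^sub>R noise x w (int s) \<xi>s, q + residual x w (int s) \<xi>s)))))"
    using * by (intro expect_cong) (auto simp: aug_step_def expect_bind simp del: integral_bernoulli_pmf)
  finally show ?thesis .
qed

definition toss_again ::
  "nat \<Rightarrow> ((int \<Rightarrow> 'a) \<times> (int \<Rightarrow> 'a)) \<times> 'a \<times> real \<Rightarrow> (((int \<Rightarrow> 'a) \<times> (int \<Rightarrow> 'a)) \<times> 'a \<times> real) pmf" where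
  "toss_again s = (\<lambda>((x, w), a). bind_pmf (bernoulli_pmf p) (\<lambda>coin.
     return_pmf ((x, w(int s := if coin then x (int s) else x (int s - 1))), a)))"

text \<open>
  The step that creates \<open>x\<^sub>s\<close> and \<open>w\<^sub>s\<close> uses the coin for \<open>w\<^sub>s\<close> nowhere else, so this coin may be
  tossed again without changing the law. The next step can thus be analysed with a fresh coin,
  although \<open>x\<^sub>s\<^sub>+\<^sub>1\<close> depends on it.
\<close>

lemma aug_run_toss_again: "bind_pmf (aug_run s) (toss_again s) = aug_run s"
proof (cases s)
  case 0
  have "(\<lambda>_. x0)(0 := x0) = (\<lambda>_::int. x0)" by auto
  thus ?thesis using 0 by (simp add: bind_return_pmf toss_again_def)
next
  case (Suc r)
  have suc: "int (Suc r) = int r + 1" by simp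
  have "bind_pmf (aug_step (int r) \<sigma>) (toss_again (Suc r)) = aug_step (int r) \<sigma>" for \<sigma>
    by (cases \<sigma>)
       (auto simp: aug_step_def toss_again_def suc bind_assoc_pmf bind_return_pmf
             simp del: of_nat_Suc cong: if_cong)
  thus ?thesis by (simp add: Suc bind_assoc_pmf)
qed

lemma aug_run_coin_support:
  assumes "((x, w), a) \<in> set_pmf (aug_run s)"
  shows "((x, w(int s := x (int s))), a) \<in> set_pmf (aug_run s)"
    and "((x, w(int s := x (int s - 1))), a) \<in> set_pmf (aug_run s)"
proof -
  have *: "((x, w(int s := if coin then x (int s) else x (int s - 1))), a) \<in> set_pmf (aug_run s)" for coin
  proof -
    have "((x, w(int s := if coin then x (int s) else x (int s - 1))), a)
        \<in> set_pmf (toss_again s ((x, w), a))"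
      unfolding toss_again_def using p01 by (cases coin) (auto simp: set_pmf_bernoulli)
    hence "((x, w(int s := if coin then x (int s) else x (int s - 1))), a)
        \<in> set_pmf (bind_pmf (aug_run s) (toss_again s))"
      unfolding set_bind_pmf by (rule UN_I[OF assms])
    thus ?thesis unfolding aug_run_toss_again .
  qed
  show "((x, w(int s := x (int s))), a) \<in> set_pmf (aug_run s)" using *[of True] by simp
  show "((x, w(int s := x (int s - 1))), a) \<in> set_pmf (aug_run s)" using *[of False] by simp
qed

lemma expect_aug_toss_again:
  fixes H :: "((int \<Rightarrow> 'a) \<times> (int \<Rightarrow> 'a)) \<times> 'a \<times> real \<Rightarrow> real"
  shows "expect (aug_run s) H = expect (aug_run s) (\<lambda>((x, w), a).
    p * H ((x, w(int s := x (int s))), a) + (1 - p) * H ((x, w(int s := x (int s - 1))), a))"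
proof -
  have "expect (aug_run s) H = expect (bind_pmf (aug_run s) (toss_again s)) H"
    by (simp only: aug_run_toss_again)
  also have "\<dots> = expect (aug_run s) (\<lambda>\<sigma>. expect (toss_again s \<sigma>) H)"
    by (intro expect_bind finite_aug_run) (auto simp: toss_again_def split_def)
  also have "\<dots> = expect (aug_run s) (\<lambda>((x, w), a).
    p * H ((x, w(int s := x (int s))), a) + (1 - p) * H ((x, w(int s := x (int s - 1))), a))"
    using p01 by (intro expect_cong) (auto simp: toss_again_def expect_bind mult.commute)
  finally show ?thesis .
qed

end

section \<open>One-step estimates\<close>

lemma inner_sum_list_left: "inner (\<Sum>x\<leftarrow>xs. X x) z = (\<Sum>x\<leftarrow>xs. inner (X x) z)"
  by (induction xs) (simp_all add: inner_add_left)

context vr_method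
begin

lemma F_lipschitz:
  "y \<in> edom K g \<Longrightarrow> z \<in> edom K g \<Longrightarrow> dual_norm N (F y - F z) \<le> L * N (y - z)"
  using lipschitz_F by (auto simp: lipschitz_operator_on_def)

lemma admissible_edom:
  assumes "admissible t x w" "i \<le> t"
  shows "x i \<in> edom K g" "w i \<in> edom K g" "x i \<in> subdiff_dom K f"
  using assms by (auto simp: admissible_def)

lemma drift_le:
  assumes "admissible t x w"
  shows "dual_norm N (drift x w t) \<le> L * N (x t - w (t - 1))"
  unfolding drift_def using admissible_edom[OF assms] by (intro F_lipschitz) auto

lemma sample_moments:
  assumes "admissible t x w"
  shows "measure_pmf.expectation (Q (x t) (w (t - 1))) (\<lambda>\<xi>. Fo \<xi> (x t) - Fo \<xi> (w (t - 1))) = drift x w t"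
    and "expect (Q (x t) (w (t - 1))) (\<lambda>\<xi>. (dual_norm N (Fo \<xi> (x t) - Fo \<xi> (w (t - 1))))\<^sup>2)
      \<le> Lbar\<^sup>2 * (N (x t - w (t - 1)))\<^sup>2"
proof -
  have e: "x t \<in> edom K g" "w (t - 1) \<in> edom K g" using admissible_edom[OF assms] by auto
  have "measure_pmf.expectation (Q (x t) (w (t - 1))) (\<lambda>\<xi>. Fo \<xi> (x t) - Fo \<xi> (w (t - 1)))
      = measure_pmf.expectation (Q (x t) (w (t - 1))) (\<lambda>\<xi>. Fo \<xi> (x t))
        - measure_pmf.expectation (Q (x t) (w (t - 1))) (\<lambda>\<xi>. Fo \<xi> (w (t - 1)))"
    by (intro Bochner_Integration.integral_diff integrable_measure_pmf_finite finite_Q[OF assms])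
  moreover have "F z = measure_pmf.expectation (Q (x t) (w (t - 1))) (\<lambda>\<xi>. Fo \<xi> z)" if "z \<in> edom K g" for z
    using stochastic e that unfolding variable_lipschitz_oracle_def by blast
  ultimately show "measure_pmf.expectation (Q (x t) (w (t - 1))) (\<lambda>\<xi>. Fo \<xi> (x t) - Fo \<xi> (w (t - 1)))
      = drift x w t"
    using e by (simp add: drift_def)
  show "expect (Q (x t) (w (t - 1))) (\<lambda>\<xi>. (dual_norm N (Fo \<xi> (x t) - Fo \<xi> (w (t - 1))))\<^sup>2)
      \<le> Lbar\<^sup>2 * (N (x t - w (t - 1)))\<^sup>2"
    using stochastic e unfolding variable_lipschitz_oracle_def by blast
qed

lemma noise_mean_zero:
  assumes "admissible t x w"
  shows "expect (samples x w t) (\<lambda>\<xi>s. inner (noise x w t \<xi>s) z) = 0"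
proof -
  let ?q = "Q (x t) (w (t - 1))"
  note fin = finite_Q[OF assms]
  have "expect ?q (\<lambda>\<xi>. inner (Fo \<xi> (x t) - Fo \<xi> (w (t - 1))) z) = inner (drift x w t) z"
    unfolding sample_moments(1)[OF assms, symmetric]
    by (intro integral_inner_left integrable_measure_pmf_finite fin)
  hence "expect ?q (\<lambda>\<xi>. inner (Fo \<xi> (x t) - Fo \<xi> (w (t - 1)) - drift x w t) z) = 0"
    by (subst inner_diff_left, subst expect_diff) (auto simp: fin)
  hence "expect (samples x w t)
      (\<lambda>\<xi>s. \<Sum>\<xi>\<leftarrow>\<xi>s. inner (Fo \<xi> (x t) - Fo \<xi> (w (t - 1)) - drift x w t) z) = 0"
    unfolding samples_def by (subst expect_replicate_sum_list) (auto simp: fin)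
  thus ?thesis by (simp add: noise_def inner_sum_list_left)
qed

lemma noise_second_moment:
  assumes "admissible t x w"
  shows "expect (samples x w t) (\<lambda>\<xi>s. (dual_norm N (noise x w t \<xi>s))\<^sup>2)
    \<le> 2 * (L\<^sup>2 + Lbar\<^sup>2) * (N (x t - w (t - 1)))\<^sup>2"
proof -
  let ?q = "Q (x t) (w (t - 1))" and ?X = "\<lambda>\<xi>. Fo \<xi> (x t) - Fo \<xi> (w (t - 1))"
  define V where "V = (N (x t - w (t - 1)))\<^sup>2"
  note fin = finite_Q[OF assms]
  have "(dual_norm N (drift x w t))\<^sup>2 \<le> (L * N (x t - w (t - 1)))\<^sup>2"
    by (intro power_mono drift_le assms) auto
  hence drift: "(dual_norm N (drift x w t))\<^sup>2 \<le> L\<^sup>2 * V"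
    by (simp add: power_mult_distrib V_def)
  have "expect (samples x w t) (\<lambda>\<xi>s. (dual_norm N (noise x w t \<xi>s))\<^sup>2)
      \<le> expect (samples x w t) (\<lambda>\<xi>s. (1 / real b) * (\<Sum>\<xi>\<leftarrow>\<xi>s. (dual_norm N (?X \<xi> - drift x w t))\<^sup>2))"
    unfolding noise_def
    by (intro expect_mono finite_samples assms dual_norm_average_square samples_length)
  also have "\<dots> = expect ?q (\<lambda>\<xi>. (dual_norm N (?X \<xi> - drift x w t))\<^sup>2)"
    using b_pos by (simp add: samples_def expect_replicate_sum_list fin)
  also have "\<dots> \<le> expect ?q (\<lambda>\<xi>. 2 * (dual_norm N (?X \<xi>))\<^sup>2 + 2 * (dual_norm N (drift x w t))\<^sup>2)"
    by (intro expect_mono fin dual_norm_diff_square)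
  also have "\<dots> = 2 * expect ?q (\<lambda>\<xi>. (dual_norm N (?X \<xi>))\<^sup>2) + 2 * (dual_norm N (drift x w t))\<^sup>2"
    by (simp add: expect_add fin)
  also have "\<dots> \<le> 2 * (L\<^sup>2 + Lbar\<^sup>2) * V"
    using sample_moments(2)[OF assms] drift by (simp add: V_def algebra_simps)
  finally show ?thesis by (simp add: V_def)
qed

text \<open>
  The new iterate is a Lipschitz function of the batch average, with constant \<open>\<alpha>\<close>, so the general
  resampling bound applies with \<open>\<kappa> = \<alpha> / b\<close>.
\<close>

lemma noise_successor_correlation:
  assumes adm: "admissible t x w"
    and sub: "\<And>\<xi>s. \<xi>s \<in> set_pmf (samples x w t) \<Longrightarrow> successor x w t \<xi>s \<in> subdiff_dom K f"
  shows "expect (samples x w t) (\<lambda>\<xi>s. - inner (noise x w t \<xi>s) (successor x w t \<xi>s))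
    \<le> 2 * \<alpha> * Lbar\<^sup>2 / real b * (N (x t - w (t - 1)))\<^sup>2"
proof -
  let ?q = "Q (x t) (w (t - 1))" and ?X = "\<lambda>\<xi>. Fo \<xi> (x t) - Fo \<xi> (w (t - 1))"
  define V where "V = (N (x t - w (t - 1)))\<^sup>2"
  have "expect (samples x w t) (\<lambda>\<xi>s. - inner (\<Sum>\<xi>\<leftarrow>\<xi>s. ?X \<xi> - drift x w t) (successor x w t \<xi>s))
      \<le> 2 * real b * (\<alpha> / real b) * expect ?q (\<lambda>\<xi>. (dual_norm N (?X \<xi>))\<^sup>2)"
    unfolding samples_def
  proof (rule iid_sum_correlation[OF finite_Q[OF adm] sample_moments(1)[OF adm, symmetric]])
    show "0 \<le> \<alpha> / real b" using \<alpha>_pos by simp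
    fix \<xi>s \<xi>s' assume s: "\<xi>s \<in> set_pmf (replicate_pmf b ?q)" "\<xi>s' \<in> set_pmf (replicate_pmf b ?q)"
    hence len: "length \<xi>s = b" "length \<xi>s' = b" by (auto simp: set_replicate_pmf)
    have "N (successor x w t \<xi>s - successor x w t \<xi>s')
        \<le> \<alpha> * dual_norm N (direction x w t \<xi>s - direction x w t \<xi>s')"
      by (intro successor_lipschitz adm sub) (use s in \<open>auto simp: samples_def\<close>)
    also have "\<dots> \<le> \<alpha> * ((1 / real b) * dual_norm N ((\<Sum>\<xi>\<leftarrow>\<xi>s. ?X \<xi>) - (\<Sum>\<xi>\<leftarrow>\<xi>s'. ?X \<xi>)))"
      unfolding direction_diff[OF len] using \<alpha>_pos by (intro mult_left_mono dual_norm_scale) auto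
    finally show "N (successor x w t \<xi>s - successor x w t \<xi>s')
        \<le> \<alpha> / real b * dual_norm N ((\<Sum>\<xi>\<leftarrow>\<xi>s. ?X \<xi>) - (\<Sum>\<xi>\<leftarrow>\<xi>s'. ?X \<xi>))" by simp
  qed
  also have "\<dots> \<le> 2 * \<alpha> * (Lbar\<^sup>2 * V)"
    using sample_moments(2)[OF adm] \<alpha>_pos b_pos by (simp add: V_def mult_left_mono)
  finally have le: "expect (samples x w t)
      (\<lambda>\<xi>s. - inner (\<Sum>\<xi>\<leftarrow>\<xi>s. ?X \<xi> - drift x w t) (successor x w t \<xi>s)) \<le> 2 * \<alpha> * (Lbar\<^sup>2 * V)" .
  have "expect (samples x w t) (\<lambda>\<xi>s. - inner (noise x w t \<xi>s) (successor x w t \<xi>s))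
      = (1 / real b) * expect (samples x w t)
          (\<lambda>\<xi>s. - inner (\<Sum>\<xi>\<leftarrow>\<xi>s. ?X \<xi> - drift x w t) (successor x w t \<xi>s))"
    by (simp add: noise_def)
  also have "\<dots> \<le> (1 / real b) * (2 * \<alpha> * (Lbar\<^sup>2 * V))"
    using le by (intro mult_left_mono) auto
  finally show ?thesis by (simp add: V_def algebra_simps)
qed

lemma weighted_young: "0 < \<theta> \<Longrightarrow> r * s \<le> \<theta> / 2 * s\<^sup>2 + r\<^sup>2 / (2 * \<theta>)" for r s \<theta> :: real
proof -
  assume "0 < \<theta>"
  hence "\<theta> / 2 * s\<^sup>2 + r\<^sup>2 / (2 * \<theta>) - r * s = (\<theta> * s - r)\<^sup>2 / (2 * \<theta>)"
    by (simp add: field_simps power2_eq_square)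
  also have "\<dots> \<ge> 0" using \<open>0 < \<theta>\<close> by simp
  finally show ?thesis by simp
qed

text \<open>
  The drift and the noise are treated separately. The drift is paid for by Young's inequality,
  which consumes the share \<open>\<theta>\<close> of the one-step displacement. The noise costs nothing of the
  displacement, since it only enters through its correlation with the new iterate.
\<close>

lemma residual_mean_le:
  assumes st: "((x, w), a) \<in> set_pmf (aug_run s)" and "0 < \<theta>"
  defines "t \<equiv> int s"
  defines "y \<equiv> successor x w t"
  shows "expect (samples x w t) (residual x w t)
    \<le> ((\<alpha> * L)\<^sup>2 / (2 * \<theta>) + 2 * \<alpha>\<^sup>2 * Lbar\<^sup>2 / real b) * (N (x t - w (t - 1)))\<^sup>2
      - (\<gamma> - \<theta>) / 2 * expect (samples x w t) (\<lambda>\<xi>s. (N (y \<xi>s - x t))\<^sup>2)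
      - (1 - \<gamma>) / 2 * expect (samples x w t) (\<lambda>\<xi>s. (N (y \<xi>s - x (t - 1)))\<^sup>2)"
proof -
  let ?R = "samples x w t"
  define V where "V = (N (x t - w (t - 1)))\<^sup>2"
  have adm: "admissible t x w" unfolding t_def by (rule aug_run_admissible[OF st])
  note fin = finite_samples[OF adm]
  have sub: "y \<xi>s \<in> subdiff_dom K f" if "\<xi>s \<in> set_pmf ?R" for \<xi>s
    using successor_subdiff[OF st] that by (simp add: y_def t_def)
  have "residual x w t \<xi>s \<le> (\<alpha> * L)\<^sup>2 / (2 * \<theta>) * V - (\<gamma> - \<theta>) / 2 * (N (y \<xi>s - x t))\<^sup>2
      - (1 - \<gamma>) / 2 * (N (y \<xi>s - x (t - 1)))\<^sup>2
      + (\<alpha> * inner (noise x w t \<xi>s) x0 + \<alpha> * (- inner (noise x w t \<xi>s) (y \<xi>s)))"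
    if "\<xi>s \<in> set_pmf ?R" for \<xi>s
  proof -
    have yf: "y \<xi>s \<in> edom K f" using sub[OF that] by (simp add: subdiff_dom_def)
    have "inner (drift x w t) (x t - y \<xi>s) \<le> dual_norm N (drift x w t) * N (y \<xi>s - x t)"
      using inner_le_dual_norm[of "drift x w t" "x t - y \<xi>s"] N_commute[of "x t"] by simp
    also have "\<dots> \<le> (L * N (x t - w (t - 1))) * N (y \<xi>s - x t)"
      by (intro mult_right_mono drift_le adm) auto
    finally have "\<alpha> * inner (drift x w t) (x t - y \<xi>s) \<le> \<alpha> * ((L * N (x t - w (t - 1))) * N (y \<xi>s - x t))"
      using \<alpha>_pos by (intro mult_left_mono) auto
    also have "\<dots> = (\<alpha> * L * N (x t - w (t - 1))) * N (y \<xi>s - x t)" by simp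
    also have "\<dots> \<le> \<theta> / 2 * (N (y \<xi>s - x t))\<^sup>2 + (\<alpha> * L * N (x t - w (t - 1)))\<^sup>2 / (2 * \<theta>)"
      by (rule weighted_young[OF \<open>0 < \<theta>\<close>])
    also have "(\<alpha> * L * N (x t - w (t - 1)))\<^sup>2 / (2 * \<theta>) = (\<alpha> * L)\<^sup>2 / (2 * \<theta>) * V"
      by (simp add: power_mult_distrib V_def)
    finally have 1: "\<alpha> * inner (drift x w t) (x t - y \<xi>s)
        \<le> \<theta> / 2 * (N (y \<xi>s - x t))\<^sup>2 + (\<alpha> * L)\<^sup>2 / (2 * \<theta>) * V" .
    have "\<gamma> * D (y \<xi>s) (x t) \<ge> \<gamma> * ((N (y \<xi>s - x t))\<^sup>2 / 2)"
      "(1 - \<gamma>) * D (y \<xi>s) (x (t - 1)) \<ge> (1 - \<gamma>) * ((N (y \<xi>s - x (t - 1)))\<^sup>2 / 2)"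
      using \<gamma>01 strong_convexity[OF yf admissible_edom(3)[OF adm, of t]]
        strong_convexity[OF yf admissible_edom(3)[OF adm, of "t - 1"]]
      by (auto intro!: mult_left_mono simp del: times_divide_eq_right)
    with 1 show ?thesis
      by (simp add: residual_def Let_def y_def inner_diff_right algebra_simps diff_divide_distrib)
  qed
  hence "expect ?R (residual x w t) \<le> expect ?R (\<lambda>\<xi>s.
      (\<alpha> * L)\<^sup>2 / (2 * \<theta>) * V - (\<gamma> - \<theta>) / 2 * (N (y \<xi>s - x t))\<^sup>2
      - (1 - \<gamma>) / 2 * (N (y \<xi>s - x (t - 1)))\<^sup>2
      + (\<alpha> * inner (noise x w t \<xi>s) x0 + \<alpha> * (- inner (noise x w t \<xi>s) (y \<xi>s))))"
    by (rule expect_mono[OF fin])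
  also have "\<dots> = (\<alpha> * L)\<^sup>2 / (2 * \<theta>) * V - (\<gamma> - \<theta>) / 2 * expect ?R (\<lambda>\<xi>s. (N (y \<xi>s - x t))\<^sup>2)
      - (1 - \<gamma>) / 2 * expect ?R (\<lambda>\<xi>s. (N (y \<xi>s - x (t - 1)))\<^sup>2)
      + \<alpha> * expect ?R (\<lambda>\<xi>s. - inner (noise x w t \<xi>s) (y \<xi>s))"
    using noise_mean_zero[OF adm, of x0] by (simp add: expect_add expect_diff fin)
  also have "\<alpha> * expect ?R (\<lambda>\<xi>s. - inner (noise x w t \<xi>s) (y \<xi>s))
      \<le> \<alpha> * (2 * \<alpha> * Lbar\<^sup>2 / real b * V)"
    using noise_successor_correlation[OF adm] sub \<alpha>_pos
    unfolding V_def y_def by (intro mult_left_mono) auto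
  finally show ?thesis by (simp add: V_def algebra_simps power2_eq_square)
qed

section \<open>Mean squared displacements\<close>

definition lag1 :: "nat \<Rightarrow> real" where
  "lag1 s = expect (aug_run s) (\<lambda>((x, w), a). (N (x (int s) - x (int s - 1)))\<^sup>2)"

definition lag2 :: "nat \<Rightarrow> real" where
  "lag2 s = expect (aug_run s) (\<lambda>((x, w), a). (N (x (int s) - x (int s - 2)))\<^sup>2)"

definition lagw :: "nat \<Rightarrow> real" where
  "lagw s = expect (aug_run s) (\<lambda>((x, w), a). (N (x (int s) - w (int s - 1)))\<^sup>2)"

definition mean_residual :: "nat \<Rightarrow> real" where
  "mean_residual s = expect (aug_run s) (\<lambda>(\<omega>, (v, q)). q)"

lemma lag_0: "lag1 0 = 0" "lag2 0 = 0" "lagw 0 = 0" "mean_residual 0 = 0"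
  by (simp_all add: lag1_def lag2_def lagw_def mean_residual_def)

lemma lag_nonneg: "0 \<le> lag1 s" "0 \<le> lag2 s" "0 \<le> lagw s"
  by (auto simp: lag1_def lag2_def lagw_def split_def intro!: integral_nonneg)

lemma lag1_Suc: "lag1 (Suc s) = expect (aug_run s) (\<lambda>((x, w), a).
    expect (samples x w (int s)) (\<lambda>\<xi>s. (N (successor x w (int s) \<xi>s - x (int s)))\<^sup>2))"
  and lag2_Suc: "lag2 (Suc s) = expect (aug_run s) (\<lambda>((x, w), a).
    expect (samples x w (int s)) (\<lambda>\<xi>s. (N (successor x w (int s) \<xi>s - x (int s - 1)))\<^sup>2))"
  and lagw_Suc: "lagw (Suc s) = expect (aug_run s) (\<lambda>((x, w), a).
    expect (samples x w (int s)) (\<lambda>\<xi>s. (N (successor x w (int s) \<xi>s - w (int s)))\<^sup>2))"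
proof -
  have idx: "int (Suc s) = int s + 1" "int s + 1 - 1 = int s" "int s + 1 - 2 = int s - 1"
    "int s \<noteq> int s + 1" "int s - 1 \<noteq> int s + 1" by auto
  show "lag1 (Suc s) = expect (aug_run s) (\<lambda>((x, w), a).
    expect (samples x w (int s)) (\<lambda>\<xi>s. (N (successor x w (int s) \<xi>s - x (int s)))\<^sup>2))"
    "lag2 (Suc s) = expect (aug_run s) (\<lambda>((x, w), a).
    expect (samples x w (int s)) (\<lambda>\<xi>s. (N (successor x w (int s) \<xi>s - x (int s - 1)))\<^sup>2))"
    "lagw (Suc s) = expect (aug_run s) (\<lambda>((x, w), a).
    expect (samples x w (int s)) (\<lambda>\<xi>s. (N (successor x w (int s) \<xi>s - w (int s)))\<^sup>2))"
    unfolding lag1_def lag2_def lagw_def expect_aug_Suc idx(1)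
    by (auto intro!: expect_cong simp: idx(2-) simp del: integral_bernoulli_pmf)
qed

lemma aug_expect_mono:
  assumes "\<And>x w v q. ((x, w), (v, q)) \<in> set_pmf (aug_run s) \<Longrightarrow>
    H ((x, w), (v, q)) \<le> H' ((x, w), (v, q))"
  shows "expect (aug_run s) H \<le> expect (aug_run s) H'"
  using assms by (intro expect_mono finite_aug_run) auto

lemma mean_residual_Suc:
  assumes "0 < \<theta>"
  shows "mean_residual (Suc s) \<le> mean_residual s
    + ((\<alpha> * L)\<^sup>2 / (2 * \<theta>) + 2 * \<alpha>\<^sup>2 * Lbar\<^sup>2 / real b) * lagw s
    - (\<gamma> - \<theta>) / 2 * lag1 (Suc s) - (1 - \<gamma>) / 2 * lag2 (Suc s)"
proof -
  define c where "c = (\<alpha> * L)\<^sup>2 / (2 * \<theta>) + 2 * \<alpha>\<^sup>2 * Lbar\<^sup>2 / real b"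
  let ?t = "int s"
  have "mean_residual (Suc s) = expect (aug_run s) (\<lambda>((x, w), (v, q)).
      expect (samples x w ?t) (\<lambda>\<xi>s. q + residual x w ?t \<xi>s))"
    unfolding mean_residual_def expect_aug_Suc
    by (simp add: split_def del: integral_bernoulli_pmf)
  also have "\<dots> \<le> expect (aug_run s) (\<lambda>\<sigma>. snd (snd \<sigma>)
      + c * (case \<sigma> of ((x, w), a) \<Rightarrow> (N (x ?t - w (?t - 1)))\<^sup>2)
      - (\<gamma> - \<theta>) / 2 * (case \<sigma> of ((x, w), a) \<Rightarrow>
          expect (samples x w ?t) (\<lambda>\<xi>s. (N (successor x w ?t \<xi>s - x ?t))\<^sup>2))
      - (1 - \<gamma>) / 2 * (case \<sigma> of ((x, w), a) \<Rightarrow>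
          expect (samples x w ?t) (\<lambda>\<xi>s. (N (successor x w ?t \<xi>s - x (?t - 1)))\<^sup>2)))"
  proof (rule aug_expect_mono, unfold prod.case snd_conv)
    fix x w v q assume st: "((x, w), (v, q)) \<in> set_pmf (aug_run s)"
    have fin: "finite (set_pmf (samples x w ?t))"
      by (rule finite_samples[OF aug_run_admissible[OF st]])
    show "expect (samples x w ?t) (\<lambda>\<xi>s. q + residual x w ?t \<xi>s)
      \<le> q + c * (N (x ?t - w (?t - 1)))\<^sup>2
        - (\<gamma> - \<theta>) / 2 * expect (samples x w ?t) (\<lambda>\<xi>s. (N (successor x w ?t \<xi>s - x ?t))\<^sup>2)
        - (1 - \<gamma>) / 2 * expect (samples x w ?t) (\<lambda>\<xi>s. (N (successor x w ?t \<xi>s - x (?t - 1)))\<^sup>2)"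
      using residual_mean_le[OF st assms] by (simp add: c_def expect_add fin)
  qed
  also have "\<dots> = mean_residual s + c * lagw s - (\<gamma> - \<theta>) / 2 * lag1 (Suc s) - (1 - \<gamma>) / 2 * lag2 (Suc s)"
    unfolding mean_residual_def lagw_def lag1_Suc lag2_Suc
    by (subst expect_diff expect_add, rule finite_aug_run)+ (simp add: split_def)
  finally show ?thesis by (simp add: c_def)
qed

lemma lag2_Suc_le: "lag2 (Suc s) \<le> 2 * lag1 (Suc s) + 2 * lag1 s"
proof -
  let ?t = "int s"
  have "lag2 (Suc s) \<le> expect (aug_run s) (\<lambda>\<sigma>.
      2 * (case \<sigma> of ((x, w), a) \<Rightarrow> expect (samples x w ?t) (\<lambda>\<xi>s. (N (successor x w ?t \<xi>s - x ?t))\<^sup>2))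
      + 2 * (case \<sigma> of ((x, w), a) \<Rightarrow> (N (x ?t - x (?t - 1)))\<^sup>2))"
    unfolding lag2_Suc
  proof (rule aug_expect_mono, unfold prod.case)
    fix x w v q assume st: "((x, w), (v, q)) \<in> set_pmf (aug_run s)"
    note fin = finite_samples[OF aug_run_admissible[OF st]]
    have "expect (samples x w ?t) (\<lambda>\<xi>s. (N (successor x w ?t \<xi>s - x (?t - 1)))\<^sup>2)
      \<le> expect (samples x w ?t) (\<lambda>\<xi>s. 2 * (N (successor x w ?t \<xi>s - x ?t))\<^sup>2 + 2 * (N (x ?t - x (?t - 1)))\<^sup>2)"
    proof (intro expect_mono fin)
      fix \<xi>s show "(N (successor x w ?t \<xi>s - x (?t - 1)))\<^sup>2
          \<le> 2 * (N (successor x w ?t \<xi>s - x ?t))\<^sup>2 + 2 * (N (x ?t - x (?t - 1)))\<^sup>2"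
        using N_sum_square[of "successor x w ?t \<xi>s - x ?t" "x ?t - x (?t - 1)"] by simp
    qed
    also have "\<dots> = 2 * expect (samples x w ?t) (\<lambda>\<xi>s. (N (successor x w ?t \<xi>s - x ?t))\<^sup>2)
        + 2 * (N (x ?t - x (?t - 1)))\<^sup>2" by (simp add: expect_add fin)
    finally show "expect (samples x w ?t) (\<lambda>\<xi>s. (N (successor x w ?t \<xi>s - x (?t - 1)))\<^sup>2)
      \<le> 2 * expect (samples x w ?t) (\<lambda>\<xi>s. (N (successor x w ?t \<xi>s - x ?t))\<^sup>2)
        + 2 * (N (x ?t - x (?t - 1)))\<^sup>2" .
  qed
  also have "\<dots> = 2 * lag1 (Suc s) + 2 * lag1 s"
    by (subst expect_add, rule finite_aug_run) (simp add: lag1_Suc lag1_def[of s] split_def)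
  finally show ?thesis .
qed

text \<open>
  The anchor \<open>w\<^sub>s\<close> equals \<open>x\<^sub>s\<close> only on the event that its coin shows heads, of probability \<open>p\<close>. The new
  iterate depends on that coin, but flipping it changes the prox direction by \<open>F x\<^sub>s - F x\<^sub>s\<^sub>-\<^sub>1\<close>, hence
  the iterate by at most \<open>\<alpha> L\<close> times the last step; so the displacements for heads and for tails are
  comparable, and the heads contribute to the mean only with a factor of order \<open>p\<close>.
\<close>

lemma lagw_Suc_le:
  "lagw (Suc s) \<le> 2 * p * (lag1 (Suc s) + (\<alpha> * L)\<^sup>2 * lag1 s) + lag2 (Suc s)"
  "lagw (Suc s) \<le> lag1 (Suc s) + lag2 (Suc s)"
proof -
  let ?t = "int s"
  define A :: "((int \<Rightarrow> 'a) \<times> (int \<Rightarrow> 'a)) \<times> 'a \<times> real \<Rightarrow> real"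
    where "A = (\<lambda>((x, w), a). expect (samples x w ?t) (\<lambda>\<xi>s. (N (successor x w ?t \<xi>s - x ?t))\<^sup>2))"
  define C :: "((int \<Rightarrow> 'a) \<times> (int \<Rightarrow> 'a)) \<times> 'a \<times> real \<Rightarrow> real"
    where "C = (\<lambda>((x, w), a). expect (samples x w ?t) (\<lambda>\<xi>s. (N (successor x w ?t \<xi>s - x (?t - 1)))\<^sup>2))"
  define W :: "((int \<Rightarrow> 'a) \<times> (int \<Rightarrow> 'a)) \<times> 'a \<times> real \<Rightarrow> real"
    where "W = (\<lambda>((x, w), a). expect (samples x w ?t) (\<lambda>\<xi>s. (N (successor x w ?t \<xi>s - w ?t))\<^sup>2))"
  define P :: "((int \<Rightarrow> 'a) \<times> (int \<Rightarrow> 'a)) \<times> 'a \<times> real \<Rightarrow> real"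
    where "P = (\<lambda>((x, w), a). (N (x ?t - x (?t - 1)))\<^sup>2)"
  define heads where "heads = (\<lambda>((x :: int \<Rightarrow> 'a, w :: int \<Rightarrow> 'a), a :: 'a \<times> real). ((x, w(?t := x ?t)), a))"
  define tails where "tails = (\<lambda>((x :: int \<Rightarrow> 'a, w :: int \<Rightarrow> 'a), a :: 'a \<times> real). ((x, w(?t := x (?t - 1))), a))"
  have toss: "expect (aug_run s) H = expect (aug_run s) (\<lambda>\<sigma>. p * H (heads \<sigma>) + (1 - p) * H (tails \<sigma>))" for H
    by (subst expect_aug_toss_again) (simp add: heads_def tails_def split_def)
  have same: "samples x (w(?t := z)) ?t = samples x w ?t" for x w z by (simp add: samples_def)
  have WA: "W (heads \<sigma>) = A (heads \<sigma>)" for \<sigma>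
    by (simp add: W_def A_def heads_def split_def)
  have WC: "W (tails \<sigma>) = C (tails \<sigma>)" for \<sigma>
    by (simp add: W_def C_def tails_def split_def)
  have nonneg: "0 \<le> A \<sigma>" "0 \<le> C \<sigma>" for \<sigma>
    by (auto simp: A_def C_def split_def intro!: integral_nonneg)
  have flip: "A (heads \<sigma>) \<le> 2 * A (tails \<sigma>) + 2 * (\<alpha> * L)\<^sup>2 * P \<sigma>" if \<sigma>: "\<sigma> \<in> set_pmf (aug_run s)" for \<sigma>
  proof -
    obtain x w a where \<sigma>_eq: "\<sigma> = ((x, w), a)" by (cases \<sigma>) auto
    define w1 w0 where "w1 = w(?t := x ?t)" and "w0 = w(?t := x (?t - 1))"
    have st: "((x, w), a) \<in> set_pmf (aug_run s)" "((x, w1), a) \<in> set_pmf (aug_run s)"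
      "((x, w0), a) \<in> set_pmf (aug_run s)"
      using \<sigma> aug_run_coin_support[of x w a s] by (auto simp: \<sigma>_eq w1_def w0_def)
    note adm = st[THEN aug_run_admissible]
    have samp: "samples x w1 ?t = samples x w ?t" "samples x w0 ?t = samples x w ?t"
      by (auto simp: w1_def w0_def same)
    note fin = finite_samples[OF adm(1)]
    have "expect (samples x w ?t) (\<lambda>\<xi>s. (N (successor x w1 ?t \<xi>s - x ?t))\<^sup>2)
      \<le> expect (samples x w ?t) (\<lambda>\<xi>s. 2 * (N (successor x w0 ?t \<xi>s - x ?t))\<^sup>2
          + 2 * (\<alpha> * L)\<^sup>2 * (N (x ?t - x (?t - 1)))\<^sup>2)"
    proof (intro expect_mono fin)
      fix \<xi>s assume \<xi>s: "\<xi>s \<in> set_pmf (samples x w ?t)"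
      let ?y1 = "successor x w1 ?t \<xi>s" and ?y0 = "successor x w0 ?t \<xi>s"
      have len: "length \<xi>s = b" by (rule samples_length[OF \<xi>s])
      have "N (?y1 - ?y0) \<le> \<alpha> * dual_norm N (direction x w1 ?t \<xi>s - direction x w0 ?t \<xi>s)"
        using \<xi>s by (intro successor_lipschitz adm successor_subdiff[OF st(2)] successor_subdiff[OF st(3)])
          (auto simp: samp)
      also have "direction x w1 ?t \<xi>s - direction x w0 ?t \<xi>s = F (x ?t) - F (x (?t - 1))"
        unfolding direction_eq[OF len] by (simp add: drift_def noise_def w1_def w0_def)
      also have "\<alpha> * dual_norm N (F (x ?t) - F (x (?t - 1))) \<le> \<alpha> * (L * N (x ?t - x (?t - 1)))"
        using \<alpha>_pos admissible_edom(1)[OF adm(1)] by (intro mult_left_mono F_lipschitz) auto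
      finally have "(N (?y1 - ?y0))\<^sup>2 \<le> (\<alpha> * (L * N (x ?t - x (?t - 1))))\<^sup>2"
        by (intro power_mono) auto
      hence "(N (?y1 - ?y0))\<^sup>2 \<le> (\<alpha> * L)\<^sup>2 * (N (x ?t - x (?t - 1)))\<^sup>2"
        by (simp add: power_mult_distrib)
      thus "(N (?y1 - x ?t))\<^sup>2 \<le> 2 * (N (?y0 - x ?t))\<^sup>2 + 2 * (\<alpha> * L)\<^sup>2 * (N (x ?t - x (?t - 1)))\<^sup>2"
        using N_sum_square[of "?y0 - x ?t" "?y1 - ?y0"] by simp
    qed
    also have "\<dots> = 2 * expect (samples x w ?t) (\<lambda>\<xi>s. (N (successor x w0 ?t \<xi>s - x ?t))\<^sup>2)
        + 2 * (\<alpha> * L)\<^sup>2 * (N (x ?t - x (?t - 1)))\<^sup>2"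
      by (simp add: expect_add fin)
    finally show ?thesis
      by (simp add: A_def P_def \<sigma>_eq heads_def tails_def w1_def[symmetric] w0_def[symmetric] samp)
  qed
  have sums: "lag1 (Suc s) = expect (aug_run s) (\<lambda>\<sigma>. p * A (heads \<sigma>) + (1 - p) * A (tails \<sigma>))"
    "lag2 (Suc s) = expect (aug_run s) (\<lambda>\<sigma>. p * C (heads \<sigma>) + (1 - p) * C (tails \<sigma>))"
    "lagw (Suc s) = expect (aug_run s) (\<lambda>\<sigma>. p * W (heads \<sigma>) + (1 - p) * W (tails \<sigma>))"
    "lag1 s = expect (aug_run s) P"
    unfolding lag1_Suc lag2_Suc lagw_Suc A_def[symmetric] C_def[symmetric] W_def[symmetric]
    by (rule toss)+ (simp add: lag1_def P_def)
  have "lagw (Suc s) \<le> expect (aug_run s) (\<lambda>\<sigma>.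
      2 * p * ((p * A (heads \<sigma>) + (1 - p) * A (tails \<sigma>)) + (\<alpha> * L)\<^sup>2 * P \<sigma>)
      + (p * C (heads \<sigma>) + (1 - p) * C (tails \<sigma>)))"
    unfolding sums(3) WA WC
  proof (intro expect_mono finite_aug_run)
    fix \<sigma> assume \<sigma>: "\<sigma> \<in> set_pmf (aug_run s)"
    have P0: "0 \<le> (\<alpha> * L)\<^sup>2 * P \<sigma>" by (auto simp: P_def split_def)
    have "(1 - p) * A (heads \<sigma>) \<le> (1 - p) * (2 * A (tails \<sigma>) + 2 * (\<alpha> * L)\<^sup>2 * P \<sigma>)"
      using flip[OF \<sigma>] p01 by (intro mult_left_mono) auto
    moreover have "p * A (heads \<sigma>) \<ge> 0" "p * ((\<alpha> * L)\<^sup>2 * P \<sigma>) \<ge> 0" "p * C (heads \<sigma>) \<ge> 0"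
      using nonneg P0 p01 by auto
    ultimately have "A (heads \<sigma>) \<le> 2 * ((p * A (heads \<sigma>) + (1 - p) * A (tails \<sigma>)) + (\<alpha> * L)\<^sup>2 * P \<sigma>)"
      by (simp add: algebra_simps)
    hence "p * A (heads \<sigma>) \<le> p * (2 * ((p * A (heads \<sigma>) + (1 - p) * A (tails \<sigma>)) + (\<alpha> * L)\<^sup>2 * P \<sigma>))"
      using p01 by (intro mult_left_mono) auto
    thus "p * A (heads \<sigma>) + (1 - p) * C (tails \<sigma>)
      \<le> 2 * p * ((p * A (heads \<sigma>) + (1 - p) * A (tails \<sigma>)) + (\<alpha> * L)\<^sup>2 * P \<sigma>)
        + (p * C (heads \<sigma>) + (1 - p) * C (tails \<sigma>))"
      using \<open>p * C (heads \<sigma>) \<ge> 0\<close> by (simp add: mult.assoc mult.left_commute)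
  qed
  also have "\<dots> = 2 * p * (lag1 (Suc s) + (\<alpha> * L)\<^sup>2 * lag1 s) + lag2 (Suc s)"
    unfolding sums(1,2,4) by (simp add: expect_add finite_aug_run)
  finally show "lagw (Suc s) \<le> 2 * p * (lag1 (Suc s) + (\<alpha> * L)\<^sup>2 * lag1 s) + lag2 (Suc s)" .
  have "lagw (Suc s) \<le> expect (aug_run s) (\<lambda>\<sigma>.
      (p * A (heads \<sigma>) + (1 - p) * A (tails \<sigma>)) + (p * C (heads \<sigma>) + (1 - p) * C (tails \<sigma>)))"
    unfolding sums(3) WA WC using nonneg p01
    by (intro expect_mono finite_aug_run) (simp add: add_increasing add_increasing2)
  also have "\<dots> = lag1 (Suc s) + lag2 (Suc s)"
    unfolding sums(1,2) by (rule expect_add[OF finite_aug_run])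
  finally show "lagw (Suc s) \<le> lag1 (Suc s) + lag2 (Suc s)" .
qed

text \<open>
  A zero-mean increment contributes nothing to first order, so smoothness leaves only its second
  moment.
\<close>

lemma conjugate_growth:
  assumes zero: "\<psi> 0 \<le> (0::real)"
    and smooth: "\<And>v e. \<psi> (v + e) \<le> \<psi> v + inner e (\<eta> v) + (dual_norm N e)\<^sup>2 / 2" and "0 \<le> k"
  shows "expect (aug_run s) (\<lambda>(\<omega>, (v, q)). \<psi> (k *\<^sub>R v)) \<le> (k * \<alpha>)\<^sup>2 * (L\<^sup>2 + Lbar\<^sup>2) * (\<Sum>i<s. lagw i)"
proof (induction s)
  case 0
  show ?case using zero by simp
next
  case (Suc s)
  let ?t = "int s"
  have "expect (aug_run (Suc s)) (\<lambda>(\<omega>, (v, q)). \<psi> (k *\<^sub>R v)) = expect (aug_run s) (\<lambda>((x, w), (v, q)).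
      expect (samples x w ?t) (\<lambda>\<xi>s. \<psi> (k *\<^sub>R (v + \<alpha> *\<^sub>R noise x w ?t \<xi>s))))"
    unfolding expect_aug_Suc by (simp add: split_def del: integral_bernoulli_pmf)
  also have "\<dots> \<le> expect (aug_run s) (\<lambda>\<sigma>. (case \<sigma> of (\<omega>, (v, q)) \<Rightarrow> \<psi> (k *\<^sub>R v))
      + (k * \<alpha>)\<^sup>2 * (L\<^sup>2 + Lbar\<^sup>2) * (case \<sigma> of ((x, w), a) \<Rightarrow> (N (x ?t - w (?t - 1)))\<^sup>2))"
  proof (rule aug_expect_mono, unfold prod.case)
    fix x w v q assume st: "((x, w), (v, q)) \<in> set_pmf (aug_run s)"
    have adm: "admissible ?t x w" by (rule aug_run_admissible[OF st])
    note fin = finite_samples[OF adm]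
    let ?e = "noise x w ?t"
    have "expect (samples x w ?t) (\<lambda>\<xi>s. \<psi> (k *\<^sub>R (v + \<alpha> *\<^sub>R ?e \<xi>s)))
      \<le> expect (samples x w ?t) (\<lambda>\<xi>s. (\<psi> (k *\<^sub>R v) + (k * \<alpha>) * inner (?e \<xi>s) (\<eta> (k *\<^sub>R v)))
          + (k * \<alpha>)\<^sup>2 / 2 * (dual_norm N (?e \<xi>s))\<^sup>2)"
    proof (intro expect_mono fin)
      fix \<xi>s
      have "(dual_norm N ((k * \<alpha>) *\<^sub>R ?e \<xi>s))\<^sup>2 \<le> ((k * \<alpha>) * dual_norm N (?e \<xi>s))\<^sup>2"
        using \<open>0 \<le> k\<close> \<alpha>_pos by (intro power_mono dual_norm_scale) auto
      thus "\<psi> (k *\<^sub>R (v + \<alpha> *\<^sub>R ?e \<xi>s)) \<le> (\<psi> (k *\<^sub>R v) + (k * \<alpha>) * inner (?e \<xi>s) (\<eta> (k *\<^sub>R v)))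
          + (k * \<alpha>)\<^sup>2 / 2 * (dual_norm N (?e \<xi>s))\<^sup>2"
        using smooth[of "k *\<^sub>R v" "(k * \<alpha>) *\<^sub>R ?e \<xi>s"]
        by (simp add: scaleR_add_right power_mult_distrib)
    qed
    also have "\<dots> = \<psi> (k *\<^sub>R v) + (k * \<alpha>)\<^sup>2 / 2 * expect (samples x w ?t) (\<lambda>\<xi>s. (dual_norm N (?e \<xi>s))\<^sup>2)"
      using noise_mean_zero[OF adm] by (simp add: expect_add fin)
    also have "\<dots> \<le> \<psi> (k *\<^sub>R v) + (k * \<alpha>)\<^sup>2 / 2 * (2 * (L\<^sup>2 + Lbar\<^sup>2) * (N (x ?t - w (?t - 1)))\<^sup>2)"
      by (intro add_left_mono mult_left_mono noise_second_moment[OF adm]) auto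
    also have "\<dots> = \<psi> (k *\<^sub>R v)
        + (k * \<alpha>)\<^sup>2 * (L\<^sup>2 + Lbar\<^sup>2) * (N (x ?t - w (?t - 1)))\<^sup>2" by (simp add: field_simps)
    finally show "expect (samples x w ?t) (\<lambda>\<xi>s. \<psi> (k *\<^sub>R (v + \<alpha> *\<^sub>R noise x w ?t \<xi>s)))
      \<le> \<psi> (k *\<^sub>R v) + (k * \<alpha>)\<^sup>2 * (L\<^sup>2 + Lbar\<^sup>2) * (N (x ?t - w (?t - 1)))\<^sup>2" .
  qed
  also have "\<dots> = expect (aug_run s) (\<lambda>(\<omega>, (v, q)). \<psi> (k *\<^sub>R v)) + (k * \<alpha>)\<^sup>2 * (L\<^sup>2 + Lbar\<^sup>2) * lagw s"
    unfolding lagw_def by (subst expect_add, rule finite_aug_run) (simp add: split_def)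
  also have "\<dots> \<le> (k * \<alpha>)\<^sup>2 * (L\<^sup>2 + Lbar\<^sup>2) * (\<Sum>i<s. lagw i) + (k * \<alpha>)\<^sup>2 * (L\<^sup>2 + Lbar\<^sup>2) * lagw s"
    using Suc by simp
  finally show ?case by (simp add: algebra_simps)
qed

section \<open>The pathwise inequality and the gap\<close>

text \<open>
  Along every trajectory the potential \<open>D u x\<^sub>s + (1 - \<gamma>) D u x\<^sub>s\<^sub>-\<^sub>1\<close> telescopes because the
  extrapolated gradient is a convex combination, and the correction \<open>F x\<^sub>s - F w\<^sub>s\<^sub>-\<^sub>1\<close> in the direction
  cancels the error made in the previous step by using \<open>F w\<^sub>s\<^sub>-\<^sub>1\<close> in place of \<open>F x\<^sub>s\<close>.
\<close>

lemma pathwise_inequality: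
  assumes "((x, w), (v, q)) \<in> set_pmf (aug_run s)" "u \<in> edom K g"
  shows "\<alpha> * (\<Sum>i<s. inner (F (x (int i + 1))) (x (int i + 1) - u) + gr (x (int i + 1)) - gr u)
    + D u (x (int s)) + (1 - \<gamma>) * D u (x (int s - 1))
    - \<alpha> * inner (drift x w (int s)) (x (int s) - u)
    \<le> (2 - \<gamma>) * D u x0 + inner v (u - x0) + q"
  using assms(1)
proof (induction s arbitrary: x w v q)
  case 0
  hence "x = (\<lambda>_. x0)" "w = (\<lambda>_. x0)" "v = 0" "q = 0" by auto
  thus ?case by (simp add: drift_def algebra_simps)
next
  case (Suc s)
  obtain x1 w1 v1 q1 \<xi>s z where st: "((x1, w1), (v1, q1)) \<in> set_pmf (aug_run s)"
    and \<xi>s: "\<xi>s \<in> set_pmf (samples x1 w1 (int s))"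
    and x: "x = x1(int s + 1 := successor x1 w1 (int s) \<xi>s)" and w: "w = w1(int s + 1 := z)"
    and v: "v = v1 + \<alpha> *\<^sub>R noise x1 w1 (int s) \<xi>s" and q: "q = q1 + residual x1 w1 (int s) \<xi>s"
    by (rule aug_run_SucE[OF Suc.prems])
  define y where "y = successor x1 w1 (int s) \<xi>s"
  define d e where "d = drift x1 w1 (int s)" and "e = noise x1 w1 (int s) \<xi>s"
  have adm: "admissible (int s) x1 w1" by (rule aug_run_admissible[OF st])
  have dir: "direction x1 w1 (int s) \<xi>s = F (w1 (int s)) + d + e"
    unfolding d_def e_def by (rule direction_eq[OF samples_length[OF \<xi>s]])
  have vi: "0 \<le> \<alpha> * (gr u - gr y) + inner (\<alpha> *\<^sub>R (F (w1 (int s)) + d + e) + f' y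
      - (\<gamma> *\<^sub>R f' (x1 (int s)) + (1 - \<gamma>) *\<^sub>R f' (x1 (int s - 1)))) (u - y)"
    using successor_variational_inequality[OF adm successor_subdiff[OF st \<xi>s] assms(2)]
    unfolding dir y_def .
  have idx: "int (Suc s) = int s + 1" "int s + 1 - 1 = int s" by auto
  have xs: "x (int s + 1) = y" "x (int s) = x1 (int s)" "w (int s) = w1 (int s)"
    by (auto simp: x w y_def)
  have old: "x (int i + 1) = x1 (int i + 1)" if "i < s" for i using that by (simp add: x)
  have sum: "(\<Sum>i<Suc s. inner (F (x (int i + 1))) (x (int i + 1) - u) + gr (x (int i + 1)) - gr u)
      = (\<Sum>i<s. inner (F (x1 (int i + 1))) (x1 (int i + 1) - u) + gr (x1 (int i + 1)) - gr u)
        + (inner (F y) (y - u) + gr y - gr u)"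
    using old by (simp add: xs)
  have res: "residual x1 w1 (int s) \<xi>s = \<alpha> * inner d (x1 (int s) - y) + \<alpha> * inner e (x0 - y)
      - \<gamma> * D y (x1 (int s)) - (1 - \<gamma>) * D y (x1 (int s - 1))"
    by (simp add: residual_def Let_def y_def d_def e_def)
  have drift: "drift x w (int s + 1) = F y - F (w1 (int s))"
    unfolding drift_def idx xs ..
  note IH = Suc.IH[OF st, folded d_def]
  have step: "\<alpha> * (inner (F y) (y - u) + gr y - gr u) + D u y + (1 - \<gamma>) * D u (x1 (int s))
      - \<alpha> * inner (F y - F (w1 (int s))) (y - u)
    \<le> D u (x1 (int s)) + (1 - \<gamma>) * D u (x1 (int s - 1)) - \<alpha> * inner d (x1 (int s) - u)
      + \<alpha> * inner e (u - x0) + residual x1 w1 (int s) \<xi>s"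
    using vi unfolding res D_def by (simp add: inner_simps algebra_simps)
  show ?case
    unfolding idx drift sum xs
    using IH step by (simp add: v q e_def[symmetric] inner_add_left algebra_simps)
qed

lemma ergodic_avg_edom:
  assumes "((x, w), a) \<in> set_pmf (aug_run S)" "1 \<le> S"
  shows "ergodic_avg S (x, w) \<in> edom K g"
    and "gr (ergodic_avg S (x, w)) \<le> (1 / real S) * (\<Sum>s<S. gr (x (int s + 1)))"
proof -
  have adm: "admissible (int S) x w" by (rule aug_run_admissible[OF assms(1)])
  have mem: "x (int s + 1) \<in> edom K g" if "s < S" for s
    using admissible_edom(1)[OF adm, of "int s + 1"] that by simp
  have avg: "ergodic_avg S (x, w) = (\<Sum>s<S. (1 / real S) *\<^sub>R x (int s + 1))"
    by (simp add: ergodic_avg_def scaleR_sum_right)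
  have one: "(\<Sum>s<S. 1 / real S) = 1" using assms(2) by simp
  show "ergodic_avg S (x, w) \<in> edom K g"
    unfolding avg using convex_edom(1)[OF proper_g econvex_g] mem one
    by (intro convex_sum) auto
  have "gr (\<Sum>s<S. (1 / real S) *\<^sub>R x (int s + 1)) \<le> (\<Sum>s<S. 1 / real S * gr (x (int s + 1)))"
    using assms(2) mem one
    by (intro convex_on_sum[of "{..<S}", OF _ _ convex_edom(2)[OF proper_g econvex_g]])
       (auto simp: lessThan_empty_iff)
  thus "gr (ergodic_avg S (x, w)) \<le> (1 / real S) * (\<Sum>s<S. gr (x (int s + 1)))"
    by (simp add: avg sum_distrib_left)
qed

text \<open>
  Monotonicity replaces \<open>F u\<close> by \<open>F x\<^sub>s\<^sub>+\<^sub>1\<close> and convexity passes to the average. The last drift term does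
  not telescope; it is absorbed by \<open>D u x\<^sub>S\<close> at the price of one more displacement to the anchor.
\<close>

lemma gap_term_le:
  assumes st: "((x, w), (v, q)) \<in> set_pmf (aug_run S)" and S: "1 \<le> S" and u: "u \<in> edom K g"
  defines "z \<equiv> ergodic_avg S (x, w)"
  shows "\<alpha> * real S * (inner (F u) (z - u) + gr z - gr u)
    \<le> (2 - \<gamma>) * D u x0 + inner v (u - x0) + q
      + (\<alpha> * L)\<^sup>2 / 2 * (N (x (int S) - w (int S - 1)))\<^sup>2"
proof -
  have adm: "admissible (int S) x w" by (rule aug_run_admissible[OF st])
  have mem: "x (int s + 1) \<in> edom K g" if "s < S" for s
    using admissible_edom(1)[OF adm, of "int s + 1"] that by simp
  have "real S *\<^sub>R (z - u) = (\<Sum>s<S. x (int s + 1) - u)"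
    using S by (simp add: z_def ergodic_avg_def scaleR_diff_right sum_subtractf sum_constant_scaleR)
  hence "real S * inner (F u) (z - u) = inner (F u) (\<Sum>s<S. x (int s + 1) - u)"
    by (metis inner_scaleR_right)
  also have "\<dots> = (\<Sum>s<S. inner (F u) (x (int s + 1) - u))" by (simp add: inner_sum_right)
  also have "\<dots> \<le> (\<Sum>s<S. inner (F (x (int s + 1))) (x (int s + 1) - u))"
  proof (rule sum_mono)
    fix s assume "s \<in> {..<S}"
    hence "inner (F (x (int s + 1)) - F u) (x (int s + 1) - u) \<ge> 0"
      using monotone_F mem u by (simp add: monotone_operator_on_def)
    thus "inner (F u) (x (int s + 1) - u) \<le> inner (F (x (int s + 1))) (x (int s + 1) - u)"
      by (simp add: inner_diff_left)
  qed
  finally have 1: "real S * inner (F u) (z - u) \<le> (\<Sum>s<S. inner (F (x (int s + 1))) (x (int s + 1) - u))" .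
  have "real S * gr z \<le> (\<Sum>s<S. gr (x (int s + 1)))"
    using ergodic_avg_edom(2)[OF st S] S by (simp add: z_def field_simps)
  with 1 have "real S * (inner (F u) (z - u) + gr z - gr u)
      \<le> (\<Sum>s<S. inner (F (x (int s + 1))) (x (int s + 1) - u) + gr (x (int s + 1)) - gr u)"
    by (simp add: sum.distrib sum_subtractf algebra_simps)
  hence 2: "\<alpha> * (real S * (inner (F u) (z - u) + gr z - gr u))
      \<le> \<alpha> * (\<Sum>s<S. inner (F (x (int s + 1))) (x (int s + 1) - u) + gr (x (int s + 1)) - gr u)"
    using \<alpha>_pos by (intro mult_left_mono) auto
  have uf: "u \<in> edom K f" by (rule edom_gf[OF u])
  have "\<alpha> * inner (drift x w (int S)) (x (int S) - u)
      \<le> (\<alpha> * L * N (x (int S) - w (int S - 1))) * N (u - x (int S))"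
  proof -
    have "inner (drift x w (int S)) (x (int S) - u) \<le> dual_norm N (drift x w (int S)) * N (u - x (int S))"
      using inner_le_dual_norm[of "drift x w (int S)" "x (int S) - u"] N_commute[of u] by simp
    also have "\<dots> \<le> L * N (x (int S) - w (int S - 1)) * N (u - x (int S))"
      by (intro mult_right_mono drift_le adm) auto
    finally show ?thesis using \<alpha>_pos by (simp add: mult.assoc)
  qed
  also have "\<dots> \<le> 1 / 2 * (N (u - x (int S)))\<^sup>2 + (\<alpha> * L * N (x (int S) - w (int S - 1)))\<^sup>2 / (2 * 1)"
    by (rule weighted_young) simp
  also have "\<dots> \<le> D u (x (int S)) + (\<alpha> * L)\<^sup>2 / 2 * (N (x (int S) - w (int S - 1)))\<^sup>2"
    using strong_convexity[OF uf admissible_edom(3)[OF adm, of "int S"]] by (simp add: power_mult_distrib)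
  finally have 3: "\<alpha> * inner (drift x w (int S)) (x (int S) - u)
      \<le> D u (x (int S)) + (\<alpha> * L)\<^sup>2 / 2 * (N (x (int S) - w (int S - 1)))\<^sup>2" .
  have "0 \<le> (1 - \<gamma>) * D u (x (int S - 1))"
    using \<gamma>01 D_nonneg[OF uf admissible_edom(3)[OF adm, of "int S - 1"]] by simp
  with 2 3 pathwise_inequality[OF st u] show ?thesis by (simp add: mult.assoc)
qed

end

section \<open>Summation and the choice of parameters\<close>

text \<open>
  Here \<open>a\<close>, \<open>c\<close> and \<open>W\<close> stand for the mean squared displacements over one step, over two steps and to
  the anchor. Since only sums over time matter, index shifts are free: \<open>a s\<close> and \<open>a (Suc s)\<close> count
  alike, and \<open>budget\<close> is a condition on three numbers.
\<close>

lemma displacement_budget: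
  fixes a c W R :: "nat \<Rightarrow> real" and \<beta> \<gamma> \<theta> \<rho> p \<Lambda> :: real
  assumes zero: "a 0 = 0" "W 0 = 0" "R 0 = 0"
    and nonneg: "\<And>s. 0 \<le> a s" "\<And>s. 0 \<le> c s" "\<And>s. 0 \<le> W s" and p: "0 \<le> p" and \<Lambda>: "0 \<le> \<Lambda>"
    and R: "\<And>s. R (Suc s) \<le> R s + \<rho> / 2 * W s - (\<gamma> - \<theta>) / 2 * a (Suc s) - (1 - \<gamma>) / 2 * c (Suc s)"
    and W1: "\<And>s. W (Suc s) \<le> a (Suc s) + c (Suc s)"
    and W2: "\<And>s. W (Suc s) \<le> 2 * p * (a (Suc s) + \<Lambda> * a s) + c (Suc s)"
    and c: "\<And>s. c (Suc s) \<le> 2 * a (Suc s) + 2 * a s"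
    and budget: "\<And>A C V. \<lbrakk>0 \<le> A; 0 \<le> C; 0 \<le> V; V \<le> A + C; V \<le> 2 * p * (1 + \<Lambda>) * A + C; C \<le> 4 * A\<rbrakk>
      \<Longrightarrow> (\<rho> + \<beta>) * V \<le> (\<gamma> - \<theta>) * A + (1 - \<gamma>) * C"
    and "0 \<le> \<beta>"
  shows "R S + \<rho> / 2 * W S + \<beta> / 2 * (\<Sum>i<S. W i) \<le> 0"
proof -
  define A C V A' where "A = (\<Sum>i<S. a (Suc i))" and "C = (\<Sum>i<S. c (Suc i))"
    and "V = (\<Sum>i<S. W (Suc i))" and "A' = (\<Sum>i<S. a i)"
  have V: "V = (\<Sum>i<S. W i) + W S"
    using sum.lessThan_Suc_shift[of W S] zero by (simp add: V_def)
  have "A' + a S = A"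
    using sum.lessThan_Suc_shift[of a S] zero by (simp add: A_def A'_def)
  hence A': "A' \<le> A" using nonneg(1)[of S] by linarith
  have pos: "0 \<le> A" "0 \<le> C" "0 \<le> V" by (auto simp: A_def C_def V_def intro: sum_nonneg nonneg)
  have "V \<le> A + C"
    unfolding V_def A_def C_def sum.distrib[symmetric] by (intro sum_mono W1)
  moreover have "V \<le> (\<Sum>i<S. 2 * p * (a (Suc i) + \<Lambda> * a i) + c (Suc i))"
    unfolding V_def by (intro sum_mono W2)
  hence "V \<le> 2 * p * (A + \<Lambda> * A') + C"
    by (simp add: A_def A'_def C_def sum.distrib sum_distrib_left[symmetric])
  moreover have "2 * p * (A + \<Lambda> * A') \<le> 2 * p * (A + \<Lambda> * A)"
    using A' p \<Lambda> by (intro mult_left_mono add_left_mono) auto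
  moreover have "C \<le> (\<Sum>i<S. 2 * a (Suc i) + 2 * a i)"
    unfolding C_def by (intro sum_mono c)
  hence "C \<le> 2 * A + 2 * A'" by (simp add: A_def A'_def sum.distrib sum_distrib_left)
  ultimately have "(\<rho> + \<beta>) * V \<le> (\<gamma> - \<theta>) * A + (1 - \<gamma>) * C"
    using A' pos by (intro budget) (auto simp: algebra_simps)
  moreover have "R S \<le> \<rho> / 2 * (\<Sum>i<S. W i) - (\<gamma> - \<theta>) / 2 * A - (1 - \<gamma>) / 2 * C"
    unfolding A_def C_def
  proof (induction S)
    case (Suc s)
    show ?case using Suc R[of s] by (simp add: algebra_simps diff_divide_distrib)
  qed (simp add: zero)
  moreover have "0 \<le> \<beta> * W S" using \<open>0 \<le> \<beta>\<close> nonneg by simp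
  ultimately show ?thesis unfolding V by (simp add: field_simps)
qed

lemma three_le_M:
  fixes M :: nat
  assumes "p = 1 / real M" "0 < p" "p < 1" "\<gamma> = p + 1 / sqrt (real M)" "\<gamma> < 1"
  shows "3 \<le> M"
proof (rule ccontr)
  assume "\<not> 3 \<le> M"
  moreover have "M \<noteq> 0" "M \<noteq> 1" using assms(1-3) by auto
  ultimately have M: "M = 2" by linarith
  have "sqrt 2 \<le> (2::real)" by (rule real_le_lsqrt) auto
  hence "1 / 2 \<le> 1 / sqrt 2" by (intro divide_left_mono) auto
  moreover have "p = 1 / 2" "\<gamma> = p + 1 / sqrt 2" using assms(1,4) M by simp_all
  ultimately show False using assms(5) by linarith
qed

lemma sqrt_3_bounds: "1.732 \<le> sqrt (3::real)" "sqrt (3::real) \<le> 1.7321"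
  by (rule real_le_rsqrt, simp add: power2_eq_square) (rule real_le_lsqrt, simp_all add: power2_eq_square)

text \<open>
  With \<open>\<Lambda> = (\<alpha> L)\<^sup>2\<close> and \<open>\<nu> = \<alpha>\<^sup>2 Lbar\<^sup>2 / b\<close>, the last hypothesis is what the step size guarantees.
  Young's inequality with weight \<open>\<theta>\<close> costs \<open>\<theta>\<close> per unit of the one-step displacement \<open>A\<close> and \<open>\<rho>\<close> per
  unit of the displacement \<open>V\<close> to the anchor; the budget is \<open>\<gamma>\<close> per unit of \<open>A\<close> and \<open>1 - \<gamma>\<close> per unit
  of the two-step displacement \<open>C\<close>. For \<open>M \<ge> 4\<close> the displacement to the anchor is
  charged to the two-step displacement and, up to a factor of order \<open>p\<close>, to the one-step
  displacement. For \<open>M = 3\<close> the two-step budget \<open>1 - \<gamma>\<close> is too small, but \<open>\<gamma>\<close> is so large that the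
  triangle inequality can shift the excess to the one-step displacement. The slack \<open>1 / 36\<close> is left
  to pay for the noise inside the supremum that defines the gap.
\<close>

lemma ex_young_weight:
  fixes M :: nat and p \<gamma> \<Lambda> \<nu> :: real
  assumes p: "p = 1 / real M" "0 < p" "p < 1" and \<gamma>: "\<gamma> = p + 1 / sqrt (real M)" "\<gamma> < 1"
    and \<Lambda>: "0 \<le> \<Lambda>" and \<nu>: "0 \<le> \<nu>"
    and \<kappa>: "\<Lambda> + 2 * \<nu> \<le> (\<gamma> - p) / (2 * (1 - p)) * ((1 - \<gamma>) / (1 - p))"
  obtains \<theta> \<rho> where "0 < \<theta>" "\<theta> \<le> 1" "\<Lambda> / \<theta> + 4 * \<nu> \<le> \<rho>"
    "\<And>A C V. \<lbrakk>0 \<le> A; 0 \<le> C; 0 \<le> V; V \<le> A + C; V \<le> 2 * p * (1 + \<Lambda>) * A + C; C \<le> 4 * A\<rbrakk>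
      \<Longrightarrow> (\<rho> + 1 / 36) * V \<le> (\<gamma> - \<theta>) * A + (1 - \<gamma>) * C"
proof -
  define m where "m = sqrt (real M)"
  have M3: "3 \<le> M" by (rule three_le_M[OF p \<gamma>])
  have m2: "m\<^sup>2 = real M" by (simp add: m_def)
  have m_pos: "0 < m" using M3 by (simp add: m_def)
  have p_m: "p = 1 / m\<^sup>2" and \<gamma>_m: "\<gamma> = 1 / m\<^sup>2 + 1 / m" using p \<gamma> m2 by (auto simp: m_def)
  have m1: "1 < m\<^sup>2" using m2 M3 by simp
  define \<theta>0 \<rho>0 where "\<theta>0 = m / (2 * (m\<^sup>2 - 1))" and "\<rho>0 = (m\<^sup>2 - m - 1) / (m\<^sup>2 - 1)"
  have "(\<gamma> - p) / (2 * (1 - p)) = \<theta>0" "(1 - \<gamma>) / (1 - p) = \<rho>0"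
    using m_pos m1 by (simp_all add: p_m \<gamma>_m \<theta>0_def \<rho>0_def field_simps power2_eq_square)
  hence \<kappa>': "\<Lambda> + 2 * \<nu> \<le> \<theta>0 * \<rho>0" using \<kappa> by simp
  have cost: "\<Lambda> / \<theta> + 4 * \<nu> \<le> \<theta>0 * \<rho>0 / \<theta>" if "0 < \<theta>" "\<theta> \<le> 1 / 2" for \<theta>
  proof -
    have "4 * \<nu> * \<theta> \<le> 4 * \<nu> * (1 / 2)" using that \<nu> by (intro mult_left_mono) auto
    hence "\<Lambda> + 4 * \<nu> * \<theta> \<le> \<theta>0 * \<rho>0" using \<kappa>' by simp
    hence "(\<Lambda> + 4 * \<nu> * \<theta>) / \<theta> \<le> \<theta>0 * \<rho>0 / \<theta>" using that by (intro divide_right_mono) auto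
    thus ?thesis using that by (simp add: add_divide_distrib)
  qed
  show thesis
  proof (cases "M = 3")
    case True
    have m: "m = sqrt 3" "m\<^sup>2 = 3" using True by (auto simp: m_def)
    have b: "1.732 \<le> m" "m \<le> 1.7321" using sqrt_3_bounds m by auto
    have \<gamma>3: "\<gamma> = 1 / 3 + m / 3" using m_pos m(2) by (simp add: \<gamma>_m field_simps power2_eq_square)
    have \<rho>3: "\<theta>0 * \<rho>0 / (1 / 2) = m / 2 - 3 / 4"
      using m(2) by (simp add: \<theta>0_def \<rho>0_def field_simps power2_eq_square)
    show thesis
    proof (rule that[of "1 / 2" "m / 2 - 3 / 4"])
      show "\<Lambda> / (1 / 2) + 4 * \<nu> \<le> m / 2 - 3 / 4" using cost[of "1 / 2"] \<rho>3 by simp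
      fix A C V :: real assume *: "0 \<le> A" "0 \<le> C" "V \<le> A + C" "C \<le> 4 * A"
      have "(m / 2 - 3 / 4 + 1 / 36) * V \<le> (m / 2 - 3 / 4 + 1 / 36) * (A + C)"
        using * b by (intro mult_left_mono) auto
      also have "\<dots> \<le> (\<gamma> - 1 / 2) * A + (1 - \<gamma>) * C"
      proof -
        have "(5 * m / 6 - 25 / 18) * C \<le> (5 * m / 6 - 25 / 18) * (4 * A)"
          using * b by (intro mult_left_mono) auto
        moreover have "0 \<le> (110 / 18 - 21 * m / 6) * A"
          using * b by (intro mult_nonneg_nonneg) auto
        ultimately show ?thesis by (simp add: \<gamma>3 field_simps)
      qed
      finally show "(m / 2 - 3 / 4 + 1 / 36) * V \<le> (\<gamma> - 1 / 2) * A + (1 - \<gamma>) * C" .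
    qed auto
  next
    case False
    hence M4: "4 \<le> M" using M3 by simp
    have m_ge: "2 \<le> m"
      using real_sqrt_le_mono[of 4 "real M"] M4 by (simp add: m_def)
    have mm: "4 \<le> m * m" using mult_mono[OF m_ge m_ge] m_pos by simp
    have den: "0 < m\<^sup>2 - 1" using m1 by simp
    have half: "3 / 2 * \<theta>0 \<le> 1 / 2"
    proof -
      have "0 \<le> (m - 2) * (2 * m + 1)" using m_ge by (intro mult_nonneg_nonneg) auto
      thus ?thesis using den by (simp add: \<theta>0_def field_simps power2_eq_square)
    qed
    have \<theta>0_pos: "0 < \<theta>0" using m_pos den by (simp add: \<theta>0_def)
    \<comment> \<open>The difference of the two sides is a perfect square.\<close>
    have "\<theta>0 * \<rho>0 \<le> 1 / 8"
    proof -
      have "0 \<le> (m\<^sup>2 - 2 * m - 1)\<^sup>2" by simp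
      hence "4 * (m * (m\<^sup>2 - m - 1)) \<le> (m\<^sup>2 - 1)\<^sup>2" by (simp add: power2_eq_square algebra_simps)
      hence "m * (m\<^sup>2 - m - 1) / (2 * (m\<^sup>2 - 1)\<^sup>2) \<le> 1 / 8"
        using den by (simp add: divide_le_eq)
      moreover have "\<theta>0 * \<rho>0 = m * (m\<^sup>2 - m - 1) / (2 * (m\<^sup>2 - 1)\<^sup>2)"
        by (simp only: \<theta>0_def \<rho>0_def power2_eq_square[of "m\<^sup>2 - 1"] times_divide_times_eq mult.assoc)
      ultimately show ?thesis by simp
    qed
    hence \<Lambda>8: "\<Lambda> \<le> 1 / 8" using \<kappa>' \<nu> by linarith
    have gap: "1 - \<gamma> = (m\<^sup>2 - m - 1) / m\<^sup>2"
      using m_pos by (simp add: \<gamma>_m field_simps power2_eq_square)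
    have quarter: "1 / 4 \<le> 1 - \<gamma>"
    proof -
      have "0 \<le> (m - 2) * (3 * m + 2)" using m_ge by (intro mult_nonneg_nonneg) auto
      thus ?thesis unfolding gap using m_pos by (simp add: field_simps power2_eq_square)
    qed
    have \<rho>_le: "2 / 3 * \<rho>0 + 1 / 36 \<le> 1 - \<gamma>"
    proof -
      have num: "0 \<le> m\<^sup>2 - m - 1" using quarter unfolding gap using m_pos by (simp add: field_simps)
      have "\<rho>0 \<le> (m\<^sup>2 - m - 1) / (3 / 4 * m\<^sup>2)"
        unfolding \<rho>0_def using num mm m_pos by (intro divide_left_mono) (auto simp: power2_eq_square)
      also have "\<dots> = 4 / 3 * (1 - \<gamma>)" unfolding gap by simp
      finally have "2 / 3 * \<rho>0 \<le> 8 / 9 * (1 - \<gamma>)" by simp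
      moreover have "1 / 36 \<le> 1 / 9 * (1 - \<gamma>)" using quarter by simp
      ultimately show ?thesis by argo
    qed
    have one_step: "9 / 4 * p * (1 - \<gamma>) \<le> \<gamma> - 3 / 2 * \<theta>0"
    proof -
      define d x where "d = m\<^sup>2 - 1" and "x = \<gamma> - 3 / 2 * \<theta>0 - 9 / 4 * p * (1 - \<gamma>)"
      have d: "0 < d" using den by (simp add: d_def)
      have clear: "p * m\<^sup>2 = 1" "\<gamma> * m\<^sup>2 = 1 + m" "(1 - \<gamma>) * m\<^sup>2 = m\<^sup>2 - m - 1" "\<theta>0 * (2 * d) = m"
        using m_pos d by (simp_all add: p_m gap \<theta>0_def d_def[symmetric])
           (simp add: \<gamma>_m field_simps power2_eq_square)
      have "4 * m ^ 4 * d * x = 4 * m\<^sup>2 * d * (\<gamma> * m\<^sup>2) - 3 * m ^ 4 * (\<theta>0 * (2 * d))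
          - 9 * d * (p * m\<^sup>2) * ((1 - \<gamma>) * m\<^sup>2)"
        by (simp add: x_def eval_nat_numeral algebra_simps diff_divide_distrib)
      also have "\<dots> = m\<^sup>2 * ((m - 3)\<^sup>2 * (m + 1)) + 2 * m * (m * m - 4) + 5 * m * (m - 2) + 9 * (m - 1)"
        unfolding clear by (simp add: d_def eval_nat_numeral algebra_simps)
      also have "\<dots> \<ge> 0" using m_ge mm by (intro add_nonneg_nonneg mult_nonneg_nonneg) auto
      finally have "0 \<le> 4 * m ^ 4 * d * x" .
      moreover have "0 < 4 * m ^ 4 * d" using m_pos d by simp
      ultimately have "0 \<le> x" by (simp only: zero_le_mult_iff) linarith
      thus ?thesis by (simp add: x_def)
    qed
    \<comment> \<open>The weight \<open>\<theta>0\<close> would exhaust the two-step budget; the factor \<open>3 / 2\<close> gives slack there and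
      still leaves \<open>\<theta>0 / 2\<close> of the one-step budget.\<close>
    show thesis
    proof (rule that[of "3 / 2 * \<theta>0" "2 / 3 * \<rho>0"])
      show "\<Lambda> / (3 / 2 * \<theta>0) + 4 * \<nu> \<le> 2 / 3 * \<rho>0"
        using cost[OF _ half] \<theta>0_pos by simp
      fix A C V :: real
      assume *: "0 \<le> A" "0 \<le> C" "0 \<le> V" "V \<le> 2 * p * (1 + \<Lambda>) * A + C"
      have "2 * p * (1 + \<Lambda>) * A \<le> 2 * p * (1 + 1 / 8) * A"
        using \<Lambda>8 p * by (intro mult_right_mono mult_left_mono) auto
      hence "V \<le> 9 / 4 * p * A + C" using * by simp
      hence "(1 - \<gamma>) * V \<le> (1 - \<gamma>) * (9 / 4 * p * A + C)" using \<gamma> by (intro mult_left_mono) auto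
      moreover have "(2 / 3 * \<rho>0 + 1 / 36) * V \<le> (1 - \<gamma>) * V" using \<rho>_le * by (intro mult_right_mono)
      moreover have "9 / 4 * p * (1 - \<gamma>) * A \<le> (\<gamma> - 3 / 2 * \<theta>0) * A"
        using one_step * by (intro mult_right_mono)
      ultimately show "(2 / 3 * \<rho>0 + 1 / 36) * V \<le> (\<gamma> - 3 / 2 * \<theta>0) * A + (1 - \<gamma>) * C"
        by (simp add: algebra_simps)
    qed (use \<theta>0_pos half in auto)
  qed
qed

lemma one_minus_\<gamma>_ge:
  fixes M :: nat
  assumes "3 \<le> M" "\<gamma> = 1 / real M + 1 / sqrt (real M)"
  shows "1 / 12 \<le> 1 - \<gamma>"
proof -
  have "1 / real M \<le> 1 / 3" using assms(1) by simp
  moreover have "1 / sqrt (real M) \<le> 1 / 1.732"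
  proof (rule divide_left_mono)
    have "sqrt 3 \<le> sqrt (real M)" using assms(1) by simp
    thus "1.732 \<le> sqrt (real M)" using sqrt_3_bounds by linarith
  qed (use assms(1) in auto)
  ultimately show ?thesis unfolding assms(2) by simp
qed

lemma step_size_bounds:
  fixes M b :: nat and p \<gamma> \<alpha> L Lbar :: real
  assumes p: "p = 1 / real M" "0 < p" "p < 1" and \<gamma>: "\<gamma> = p + 1 / sqrt (real M)" "\<gamma> < 1"
    and b: "1 \<le> b" and \<alpha>: "0 < \<alpha>"
      "\<alpha> = min ((\<gamma> - p) / (2 * (1 - p))) ((1 - \<gamma>) * real b / ((1 - p) * (2 * Lbar\<^sup>2 + real b * L\<^sup>2)))"
  shows "\<alpha> \<le> 1 / 2"
    and "(\<alpha> * L)\<^sup>2 + 2 * (\<alpha>\<^sup>2 * Lbar\<^sup>2 / real b) \<le> (\<gamma> - p) / (2 * (1 - p)) * ((1 - \<gamma>) / (1 - p))"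
    and "1 \<le> \<alpha> * (sqrt (real M) * (2 + 12 * (2 * Lbar\<^sup>2 + L\<^sup>2)))"
proof -
  have M3: "3 \<le> M" by (rule three_le_M[OF p \<gamma>])
  define m where "m = sqrt (real M)"
  have m: "1 \<le> m" using M3 by (simp add: m_def)
  have \<gamma>p: "\<gamma> - p = 1 / m" by (simp add: \<gamma> m_def)
  define E where "E = 2 * Lbar\<^sup>2 + real b * L\<^sup>2"
  have \<alpha>1: "\<alpha> \<le> (\<gamma> - p) / (2 * (1 - p))" and \<alpha>2: "\<alpha> \<le> (1 - \<gamma>) * real b / ((1 - p) * E)"
    using \<alpha>(2) by (auto simp: E_def)
  have "E \<noteq> 0" using \<alpha>(1) \<alpha>2 by auto
  hence E: "0 < E" by (simp add: E_def less_le)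
  have "(\<gamma> - p) / (2 * (1 - p)) \<le> (1 - p) / (2 * (1 - p))"
    using \<gamma>(2) p(3) by (intro divide_right_mono) auto
  moreover have "(1 - p) / (2 * (1 - p)) = 1 / 2" using p(3) by (simp add: field_simps)
  ultimately have "(\<gamma> - p) / (2 * (1 - p)) \<le> 1 / 2" by linarith
  thus "\<alpha> \<le> 1 / 2" using \<alpha>1 by linarith
  have "\<alpha> * E / real b \<le> (1 - \<gamma>) / (1 - p)"
  proof -
    have "0 < (1 - p) * E" using E p(3) by simp
    hence "\<alpha> * ((1 - p) * E) \<le> (1 - \<gamma>) * real b" using \<alpha>2 by (simp only: pos_le_divide_eq)
    hence "\<alpha> * E / real b * (1 - p) \<le> 1 - \<gamma>"
      using b by (simp add: pos_divide_le_eq mult.assoc mult.commute mult.left_commute)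
    thus ?thesis using p(3) by (simp only: pos_le_divide_eq diff_gt_0_iff_gt)
  qed
  hence "\<alpha> * (\<alpha> * E / real b) \<le> (\<gamma> - p) / (2 * (1 - p)) * ((1 - \<gamma>) / (1 - p))"
    using \<alpha> \<alpha>1 E b by (intro mult_mono) auto
  moreover have "\<alpha> * (\<alpha> * E / real b) = (\<alpha> * L)\<^sup>2 + 2 * (\<alpha>\<^sup>2 * Lbar\<^sup>2 / real b)"
    using b by (simp add: E_def field_simps power2_eq_square)
  ultimately show "(\<alpha> * L)\<^sup>2 + 2 * (\<alpha>\<^sup>2 * Lbar\<^sup>2 / real b) \<le> (\<gamma> - p) / (2 * (1 - p)) * ((1 - \<gamma>) / (1 - p))"
    by simp
  define G where "G = 2 * Lbar\<^sup>2 + L\<^sup>2"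
  have G: "0 \<le> G" by (simp add: G_def)
  show "1 \<le> \<alpha> * (sqrt (real M) * (2 + 12 * (2 * Lbar\<^sup>2 + L\<^sup>2)))"
    unfolding m_def[symmetric] G_def[symmetric]
  proof (cases "\<alpha> = (\<gamma> - p) / (2 * (1 - p))")
    case True
    have "1 \<le> 1 / (1 - p)" using p(2,3) by (simp add: field_simps)
    also have "\<dots> = \<alpha> * (m * 2)" unfolding True \<gamma>p using m p(3) by (simp add: field_simps)
    also have "\<dots> \<le> \<alpha> * (m * (2 + 12 * G))" using \<alpha> m G by (intro mult_left_mono) auto
    finally show "1 \<le> \<alpha> * (m * (2 + 12 * G))" .
  next
    case False
    hence eq: "\<alpha> = (1 - \<gamma>) * real b / ((1 - p) * E)" using \<alpha>(2) by (auto simp: E_def min_def split: if_splits)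
    have "Lbar\<^sup>2 * 1 \<le> Lbar\<^sup>2 * real b" using b by (intro mult_left_mono) auto
    hence "E \<le> real b * G" by (simp add: E_def G_def algebra_simps)
    moreover have "1 \<le> 12 * (1 - \<gamma>)" using one_minus_\<gamma>_ge[OF M3, of \<gamma>] \<gamma> p by simp
    ultimately have "1 * E \<le> (12 * (1 - \<gamma>)) * (real b * G)" using E by (intro mult_mono) auto
    moreover have "(1 - p) * E \<le> E" using E p by (simp add: algebra_simps)
    ultimately have "(1 - p) * E \<le> (1 - \<gamma>) * real b * (12 * G)" by (simp add: algebra_simps)
    moreover have "0 < (1 - p) * E" using E p(3) by simp
    ultimately have "1 \<le> \<alpha> * (12 * G)"
      by (simp only: eq times_divide_eq_left pos_le_divide_eq mult_1)
    also have "\<dots> \<le> \<alpha> * (m * (2 + 12 * G))"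
    proof (rule mult_left_mono)
      have "1 * (12 * G) \<le> m * (2 + 12 * G)" using m G by (intro mult_mono) auto
      thus "12 * G \<le> m * (2 + 12 * G)" by simp
    qed (use \<alpha> in auto)
    finally show "1 \<le> \<alpha> * (m * (2 + 12 * G))" .
  qed
qed

section \<open>The expected gap\<close>

context vr_method
begin

text \<open>
  Points of \<open>C\<close> outside the domain of \<open>g\<close> contribute \<open>-\<infinity>\<close>, and at least one point lies inside, so a
  bound over the domain makes the gap finite.
\<close>

lemma gap_bounds:
  assumes z: "z \<in> edom K g" and CK: "C \<subseteq> K" and ne: "C \<inter> edom K g \<noteq> {}"
    and B: "\<And>u. u \<in> C \<inter> edom K g \<Longrightarrow> inner (F u) (z - u) + gr z - gr u \<le> B"
  shows "\<bar>gap g F C z\<bar> \<noteq> \<infinity>" "real_of_ereal (gap g F C z) \<le> B"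
proof -
  have gz: "g z = ereal (gr z)" by (rule edom_real[OF proper_g z])
  have fin: "ereal (inner (F u) (z - u)) + g z - g u = ereal (inner (F u) (z - u) + gr z - gr u)"
    if "u \<in> C \<inter> edom K g" for u
    by (subst gz, subst edom_real[OF proper_g, of u]) (use that in auto)
  have "ereal (inner (F u) (z - u)) + g z - g u \<le> ereal B" if "u \<in> C" for u
  proof (cases "u \<in> edom K g")
    case True
    thus ?thesis using fin[of u] B[of u] that by simp
  next
    case False
    hence "g u = \<infinity>" using that CK by (auto simp: edom_def)
    thus ?thesis by (subst gz) simp
  qed
  hence upper: "gap g F C z \<le> ereal B" unfolding gap_def by (rule SUP_least)
  obtain u where u: "u \<in> C \<inter> edom K g" using ne by blast
  have "ereal (inner (F u) (z - u) + gr z - gr u) \<le> gap g F C z"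
    unfolding gap_def fin[OF u, symmetric] using u by (intro SUP_upper) auto
  with upper show "\<bar>gap g F C z\<bar> \<noteq> \<infinity>" "real_of_ereal (gap g F C z) \<le> B"
    by (cases "gap g F C z"; auto)+
qed

text \<open>
  The supremum over \<open>u\<close> is taken before the expectation, and \<open>u\<close> occurs only in \<open>D u x0 \<le> Dmax\<close> and in
  the accumulated noise \<open>inner v (u - x0)\<close>. The conjugate of the Bregman distance bounds the latter
  uniformly in \<open>u\<close>; the remaining terms are controlled in expectation by the displacement budget.
\<close>

theorem expected_gap_le:
  assumes p: "p = 1 / real M" and \<gamma>: "\<gamma> = p + 1 / sqrt (real M)"
    and \<alpha>: "\<alpha> = min ((\<gamma> - p) / (2 * (1 - p)))
               ((1 - \<gamma>) * real b / ((1 - p) * (2 * Lbar\<^sup>2 + real b * L\<^sup>2)))"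
    and CK: "C \<subseteq> K" and Dmax: "(SUP u\<in>C \<inter> edom K g. bregman f f' u x0) = ereal Dmax"
    and S: "1 \<le> S"
  shows "0 \<le> Dmax"
    and "\<And>\<omega>. \<omega> \<in> set_pmf (run S) \<Longrightarrow> \<bar>gap g F C (ergodic_avg S \<omega>)\<bar> \<noteq> \<infinity>"
    and "\<alpha> * real S * expect (run S) (\<lambda>\<omega>. real_of_ereal (gap g F C (ergodic_avg S \<omega>)))
      \<le> (3 + 18 * (L\<^sup>2 + Lbar\<^sup>2)) * Dmax"
proof -
  have ne: "C \<inter> edom K g \<noteq> {}" using Dmax by (auto simp: bot_ereal_def)
  have D_le: "D u x0 \<le> Dmax" if "u \<in> C \<inter> edom K g" for u
  proof -
    have "bregman f f' u x0 \<le> ereal Dmax" unfolding Dmax[symmetric] using that by (intro SUP_upper)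
    thus ?thesis using bregman_eq_D[of u x0] edom_gf[of u] edom_gf[OF x0_edom] that by simp
  qed
  have D0: "0 \<le> D u x0" if "u \<in> C \<inter> edom K g" for u
    using D_nonneg[OF edom_gf x0_subdiff] that by simp
  show Dmax0: "0 \<le> Dmax" using ne D_le D0 by (meson all_not_in_conv order_trans)
  obtain \<psi> \<eta> where \<psi>: "\<psi> 0 \<le> (0::real)"
    "\<And>v e. \<psi> (v + e) \<le> \<psi> v + inner e (\<eta> v) + (dual_norm N e)\<^sup>2 / 2"
    "\<And>v u. u \<in> edom K f \<Longrightarrow> inner v (u - x0) \<le> \<psi> v + D u x0"
    using ex_bregman_conjugate[OF x0_subdiff] by blast
  \<comment> \<open>The scaling \<open>k\<close> makes the second moment of the noise fit into the slack \<open>1 / 36\<close> of the budget.\<close>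
  define k where "k = 1 / (1 + 18 * (L\<^sup>2 + Lbar\<^sup>2))"
  have "0 < 1 + 18 * (L\<^sup>2 + Lbar\<^sup>2)" by (simp add: add_pos_nonneg)
  hence k: "0 < k" "1 / k = 1 + 18 * (L\<^sup>2 + Lbar\<^sup>2)" "k * (L\<^sup>2 + Lbar\<^sup>2) \<le> 1 / 18"
    by (simp_all add: k_def field_simps)
  define B where "B = (\<lambda>((x, w), (v, q)). (1 / (\<alpha> * real S)) *
     ((2 - \<gamma> + 1 / k) * Dmax + (1 / k) * \<psi> (k *\<^sub>R v) + q
      + (\<alpha> * L)\<^sup>2 / 2 * (N (x (int S) - w (int S - 1)))\<^sup>2))"
  have term_le: "inner (F u) (ergodic_avg S (x, w) - u) + gr (ergodic_avg S (x, w)) - gr u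
      \<le> B ((x, w), (v, q))"
    if st: "((x, w), (v, q)) \<in> set_pmf (aug_run S)" and u: "u \<in> C \<inter> edom K g" for x w v q u
  proof -
    have "k * inner v (u - x0) \<le> \<psi> (k *\<^sub>R v) + Dmax"
      using \<psi>(3)[OF edom_gf, of u "k *\<^sub>R v"] D_le[OF u] u by simp
    hence "inner v (u - x0) \<le> (1 / k) * (\<psi> (k *\<^sub>R v) + Dmax)" using k(1) by (simp add: field_simps)
    moreover have "(2 - \<gamma>) * D u x0 \<le> (2 - \<gamma>) * Dmax"
      using D_le[OF u] \<gamma>01 by (intro mult_left_mono) auto
    ultimately have "\<alpha> * real S * (inner (F u) (ergodic_avg S (x, w) - u) + gr (ergodic_avg S (x, w)) - gr u)
      \<le> (2 - \<gamma> + 1 / k) * Dmax + (1 / k) * \<psi> (k *\<^sub>R v) + q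
        + (\<alpha> * L)\<^sup>2 / 2 * (N (x (int S) - w (int S - 1)))\<^sup>2"
      using gap_term_le[OF st S, of u] u by (simp add: algebra_simps)
    thus ?thesis using \<alpha>_pos S by (simp add: B_def field_simps)
  qed
  have bounds: "\<bar>gap g F C (ergodic_avg S (x, w))\<bar> \<noteq> \<infinity>"
    "real_of_ereal (gap g F C (ergodic_avg S (x, w))) \<le> B ((x, w), (v, q))"
    if "((x, w), (v, q)) \<in> set_pmf (aug_run S)" for x w v q
    using gap_bounds[OF ergodic_avg_edom(1)[OF that S] CK ne term_le[OF that]] by auto
  show "\<bar>gap g F C (ergodic_avg S \<omega>)\<bar> \<noteq> \<infinity>" if \<omega>: "\<omega> \<in> set_pmf (run S)" for \<omega>
  proof -
    obtain x w v q where "((x, w), (v, q)) \<in> set_pmf (aug_run S)" "\<omega> = (x, w)"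
      using \<omega> unfolding map_fst_aug_run[symmetric] by auto
    thus ?thesis using bounds(1) by simp
  qed
  note sb = step_size_bounds[OF p p01 \<gamma> \<gamma>01(2) b_pos \<alpha>_pos \<alpha>]
  obtain \<theta> \<rho> where \<theta>: "0 < \<theta>" "\<theta> \<le> 1" "(\<alpha> * L)\<^sup>2 / \<theta> + 4 * (\<alpha>\<^sup>2 * Lbar\<^sup>2 / real b) \<le> \<rho>"
    and budget: "\<And>A C V. \<lbrakk>0 \<le> A; 0 \<le> C; 0 \<le> V; V \<le> A + C; V \<le> 2 * p * (1 + (\<alpha> * L)\<^sup>2) * A + C; C \<le> 4 * A\<rbrakk>
      \<Longrightarrow> (\<rho> + 1 / 36) * V \<le> (\<gamma> - \<theta>) * A + (1 - \<gamma>) * C"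
    by (rule ex_young_weight[OF p p01 \<gamma> \<gamma>01(2) _ _ sb(2)]) auto
  have total: "mean_residual S + \<rho> / 2 * lagw S + (1 / 36) / 2 * (\<Sum>i<S. lagw i) \<le> 0"
  proof (rule displacement_budget[where a = lag1 and c = lag2 and W = lagw and R = mean_residual
        and p = p and \<Lambda> = "(\<alpha> * L)\<^sup>2" and \<gamma> = \<gamma> and \<theta> = \<theta>])
    fix A C V :: real
    assume "0 \<le> A" "0 \<le> C" "0 \<le> V" "V \<le> A + C" "V \<le> 2 * p * (1 + (\<alpha> * L)\<^sup>2) * A + C" "C \<le> 4 * A"
    thus "(\<rho> + 1 / 36) * V \<le> (\<gamma> - \<theta>) * A + (1 - \<gamma>) * C" by (rule budget)
  next
    fix s
    have "(\<alpha> * L)\<^sup>2 / (2 * \<theta>) + 2 * \<alpha>\<^sup>2 * Lbar\<^sup>2 / real b \<le> \<rho> / 2"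
      using \<theta>(3) by (simp add: field_simps)
    hence "((\<alpha> * L)\<^sup>2 / (2 * \<theta>) + 2 * \<alpha>\<^sup>2 * Lbar\<^sup>2 / real b) * lagw s \<le> \<rho> / 2 * lagw s"
      using lag_nonneg by (intro mult_right_mono) auto
    thus "mean_residual (Suc s) \<le> mean_residual s + \<rho> / 2 * lagw s
        - (\<gamma> - \<theta>) / 2 * lag1 (Suc s) - (1 - \<gamma>) / 2 * lag2 (Suc s)"
      using mean_residual_Suc[OF \<theta>(1), of s] by linarith
  qed (use p01 lag_0 lag_nonneg lagw_Suc_le lag2_Suc_le in auto)
  have "expect (run S) (\<lambda>\<omega>. real_of_ereal (gap g F C (ergodic_avg S \<omega>)))
      = expect (aug_run S) (\<lambda>\<sigma>. real_of_ereal (gap g F C (ergodic_avg S (fst \<sigma>))))"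
    unfolding map_fst_aug_run[symmetric] by simp
  also have "\<dots> \<le> expect (aug_run S) B"
    using bounds(2) by (intro expect_mono finite_aug_run) auto
  also have "expect (aug_run S) B = (1 / (\<alpha> * real S)) * ((2 - \<gamma> + 1 / k) * Dmax
      + (1 / k) * expect (aug_run S) (\<lambda>(\<omega>, (v, q)). \<psi> (k *\<^sub>R v))
      + mean_residual S + (\<alpha> * L)\<^sup>2 / 2 * lagw S)"
    by (simp add: B_def mean_residual_def lagw_def split_def expect_add finite_aug_run)
  finally have "\<alpha> * real S * expect (run S) (\<lambda>\<omega>. real_of_ereal (gap g F C (ergodic_avg S \<omega>)))
      \<le> (2 - \<gamma> + 1 / k) * Dmax + (1 / k) * expect (aug_run S) (\<lambda>(\<omega>, (v, q)). \<psi> (k *\<^sub>R v))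
        + mean_residual S + (\<alpha> * L)\<^sup>2 / 2 * lagw S"
    using \<alpha>_pos S by (simp add: field_simps)
  also have "(1 / k) * expect (aug_run S) (\<lambda>(\<omega>, (v, q)). \<psi> (k *\<^sub>R v)) \<le> (1 / 36) / 2 * (\<Sum>i<S. lagw i)"
  proof -
    have "\<alpha>\<^sup>2 \<le> (1 / 2)\<^sup>2" using sb(1) \<alpha>_pos by (intro power_mono) auto
    hence "\<alpha>\<^sup>2 * (k * (L\<^sup>2 + Lbar\<^sup>2)) \<le> 1 / 4 * (1 / 18)"
      using k by (intro mult_mono) (auto simp: power2_eq_square)
    hence c: "k * \<alpha>\<^sup>2 * (L\<^sup>2 + Lbar\<^sup>2) \<le> (1 / 36) / 2" by (simp add: algebra_simps)
    have "(1 / k) * expect (aug_run S) (\<lambda>(\<omega>, (v, q)). \<psi> (k *\<^sub>R v))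
        \<le> (1 / k) * ((k * \<alpha>)\<^sup>2 * (L\<^sup>2 + Lbar\<^sup>2) * (\<Sum>i<S. lagw i))"
      using k by (intro mult_left_mono conjugate_growth[OF \<psi>(1,2)]) auto
    also have "\<dots> = k * \<alpha>\<^sup>2 * (L\<^sup>2 + Lbar\<^sup>2) * (\<Sum>i<S. lagw i)"
      using k(1) by (simp add: power2_eq_square field_simps)
    also have "\<dots> \<le> (1 / 36) / 2 * (\<Sum>i<S. lagw i)"
      using c by (intro mult_right_mono sum_nonneg lag_nonneg)
    finally show ?thesis .
  qed
  also have "(\<alpha> * L)\<^sup>2 / 2 * lagw S \<le> \<rho> / 2 * lagw S"
  proof -
    have "(\<alpha> * L)\<^sup>2 * 1 \<le> (\<alpha> * L)\<^sup>2 / \<theta>" using \<theta>(1,2) by (simp add: le_divide_eq mult_left_le)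
    moreover have "0 \<le> 4 * (\<alpha>\<^sup>2 * Lbar\<^sup>2 / real b)" by simp
    ultimately have "(\<alpha> * L)\<^sup>2 \<le> \<rho>" using \<theta>(3) by linarith
    thus ?thesis using lag_nonneg(3)[of S] by (intro mult_right_mono) auto
  qed
  finally have "\<alpha> * real S * expect (run S) (\<lambda>\<omega>. real_of_ereal (gap g F C (ergodic_avg S \<omega>)))
      \<le> (2 - \<gamma> + 1 / k) * Dmax" using total by linarith
  also have "\<dots> \<le> (3 + 18 * (L\<^sup>2 + Lbar\<^sup>2)) * Dmax"
    using Dmax0 \<gamma>01 k(2) by (intro mult_right_mono) auto
  finally show "\<alpha> * real S * expect (run S) (\<lambda>\<omega>. real_of_ereal (gap g F C (ergodic_avg S \<omega>)))
      \<le> (3 + 18 * (L\<^sup>2 + Lbar\<^sup>2)) * Dmax" .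
qed

end

section \<open>The rate and the complexity\<close>

theorem corollary3p1:
  shows "\<exists>c :: real \<Rightarrow> real \<Rightarrow> real \<Rightarrow> real.
    \<forall>(N :: 'a::euclidean_space \<Rightarrow> real) K g f f' F Fc Fo Q M b L Lbar p \<gamma> \<alpha> x0 C Dmax.
      is_norm N \<longrightarrow>
      K \<noteq> {} \<longrightarrow> closed K \<longrightarrow> convex K \<longrightarrow>
      proper_on K g \<longrightarrow> econvex_on K g \<longrightarrow> lsc_on K g \<longrightarrow>
      distance_generating N K g f f' \<longrightarrow>
      (\<forall>z\<in>edom K g. F z = (1 / real M) *\<^sub>R (\<Sum>i=1..M. Fc i z)) \<longrightarrow>
      vi_solutions K g F \<noteq> {} \<longrightarrow>
      monotone_operator_on (edom K g) F \<longrightarrow>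
      variable_lipschitz_oracle N Lbar (edom K g) M F Fo Q \<longrightarrow>
      lipschitz_operator_on N L (edom K g) F \<longrightarrow>
      1 \<le> b \<longrightarrow> b \<le> M \<longrightarrow>
      0 < p \<longrightarrow> p < 1 \<longrightarrow> p < \<gamma> \<longrightarrow> \<gamma> < 1 \<longrightarrow> 0 < \<alpha> \<longrightarrow>
      p = 1 / real M \<longrightarrow>
      \<gamma> = p + 1 / sqrt (real M) \<longrightarrow>
      \<alpha> = min ((\<gamma> - p) / (2 * (1 - p)))
               ((1 - \<gamma>) * real b / ((1 - p) * (2 * Lbar\<^sup>2 + real b * L\<^sup>2))) \<longrightarrow>
      x0 \<in> edom K g \<longrightarrow>
      vr_well_defined K f f' \<gamma> (vr_run K g f f' F Fo Q b p \<gamma> \<alpha> x0) \<longrightarrow>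
      compact C \<longrightarrow> C \<subseteq> K \<longrightarrow>
      (SUP u\<in>C \<inter> edom K g. bregman f f' u x0) = ereal Dmax \<longrightarrow>
      (let run = vr_run K g f f' F Fo Q b p \<gamma> \<alpha> x0;
           Gap = (\<lambda>S \<omega>. gap g F C (ergodic_avg S \<omega>));
           EGap = (\<lambda>S. measure_pmf.expectation (run S) (\<lambda>\<omega>. real_of_ereal (Gap S \<omega>)))
       in (\<forall>S\<ge>1. (\<forall>\<omega>\<in>set_pmf (run S). \<bar>Gap S \<omega>\<bar> \<noteq> \<infinity>) \<and>
                  EGap S \<le> c L Lbar Dmax * (sqrt (real M) / real S)) \<and>
          (\<forall>\<epsilon>>0. \<exists>S\<ge>1. EGap S \<le> \<epsilon> \<and>
                  avg_complexity M p S \<le> c L Lbar Dmax * (real M + sqrt (real M) / \<epsilon>) \<and>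
                  (\<epsilon> \<le> 1 / sqrt (real M) \<longrightarrow>
                     avg_complexity M p S \<le> c L Lbar Dmax * (sqrt (real M) / \<epsilon>))))"
proof -
  \<comment> \<open>The first factor bounds \<open>1 / (\<alpha> sqrt M)\<close>, the second \<open>\<alpha> S\<close> times the expected gap. The witness below
    is three times larger because an iteration costs three evaluations.\<close>
  define c1 :: "real \<Rightarrow> real \<Rightarrow> real \<Rightarrow> real" where
    "c1 = (\<lambda>L Lbar Dmax. (2 + 12 * (2 * Lbar\<^sup>2 + L\<^sup>2)) * ((3 + 18 * (L\<^sup>2 + Lbar\<^sup>2)) * Dmax))"
  show ?thesis
  proof (intro exI[of _ "\<lambda>L Lbar Dmax. 3 * (1 + c1 L Lbar Dmax)"] allI impI)
    fix N :: "'a \<Rightarrow> real" and K :: "'a set" and g f :: "'a \<Rightarrow> ereal" and f' F :: "'a \<Rightarrow> 'a"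
      and Fc Fo :: "nat \<Rightarrow> 'a \<Rightarrow> 'a" and Q :: "'a \<Rightarrow> 'a \<Rightarrow> nat pmf" and M b :: nat
      and L Lbar p \<gamma> \<alpha> :: real and x0 :: 'a and C :: "'a set" and Dmax :: real
    assume geom: "is_norm N" "closed K" "convex K" "proper_on K g" "econvex_on K g" "lsc_on K g"
        "distance_generating N K g f f'"
      and op: "monotone_operator_on (edom K g) F" "variable_lipschitz_oracle N Lbar (edom K g) M F Fo Q"
        "lipschitz_operator_on N L (edom K g) F"
      and par: "1 \<le> b" "0 < p" "p < 1" "p < \<gamma>" "\<gamma> < 1" "0 < \<alpha>"
      and p: "p = 1 / real M" and \<gamma>: "\<gamma> = p + 1 / sqrt (real M)"
      and \<alpha>: "\<alpha> = min ((\<gamma> - p) / (2 * (1 - p)))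
               ((1 - \<gamma>) * real b / ((1 - p) * (2 * Lbar\<^sup>2 + real b * L\<^sup>2)))"
      and x0: "x0 \<in> edom K g" and wd: "vr_well_defined K f f' \<gamma> (vr_run K g f f' F Fo Q b p \<gamma> \<alpha> x0)"
      and C: "C \<subseteq> K" and Dmax: "(SUP u\<in>C \<inter> edom K g. bregman f f' u x0) = ereal Dmax"
    have \<gamma>0: "0 < \<gamma>" using par(2,4) by linarith
    interpret vr_method N K g f f' F Fo Q M b L Lbar p \<gamma> \<alpha> x0
      by unfold_locales (fact geom op par \<gamma>0 x0 wd)+
    define E where "E = (\<lambda>S. expect (run S) (\<lambda>\<omega>. real_of_ereal (gap g F C (ergodic_avg S \<omega>))))"
    define k where "k = c1 L Lbar Dmax"
    note eg = expected_gap_le[OF p \<gamma> \<alpha> C Dmax]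
    have M3: "3 \<le> M" by (rule three_le_M[OF p par(2,3) \<gamma> par(5)])
    have k0: "0 \<le> k" using eg(1)[of 1] by (simp add: k_def c1_def)
    have rate: "E S \<le> k * (sqrt (real M) / real S)" if S: "1 \<le> S" for S
    proof (cases "0 \<le> E S")
      case True
      let ?G = "2 + 12 * (2 * Lbar\<^sup>2 + L\<^sup>2)"
      have "E S * real S * 1 \<le> E S * real S * (\<alpha> * (sqrt (real M) * ?G))"
        using True by (intro mult_left_mono step_size_bounds(3)[OF p par(2,3) \<gamma> par(5,1,6) \<alpha>]) auto
      also have "\<dots> = (\<alpha> * real S * E S) * (sqrt (real M) * ?G)" by simp
      also have "\<dots> \<le> ((3 + 18 * (L\<^sup>2 + Lbar\<^sup>2)) * Dmax) * (sqrt (real M) * ?G)"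
        using eg(3)[OF S] unfolding E_def by (intro mult_right_mono) auto
      also have "\<dots> = k * sqrt (real M)" by (simp add: k_def c1_def)
      finally show ?thesis using S by (simp add: field_simps)
    next
      case False
      moreover have "0 \<le> k * (sqrt (real M) / real S)" using k0 by simp
      ultimately show ?thesis by linarith
    qed
    have all: "E S \<le> 3 * (1 + k) * (sqrt (real M) / real S)" if "1 \<le> S" for S
      using rate[OF that] k0 mult_right_mono[of k "3 * (1 + k)" "sqrt (real M) / real S"] by simp
    have complexity: "\<exists>S\<ge>1. E S \<le> \<epsilon> \<and>
        avg_complexity M p S \<le> 3 * (1 + k) * (real M + sqrt (real M) / \<epsilon>) \<and>
        (\<epsilon> \<le> 1 / sqrt (real M) \<longrightarrow> avg_complexity M p S \<le> 3 * (1 + k) * (sqrt (real M) / \<epsilon>))"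
      if \<epsilon>: "0 < \<epsilon>" for \<epsilon>
    proof -
      define X where "X = sqrt (real M) / \<epsilon>"
      define S where "S = max 1 (nat \<lceil>k * X\<rceil>)"
      have X: "0 \<le> X" using \<epsilon> by (simp add: X_def)
      have S1: "1 \<le> S" by (simp add: S_def)
      have kX: "0 \<le> k * X" using k0 X by simp
      have S_ge: "k * X \<le> real S" using real_nat_ceiling_ge[of "k * X"] by (simp add: S_def max_def)
      have "real (nat \<lceil>k * X\<rceil>) = of_int \<lceil>k * X\<rceil>" using kX by simp
      hence "real (nat \<lceil>k * X\<rceil>) \<le> k * X + 1"
        using ceiling_correct[of "k * X"] by linarith
      hence S_le: "real S \<le> k * X + 1" using kX by (simp add: S_def max_def)
      have "k * (sqrt (real M) / real S) \<le> \<epsilon>"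
        using S_ge S1 \<epsilon> by (simp add: X_def field_simps)
      hence gap: "E S \<le> \<epsilon>" using rate[OF S1] by linarith
      have "p * real M = 1" using p M3 by simp
      hence "avg_complexity M p S = real M + 2 + 3 * real S" by (simp add: avg_complexity_def)
      hence cost: "avg_complexity M p S \<le> 3 * real M + 3 * (k * X)" using S_le M3 by simp
      also have "\<dots> \<le> 3 * (1 + k) * (real M + X)" using k0 X by (simp add: algebra_simps)
      finally have 1: "avg_complexity M p S \<le> 3 * (1 + k) * (real M + X)" .
      have 2: "avg_complexity M p S \<le> 3 * (1 + k) * X" if small: "\<epsilon> \<le> 1 / sqrt (real M)"
      proof -
        have "\<epsilon> * sqrt (real M) \<le> 1" using small M3 by (simp add: field_simps)
        hence "(\<epsilon> * sqrt (real M)) * sqrt (real M) \<le> 1 * sqrt (real M)" by (intro mult_right_mono) auto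
        hence "real M \<le> X" using \<epsilon> by (simp add: X_def field_simps)
        thus ?thesis using cost by (simp add: algebra_simps)
      qed
      show ?thesis using S1 gap 1 2 unfolding X_def by (intro exI[of _ S] conjI impI)
    qed
    have "(\<forall>S\<ge>1. (\<forall>\<omega>\<in>set_pmf (run S). \<bar>gap g F C (ergodic_avg S \<omega>)\<bar> \<noteq> \<infinity>) \<and>
                  E S \<le> 3 * (1 + k) * (sqrt (real M) / real S)) \<and>
          (\<forall>\<epsilon>>0. \<exists>S\<ge>1. E S \<le> \<epsilon> \<and>
                  avg_complexity M p S \<le> 3 * (1 + k) * (real M + sqrt (real M) / \<epsilon>) \<and>
                  (\<epsilon> \<le> 1 / sqrt (real M) \<longrightarrow>
                     avg_complexity M p S \<le> 3 * (1 + k) * (sqrt (real M) / \<epsilon>)))"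
      by (intro conjI allI impI ballI eg(2) all complexity)
    thus "let run = vr_run K g f f' F Fo Q b p \<gamma> \<alpha> x0;
           Gap = (\<lambda>S \<omega>. gap g F C (ergodic_avg S \<omega>));
           EGap = (\<lambda>S. measure_pmf.expectation (run S) (\<lambda>\<omega>. real_of_ereal (Gap S \<omega>)))
       in (\<forall>S\<ge>1. (\<forall>\<omega>\<in>set_pmf (run S). \<bar>Gap S \<omega>\<bar> \<noteq> \<infinity>) \<and>
                  EGap S \<le> 3 * (1 + c1 L Lbar Dmax) * (sqrt (real M) / real S)) \<and>
          (\<forall>\<epsilon>>0. \<exists>S\<ge>1. EGap S \<le> \<epsilon> \<and>
                  avg_complexity M p S \<le> 3 * (1 + c1 L Lbar Dmax) * (real M + sqrt (real M) / \<epsilon>) \<and>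
                  (\<epsilon> \<le> 1 / sqrt (real M) \<longrightarrow>
                     avg_complexity M p S \<le> 3 * (1 + c1 L Lbar Dmax) * (sqrt (real M) / \<epsilon>)))"
      unfolding Let_def E_def k_def .
  qed
qed

end
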